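(* Let $\tau\in\mathbb C$ with $\mathrm{Im}\,\tau>0$, $r$ a rational number, $l$ a positive integer, and $V=\begin{pmatrix}a&b\\c&d\end{pmatrix}\in\mathrm{SL}_2(\mathbb Z)$ with $j(V;r)\ne0$. Let $M\in\mathrm M_2(\mathbb R)$ have rows $\vec x=(x',x)$, $\vec y=(y',y)$ with $\vec y\notin\mathbb Z^2$, $c\vec x+d\vec y\notin\mathbb Z^2$ and $d(r)\vec x-n(r)\vec y\notin\mathbb Z^2$. Then $$S_{1,l}(r,M;\tau)-j(V;r)^{l-1}S_{1,l}(Vr,VM;\tau)=\frac{(-1)^l\,l!}{(2\pi i)^{l+1}}R_V(l,r,M;\tau)-\frac{(-1)^l\,l}{l+1}\,\frac{c}{j(V;r)}\,\frac{B_{l+1}(d(r)\vec x-n(r)\vec y;\tau)}{d(r)^{l+1}}.$$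
   Context: Notation: $\mathrm e(x)=e^{2\pi i x}$. $\theta(x;\tau)=\sum_{m\in\mathbb Z}\mathrm e\big(\tfrac12(m+\tfrac12)^2\tau+(m+\tfrac12)(x+\tfrac12)\big)$, $\theta'$ its $x$-derivative. For $\vec x=(x',x)\in\mathbb R^2\setminus\mathbb Z^2$: $\underline F(\vec x;X;\tau)=\mathrm e(xX)\frac{\theta'(0;\tau)\theta(-x'+x\tau+X;\tau)}{\theta(-x'+x\tau;\tau)\theta(X;\tau)}$. Elliptic Bernoulli functions $B_m(\vec x;\tau)$ ($m\ge0$) are defined by $\underline F(\vec x;X;\tau)=\sum_{m\ge0}\frac{B_m(\vec x;\tau)}{m!}(2\pi i)^mX^{m-1}$ near $X=0$; they are $\mathbb Z^2$-periodic and for $m\notin\{1,2\}$ extend continuously to $\mathbb R^2$ (defining them on $\mathbb Z^2$). For rational $r$, $n(r)\in\mathbb Z$, $d(r)\in\mathbb Z_{>0}$ are coprime with $r=n(r)/d(r)$. For $M$ with rows $\vec x,\vec y$ and $m,n\ge0$: $S_{m,n}(r,M;\tau)=\frac1{d(r)}\sum_{(j',j)\in(\mathbb Z/d(r)\mathbb Z)^2}B_m\big(\frac{\vec j+\vec y}{d(r)};\tau\big)B_n\big(n(r)\frac{\vec j+\vec y}{d(r)}-\vec x;\tau\big)$, $\vec j=(j',j)$, assuming $\vec y,\ n(r)\vec y-d(r)\vec x\notin\mathbb Z^2$ when $m$ or $n\in\{1,2\}$. For $V=\begin{pmatrix}a&b\\c&d\end{pmatrix}\in\mathrm{SL}_2(\mathbb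 Z)$: $Vz=(az+b)/(cz+d)$, $j(V;z)=cz+d$, $VM$ is the matrix with rows $a\vec x+b\vec y$, $c\vec x+d\vec y$. For $M$ with $\vec y,\ c\vec x+d\vec y\notin\mathbb Z^2$: $R_V(l,z,M;\tau)=\frac{(2\pi i)^{l+1}}{(l+1)!}\sum_{k=-1}^{l}\binom{l+1}{k+1}(-j(V;z))^kS_{k+1,l-k}\big(\frac dc,\begin{pmatrix}-\vec x\\\vec y\end{pmatrix};\tau\big)$ if $c>0$; $R_V=0$ if $c=0$; $R_V=R_{-V}$ if $c<0$. *)

theory Defs
  imports "HOL-Complex_Analysis.Complex_Analysis"
begin

definition ee :: "complex \<Rightarrow> complex" where
  "ee z = exp (2 * of_real pi * \<i> * z)"

definition theta :: "complex \<Rightarrow> complex \<Rightarrow> complex" where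
  "theta z \<tau> = (\<Sum>\<^sub>\<infinity>m\<in>(UNIV :: int set).
     ee (1/2 * (of_int m + 1/2)\<^sup>2 * \<tau> + (of_int m + 1/2) * (z + 1/2)))"

definition theta' :: "complex \<Rightarrow> complex \<Rightarrow> complex" where
  "theta' z \<tau> = deriv (\<lambda>w. theta w \<tau>) z"

definition Z2 :: "(real ^ 2) set" where
  "Z2 = {v. \<forall>i. v $ i \<in> \<int>}"

text \<open>A vector \<open>(x', x)\<close> is encoded by \<open>v\<close> with \<open>v $ 1 = x'\<close> and \<open>v $ 2 = x\<close>.\<close>

definition Fgen :: "real ^ 2 \<Rightarrow> complex \<Rightarrow> complex \<Rightarrow> complex" where
  "Fgen v X \<tau> =
     (let w = - of_real (v $ 1) + of_real (v $ 2) * \<tau>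
      in ee (of_real (v $ 2) * X) *
         (theta' 0 \<tau> * theta (w + X) \<tau>) / (theta w \<tau> * theta X \<tau>))"

text \<open>Off the lattice, \<open>B\<^sub>m / m! * (2 \<pi> i)^m\<close> is the coefficient of \<open>X^(m - 1)\<close> in the
  Laurent expansion of \<open>Fgen\<close> at \<open>X = 0\<close>.\<close>

definition ellB0 :: "nat \<Rightarrow> real ^ 2 \<Rightarrow> complex \<Rightarrow> complex" where
  "ellB0 m v \<tau> = fact m / (2 * of_real pi * \<i>) ^ m *
     fls_nth (laurent_expansion (\<lambda>X. Fgen v X \<tau>) 0) (int m - 1)"

text \<open>On the lattice, the value is the continuous extension, which exists only
  for \<open>m \<notin> {1, 2}\<close>. The limit avoids \<open>Z2\<close> since \<open>Z2\<close> is discrete.\<close>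

definition ellB :: "nat \<Rightarrow> real ^ 2 \<Rightarrow> complex \<Rightarrow> complex" where
  "ellB m v \<tau> =
     (if v \<notin> Z2 then ellB0 m v \<tau>
      else if m \<in> {1, 2} then undefined
      else Lim (at v) (\<lambda>u. ellB0 m u \<tau>))"

definition rnum :: "rat \<Rightarrow> int" where
  "rnum r = fst (quotient_of r)"

definition rden :: "rat \<Rightarrow> int" where
  "rden r = snd (quotient_of r)"

text \<open>Rows of a matrix \<open>M\<close> are \<open>M $ 1\<close> and \<open>M $ 2\<close>.\<close>

definition SS :: "nat \<Rightarrow> nat \<Rightarrow> rat \<Rightarrow> real ^ 2 ^ 2 \<Rightarrow> complex \<Rightarrow> complex" where
  "SS m n r M \<tau> =
     1 / of_int (rden r) *
     (\<Sum>(j', j) \<in> {0..<rden r} \<times> {0..<rden r}.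
        let u = (vector [of_int j', of_int j] + M $ 2) /\<^sub>R of_int (rden r)
        in ellB m u \<tau> * ellB n (of_int (rnum r) *\<^sub>R u - M $ 1) \<tau>)"

definition jfac :: "int ^ 2 ^ 2 \<Rightarrow> 'a::field \<Rightarrow> 'a" where
  "jfac V z = of_int (V $ 2 $ 1) * z + of_int (V $ 2 $ 2)"

definition moebius_act :: "int ^ 2 ^ 2 \<Rightarrow> 'a::field \<Rightarrow> 'a" where
  "moebius_act V z = (of_int (V $ 1 $ 1) * z + of_int (V $ 1 $ 2)) / jfac V z"

definition lmul :: "int ^ 2 ^ 2 \<Rightarrow> real ^ 2 ^ 2 \<Rightarrow> real ^ 2 ^ 2" where
  "lmul V M = map_matrix of_int V ** M"

definition RR_pos :: "int ^ 2 ^ 2 \<Rightarrow> nat \<Rightarrow> complex \<Rightarrow> real ^ 2 ^ 2 \<Rightarrow> complex \<Rightarrow> complex" where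
  "RR_pos V l z M \<tau> =
     (2 * of_real pi * \<i>) ^ (l + 1) / fact (l + 1) *
     (\<Sum>k \<in> {-1..int l}.
        of_nat ((l + 1) choose nat (k + 1)) * (- jfac V z) powi k *
        SS (nat (k + 1)) (nat (int l - k)) (of_int (V $ 2 $ 2) / of_int (V $ 2 $ 1))
           (vector [- (M $ 1), M $ 2]) \<tau>)"

definition RR :: "int ^ 2 ^ 2 \<Rightarrow> nat \<Rightarrow> complex \<Rightarrow> real ^ 2 ^ 2 \<Rightarrow> complex \<Rightarrow> complex" where
  "RR V l z M \<tau> =
     (if V $ 2 $ 1 > 0 then RR_pos V l z M \<tau>
      else if V $ 2 $ 1 = 0 then 0
      else RR_pos (- V) l z M \<tau>)"

end

theory Submission
  imports Defs
begin

text \<open>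
  Write \<open>F(v; X)\<close> for \<open>Fgen v X \<tau>\<close>. By Liouville's theorem a meromorphic function with unimodular
  multipliers under \<open>1\<close> and \<open>\<tau>\<close>, not both trivial, vanishes as soon as it has no poles. For
  \<open>v\<close> off \<open>Z2\<close>, the multipliers of \<open>F(v; X)\<close> are of this kind and its only poles are simple ones at
  the lattice points with known residues, so every identity between such functions is checked by
  comparing multipliers and residues: periodicity in \<open>v\<close>, the distribution relation, and the Fay identity
  \<open>F(u; X) F(v; Y) = F(u; X + Y) F(v - u; Y) + F(v; X + Y) F(u - v; X)\<close>. That theta vanishes exactly on
  the lattice follows from the product formula, again by Liouville's theorem.

  For \<open>r = q/p\<close> and \<open>V r = q'/p'\<close> one has \<open>c L\<^sub>1 + p' L\<^sub>2 = p L\<^sub>3\<close> for the linear forms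
  \<open>L\<^sub>1 = p m - q n\<close>, \<open>L\<^sub>2 = n\<close>, \<open>L\<^sub>3 = c m + d n\<close>, and the three kinds of Dedekind sums in the theorem
  belong to the three pairs of these forms. Summing the Fay identity, in the variables \<open>c X\<^sub>1\<close> and
  \<open>p' X\<^sub>2\<close>, over suitable torsion points relates their generating functions; the theorem compares
  coefficients.
\<close>

subsection \<open>Elliptic functions of the second kind\<close>

text \<open>The torsion points come from reading the relation between the linear forms on
  characteristics: p' y - c (q y - p x) = p (c x + d y). Divided by p p' c it becomes
  \<open>al - be = de\<close>, the shape that the Fay identity needs for the variables c X1 and p'
  X2 with sum p X3. Each product in that identity involves two of the three characteristics, and the
  distribution relation removes the surplus denominators. The three hypotheses put y, c x + d y and
  q y - p x off \<open>Z2\<close>, hence all their division points too, so no degenerate Fay term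
  arises. The Bernoulli term is a by-product of extracting coefficients: on the line X1 = t Y, X2 =
  Y one has X3 = \<mu> Y with \<mu> = (c t + p') / p, so \<mu> = j(V;r) and d\<mu>/dt = c / p at t =
  0. The coefficient of t that yields S_{1,l} therefore also meets derivatives of powers of \<mu> at
  terms with first index 0. The summation divides by c, and reading q' / p' as the reduced fraction
  of V r requires p' > 0; this is why c = 0 and j(V;r) < 0 are treated apart.\<close>

lemma ee_0 [simp]: "ee 0 = 1"
  by (simp add: ee_def)

lemma ee_add: "ee (a + b) = ee a * ee b"
  by (simp add: ee_def distrib_left exp_add)

lemma ee_minus: "ee (- a) = inverse (ee a)"
  by (simp add: ee_def exp_minus)

lemma ee_diff: "ee (a - b) = ee a / ee b"
  by (simp add: ee_def right_diff_distrib exp_diff)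

lemma ee_nonzero [simp]: "ee a \<noteq> 0"
  by (simp add: ee_def)

lemma norm_ee: "norm (ee z) = exp (- (2 * pi * Im z))"
  by (simp add: ee_def)

lemma norm_ee_of_real [simp]: "norm (ee (of_real x)) = 1"
  by (simp add: norm_ee)

lemma ee_eq_1_iff: "ee z = 1 \<longleftrightarrow> z \<in> \<int>"
proof -
  have "ee z = 1 \<longleftrightarrow> (\<exists>n::int. 2 * of_real pi * \<i> * z = of_int (2 * n) * pi * \<i>)"
    unfolding ee_def exp_eq_1 by (auto simp: complex_eq_iff)
  also have "\<dots> \<longleftrightarrow> z \<in> \<int>"
    by (auto simp: Ints_def)
  finally show ?thesis .
qed

lemma ee_of_int [simp]: "ee (of_int n) = 1"
  by (simp add: ee_eq_1_iff)

lemma ee_1 [simp]: "ee 1 = 1"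
  using ee_of_int[of 1] by simp

lemma ee_half: "ee (1 / 2) = - 1"
  by (simp add: ee_def)

lemma ee_power: "ee z ^ n = ee (of_nat n * z)"
  by (simp add: ee_def exp_of_nat_mult [symmetric] mult_ac)

lemma ee_holomorphic [holomorphic_intros]: "f holomorphic_on S \<Longrightarrow> (\<lambda>z. ee (f z)) holomorphic_on S"
  unfolding ee_def by (intro holomorphic_intros)

lemma ee_analytic [analytic_intros]: "f analytic_on S \<Longrightarrow> (\<lambda>z. ee (f z)) analytic_on S"
  unfolding ee_def by (intro analytic_intros)

text \<open>Orthogonality of characters of Z/N. It isolates terms of the theta series and, later,
  evaluates the residues in the distribution relation.\<close>

lemma sum_ee_roots:
  fixes N m :: int
  assumes "N > 0"
  shows "(\<Sum>k\<in>{0..<N}. ee (of_int k * of_int m / of_int N)) = (if N dvd m then of_int N else 0)"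
proof -
  define w where "w = ee (of_int m / of_int N)"
  have "(\<Sum>k\<in>{0..<N}. ee (of_int k * of_int m / of_int N)) = (\<Sum>k<nat N. w ^ k)"
    by (rule sum.reindex_bij_witness[of _ int nat])
       (use assms in \<open>auto simp: w_def ee_power\<close>)
  moreover have "w = 1 \<longleftrightarrow> N dvd m"
  proof
    assume "w = 1"
    then obtain n where "of_int m / of_int N = (of_int n :: complex)"
      by (auto simp: w_def ee_eq_1_iff Ints_def)
    hence "of_int m = (of_int (n * N) :: complex)"
      using assms by (simp add: field_simps)
    hence "m = n * N"
      by (simp only: of_int_eq_iff)
    thus "N dvd m"
      by simp
  qed (use assms in \<open>auto simp: w_def elim!: dvdE\<close>)
  moreover have "w ^ nat N = 1"
    using assms by (simp add: w_def ee_power)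
  ultimately show ?thesis
    using assms by (simp add: sum_gp_strict)
qed

section \<open>Liouville's theorem for functions with constant multipliers\<close>

lemma quasi_period_int:
  fixes f :: "complex \<Rightarrow> complex"
  assumes "\<And>z. f (z + w) = s * f z" "s \<noteq> 0"
  shows "f (z + of_int n * w) = s powi n * f z"
proof (induction n arbitrary: z rule: int_induct[where k = 0])
  case base
  then show ?case by simp
next
  case (step1 i)
  have "f (z + of_int (i + 1) * w) = f (z + of_int i * w + w)"
    by (simp add: algebra_simps)
  then show ?case
    using step1 assms by (simp add: power_int_add)
next
  case (step2 i)
  have "s * f (z + of_int (i - 1) * w) = f (z + of_int (i - 1) * w + w)"
    using assms by simp
  also have "\<dots> = f (z + of_int i * w)"
    by (simp add: algebra_simps)
  finally show ?case
    using step2 assms by (simp add: power_int_diff field_simps)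
qed

text \<open>The limit condition makes every singularity removable, and unimodular multipliers make
  the modulus of the entire extension doubly periodic, hence bounded. The value of \<open>f\<close>
  at a removable point is arbitrary, so the conclusion speaks only of points of analyticity.\<close>

lemma elliptic_second_kind_constant:
  fixes f :: "complex \<Rightarrow> complex"
  assumes tau: "Im \<tau> > 0" and mero: "f meromorphic_on UNIV"
    and s: "\<And>z. f (z + 1) = s * f z" "norm s = 1"
    and t: "\<And>z. f (z + \<tau>) = t * f z" "norm t = 1"
    and no_pole: "\<And>a. ((\<lambda>z. (z - a) * f z) \<longlongrightarrow> 0) (at a)"
  obtains C where "\<And>z. f analytic_on {z} \<Longrightarrow> f z = C" "s \<noteq> 1 \<or> t \<noteq> 1 \<Longrightarrow> C = 0"
proof -
  have iso: "isolated_singularity_at f a" for a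
    by (rule meromorphic_on_isolated_singularity[OF meromorphic_on_subset[OF mero]]) auto
  have "\<exists>c. f \<midarrow>a\<rightarrow> c" for a
  proof -
    obtain r where r: "r > 0" "f analytic_on ball a r - {a}"
      using iso[of a] by (auto simp: isolated_singularity_at_def)
    have "f holomorphic_on ball a r - {a}"
      using r(2) by (simp add: analytic_imp_holomorphic)
    then obtain g where g: "g holomorphic_on ball a r" "\<And>z. z \<in> ball a r - {a} \<Longrightarrow> g z = f z"
      using holomorphic_on_extend_lim[of f "ball a r" a] no_pole[of a] r(1) by auto
    have "continuous_on (ball a r) g"
      using g(1) by (rule holomorphic_on_imp_continuous_on)
    hence "isCont g a"
      using r(1) by (simp add: continuous_on_eq_continuous_at)
    hence "g \<midarrow>a\<rightarrow> g a"
      by (rule isContD)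
    moreover have "eventually (\<lambda>z. g z = f z) (at a)"
      using eventually_at_in_open[of "ball a r" a] r(1) g(2) by (auto elim!: eventually_mono)
    ultimately have "f \<midarrow>a\<rightarrow> g a"
      by (rule Lim_transform_eventually)
    thus ?thesis ..
  qed
  then obtain g where g: "\<And>a. f \<midarrow>a\<rightarrow> g a"
    by metis
  have g_eq: "g = remove_sings f"
    by (intro ext remove_sings_eqI[symmetric] g)
  have ana: "g analytic_on {a}" for a
    unfolding g_eq by (rule remove_sings_analytic_at[OF iso g])
  have hol: "g holomorphic_on UNIV"
    using ana analytic_on_analytic_at[of g UNIV] by (auto intro: analytic_imp_holomorphic)
  have g_shift: "g (z + w) = k * g z" if "\<And>z. f (z + w) = k * f z" for z w k
  proof -
    have "(\<lambda>h. f (z + w + h)) \<midarrow>0\<rightarrow> g (z + w)"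
      using g[of "z + w"] by (simp add: at_to_0' filterlim_filtermap add_ac)
    moreover have "(\<lambda>h. k * f (z + h)) \<midarrow>0\<rightarrow> k * g z"
      using g[of z] by (intro tendsto_intros) (simp add: at_to_0' filterlim_filtermap add_ac)
    moreover have "f (z + w + h) = k * f (z + h)" for h
      using that[of "z + h"] by (simp add: add_ac)
    ultimately show ?thesis
      using tendsto_unique[of "at (0::complex)"] by simp
  qed
  have g1: "norm (g (z + of_int n)) = norm (g z)" for z n
    using quasi_period_int[of g 1 s z n] g_shift[OF s(1)] s(2)
    by (fastforce simp: norm_mult norm_power_int)
  have g2: "norm (g (z + of_int n * \<tau>)) = norm (g z)" for z n
    using quasi_period_int[of g \<tau> t z n] g_shift[OF t(1)] t(2)
    by (fastforce simp: norm_mult norm_power_int)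
  \<comment> \<open>A rectangle of width 1 and height Im \<tau> replaces the period parallelogram:
    the multiple of \<tau> is read off the imaginary part, and only then the integer off the real
    part.\<close>
  have "bounded (g ` cbox 0 (Complex 1 (Im \<tau>)))"
    by (intro compact_imp_bounded compact_continuous_image holomorphic_on_imp_continuous_on
        holomorphic_on_subset[OF hol]) auto
  then obtain B where B: "\<And>z. z \<in> cbox 0 (Complex 1 (Im \<tau>)) \<Longrightarrow> norm (g z) \<le> B"
    by (auto simp: bounded_iff)
  have "norm (g z) \<le> B" for z
  proof -
    define n where "n = \<lfloor>Im z / Im \<tau>\<rfloor>"
    define m where "m = \<lfloor>Re (z - of_int n * \<tau>)\<rfloor>"
    define w where "w = z - of_int n * \<tau> - of_int m"
    have "0 \<le> Re w" "Re w \<le> 1"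
      unfolding w_def m_def by (simp_all, linarith+)
    moreover have "of_int n * Im \<tau> \<le> Im z" "Im z \<le> (of_int n + 1) * Im \<tau>"
      unfolding n_def using tau by (auto simp: floor_divide_lower intro!: less_imp_le floor_divide_upper)
    hence "0 \<le> Im w" "Im w \<le> Im \<tau>"
      by (simp_all add: w_def algebra_simps)
    ultimately have "w \<in> cbox 0 (Complex 1 (Im \<tau>))"
      by (simp add: in_cbox_complex_iff)
    hence "norm (g w) \<le> B"
      by (rule B)
    moreover have "z = (w + of_int m) + of_int n * \<tau>"
      by (simp add: w_def)
    ultimately show ?thesis
      using g1 g2 by metis
  qed
  hence "bounded (range g)"
    by (auto simp: bounded_iff)
  with hol have "g constant_on UNIV"
    by (intro Liouville_theorem)
  then obtain C where C: "\<And>z. g z = C"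
    by (auto simp: constant_on_def)
  show ?thesis
  proof
    show "f z = C" if "f analytic_on {z}" for z
      using that C[of z] by (simp add: g_eq)
    show "C = 0" if "s \<noteq> 1 \<or> t \<noteq> 1"
      using that g_shift[OF s(1), of 0] g_shift[OF t(1), of 0] C by auto
  qed
qed

text \<open>Translation by a quasi-period multiplies the limit by the multiplier. With
  \<open>L = 0\<close> it spreads the absence of a pole over a lattice coset, otherwise it
  transports residues.\<close>

lemma no_pole_shift:
  fixes f :: "complex \<Rightarrow> complex"
  assumes "\<And>z. f (z + w) = k * f z" "((\<lambda>z. (z - a) * f z) \<longlongrightarrow> L) (at a)"
  shows "((\<lambda>z. (z - (a + w)) * f z) \<longlongrightarrow> k * L) (at (a + w))"
proof -
  have "((\<lambda>z. k * ((a + z - a) * f (a + z))) \<longlongrightarrow> k * L) (at 0)"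
    using assms(2) by (intro tendsto_intros) (simp add: at_to_0' filterlim_filtermap add_ac)
  moreover have "(\<lambda>z. k * ((a + z - a) * f (a + z))) = (\<lambda>z. (a + w + z - (a + w)) * f (a + w + z))"
    using assms(1)[of "a + _"] by (auto simp: add_ac)
  ultimately have "((\<lambda>z. (a + w + z - (a + w)) * f (a + w + z)) \<longlongrightarrow> k * L) (at 0)"
    by (simp only:)
  thus ?thesis
    by (simp only: at_to_0[of "a + w"] filterlim_filtermap) (simp only: add_ac)
qed

subsection \<open>The theta function and its product formula\<close>

definition period_lattice :: "complex \<Rightarrow> complex set" where
  "period_lattice \<tau> = {of_int m + of_int n * \<tau> | m n. True}"

lemma period_latticeI [intro]: "of_int m + of_int n * \<tau> \<in> period_lattice \<tau>"
  by (auto simp: period_lattice_def)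

definition theta_term :: "complex \<Rightarrow> int \<Rightarrow> complex \<Rightarrow> complex" where
  "theta_term \<tau> m z = ee (1/2 * (of_int m + 1/2)\<^sup>2 * \<tau> + (of_int m + 1/2) * (z + 1/2))"

lemma theta_altdef: "theta z \<tau> = (\<Sum>\<^sub>\<infinity>m. theta_term \<tau> m z)"
  by (simp add: theta_def theta_term_def)

lemma infsum_finite_sum:
  fixes f :: "'b \<Rightarrow> 'a \<Rightarrow> complex"
  assumes "finite K" "\<And>k. k \<in> K \<Longrightarrow> f k summable_on A"
  shows "(\<Sum>\<^sub>\<infinity>x\<in>A. \<Sum>k\<in>K. f k x) = (\<Sum>k\<in>K. infsum (f k) A)"
proof (rule infsumI)
  show "((\<lambda>x. \<Sum>k\<in>K. f k x) has_sum (\<Sum>k\<in>K. infsum (f k) A)) A"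
    using assms by (induction K rule: finite_induct) (auto intro!: has_sum_add)
qed

lemma summable_on_exp_neg_abs: "(\<lambda>m::int. exp (- \<bar>real_of_int m\<bar>)) summable_on UNIV"
proof -
  have "summable (\<lambda>n. exp (-1) ^ n :: real)"
    by (rule summable_geometric) simp
  hence *: "(\<lambda>n. exp (- real n)) summable_on UNIV"
    by (subst summable_on_UNIV_nonneg_real_iff) (simp_all add: exp_of_nat_mult [symmetric])
  have "(\<lambda>m::int. exp (- \<bar>real_of_int m\<bar>)) summable_on (range int)"
    using * by (subst summable_on_reindex) (auto simp: o_def)
  moreover have "(\<lambda>m::int. exp (- \<bar>real_of_int m\<bar>)) summable_on (range (\<lambda>n. - int n))"
    using * by (subst summable_on_reindex) (auto simp: o_def inj_def)
  ultimately have "(\<lambda>m::int. exp (- \<bar>real_of_int m\<bar>)) summable_on (range int \<union> range (\<lambda>n. - int n))"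
    by (rule summable_on_union)
  moreover have "m \<in> range int \<union> range (\<lambda>n. - int n)" for m
    by (cases m rule: int_cases2) auto
  hence "range int \<union> range (\<lambda>n. - int n) = UNIV"
    by blast
  ultimately show ?thesis
    by simp
qed

text \<open>Completing the square bounds the Gaussian exponent - A t^2 + B |t| by B^2 / (4 A). The
  summand 1 in B = 2 pi R + 1 pays for the decay in |t|, and the extra 1/2 for passing from |t| to
  |m|. The constant depends on z only through R, as the M-test on discs requires.\<close>

lemma theta_term_bound:
  assumes tau: "Im \<tau> > 0" and R: "\<bar>Im z\<bar> \<le> R"
  shows "norm (theta_term \<tau> m z) \<le>
    exp ((2 * pi * R + 1)\<^sup>2 / (4 * (pi * Im \<tau>)) + 1 / 2) * exp (- \<bar>real_of_int m\<bar>)"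
proof -
  define t where "t = real_of_int m + 1 / 2"
  define A where "A = pi * Im \<tau>"
  define B where "B = 2 * pi * R + 1"
  have A: "A > 0"
    using tau by (simp add: A_def)
  have "(of_int m + 1 / 2 :: complex) = of_real t"
    by (simp add: t_def)
  hence "norm (theta_term \<tau> m z) = exp (- (2 * pi * (1 / 2 * t\<^sup>2 * Im \<tau> + t * Im z)))"
    unfolding theta_term_def norm_ee by (simp add: power2_eq_square)
  also have "- (2 * pi * (1 / 2 * t\<^sup>2 * Im \<tau> + t * Im z)) = - A * t\<^sup>2 - 2 * pi * (t * Im z)"
    by (simp add: A_def algebra_simps)
  also have "- (t * Im z) \<le> \<bar>t\<bar> * R"
  proof -
    have "- (t * Im z) \<le> \<bar>t\<bar> * \<bar>Im z\<bar>"
      by (simp flip: abs_mult)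
    also have "\<dots> \<le> \<bar>t\<bar> * R"
      using R by (intro mult_left_mono) auto
    finally show ?thesis .
  qed
  hence "- A * t\<^sup>2 - 2 * pi * (t * Im z) \<le> - A * t\<^sup>2 + 2 * pi * (\<bar>t\<bar> * R)"
    using mult_left_mono[of "- (t * Im z)" "\<bar>t\<bar> * R" "2 * pi"] by simp
  also have "\<dots> = - A * t\<^sup>2 + B * \<bar>t\<bar> - \<bar>t\<bar>"
    by (simp add: B_def algebra_simps)
  also have "\<dots> \<le> B\<^sup>2 / (4 * A) + 1 / 2 - \<bar>real_of_int m\<bar>"
  proof -
    have "0 \<le> (2 * A * \<bar>t\<bar> - B)\<^sup>2"
      by simp
    hence "4 * A * (- A * t\<^sup>2 + B * \<bar>t\<bar>) \<le> B\<^sup>2"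
      by (simp add: power2_eq_square algebra_simps)
    hence "- A * t\<^sup>2 + B * \<bar>t\<bar> \<le> B\<^sup>2 / (4 * A)"
      using A by (simp add: field_simps)
    moreover have "\<bar>real_of_int m\<bar> \<le> \<bar>t\<bar> + 1 / 2"
      by (simp add: t_def)
    ultimately show ?thesis
      by linarith
  qed
  finally show ?thesis
    by (simp add: A_def B_def exp_add [symmetric] add_ac)
qed

context
  fixes \<tau> :: complex
  assumes tau: "Im \<tau> > 0"
begin

lemma theta_term_abs_summable: "(\<lambda>m. norm (theta_term \<tau> m z)) summable_on UNIV"
  by (rule Infinite_Sum.abs_summable_on_comparison_test'[of "\<lambda>m. _ * exp (- \<bar>real_of_int m\<bar>)"])
     (intro summable_on_cmult_right summable_on_exp_neg_abs, rule theta_term_bound[OF tau order_refl])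

lemma theta_holomorphic: "(\<lambda>z. theta z \<tau>) holomorphic_on A"
proof -
  have "(\<lambda>z. theta z \<tau>) holomorphic_on ball z 1" for z
  proof -
    define R where "R = norm z + 1"
    have R: "\<bar>Im w\<bar> \<le> R" if "w \<in> cball z 1" for w
    proof -
      have "\<bar>Im w\<bar> \<le> norm (z + (w - z))"
        using abs_Im_le_cmod[of w] by simp
      also have "\<dots> \<le> norm z + norm (w - z)"
        by (rule norm_triangle_ineq)
      finally show ?thesis
        using that by (simp add: R_def dist_norm norm_minus_commute)
    qed
    have lim: "uniform_limit (cball z 1) (\<lambda>X w. \<Sum>m\<in>X. theta_term \<tau> m w) (\<lambda>w. \<Sum>\<^sub>\<infinity>m. theta_term \<tau> m w)
            (finite_subsets_at_top UNIV)"
      by (rule Weierstrass_m_test_general[OF theta_term_bound[OF tau R]])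
         (auto intro!: summable_on_cmult_right summable_on_exp_neg_abs)
    have *: "(\<lambda>w. \<Sum>m\<in>X. theta_term \<tau> m w) holomorphic_on B" for X B
      unfolding theta_term_def by (intro holomorphic_intros)
    hence "\<forall>\<^sub>F X in finite_subsets_at_top UNIV. continuous_on (cball z 1) (\<lambda>w. \<Sum>m\<in>X. theta_term \<tau> m w)
         \<and> (\<lambda>w. \<Sum>m\<in>X. theta_term \<tau> m w) holomorphic_on ball z 1"
      by (intro always_eventually allI conjI holomorphic_on_imp_continuous_on)
    from holomorphic_uniform_limit[OF this lim] show ?thesis
      by (simp add: theta_altdef)
  qed
  hence "(\<lambda>z. theta z \<tau>) analytic_on UNIV"
    unfolding analytic_on_def by (meson zero_less_one)
  thus ?thesis
    using analytic_imp_holomorphic holomorphic_on_subset by blast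
qed

lemma theta_analytic [analytic_intros]: "f analytic_on A \<Longrightarrow> (\<lambda>z. theta (f z) \<tau>) analytic_on A"
  using analytic_on_compose[of f A "\<lambda>z. theta z \<tau>"]
    analytic_on_subset[of "\<lambda>z. theta z \<tau>" UNIV "f ` A"] theta_holomorphic[of UNIV]
  by (simp add: o_def analytic_on_open)

lemma theta_plus_1: "theta (z + 1) \<tau> = - theta z \<tau>"
proof -
  have "theta_term \<tau> m (z + 1) = -1 * theta_term \<tau> m z" for m
  proof -
    have "theta_term \<tau> m (z + 1) = theta_term \<tau> m z * ee (of_int m + 1 / 2)"
      unfolding theta_term_def ee_add [symmetric] by (rule arg_cong[of _ _ ee]) (simp add: algebra_simps)
    thus ?thesis
      by (simp add: ee_add ee_half)
  qed
  hence "theta (z + 1) \<tau> = (\<Sum>\<^sub>\<infinity>m. -1 * theta_term \<tau> m z)"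
    unfolding theta_altdef by simp
  thus ?thesis
    unfolding theta_altdef by (simp add: infsum_uminus)
qed

lemma theta_plus_tau: "theta (z + \<tau>) \<tau> = - ee (- \<tau> / 2 - z) * theta z \<tau>"
proof -
  have "theta_term \<tau> m (z + \<tau>) = - ee (- \<tau> / 2 - z) * theta_term \<tau> (m + 1) z" for m
  proof -
    have "theta_term \<tau> m (z + \<tau>) = theta_term \<tau> (m + 1) z * ee (- \<tau> / 2 - z) * ee (- (1 / 2))"
      unfolding theta_term_def ee_add [symmetric]
      by (rule arg_cong[of _ _ ee]) (simp add: field_simps power2_eq_square)
    thus ?thesis
      by (simp add: ee_minus ee_half)
  qed
  hence "theta (z + \<tau>) \<tau> = (\<Sum>\<^sub>\<infinity>m. - ee (- \<tau> / 2 - z) * theta_term \<tau> (m + 1) z)"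
    unfolding theta_altdef by simp
  also have "\<dots> = - ee (- \<tau> / 2 - z) * (\<Sum>\<^sub>\<infinity>m. theta_term \<tau> (m + 1) z)"
    by (rule infsum_cmult_right')
  also have "(\<Sum>\<^sub>\<infinity>m. theta_term \<tau> (m + 1) z) = theta z \<tau>"
    unfolding theta_altdef
    by (rule infsum_reindex_bij_witness[of _ "\<lambda>m. m - 1" "\<lambda>m. m + 1"]) auto
  finally show ?thesis .
qed

lemma theta_uminus: "theta (- z) \<tau> = - theta z \<tau>"
proof -
  have "theta_term \<tau> m (- z) = -1 * theta_term \<tau> (- m - 1) z" for m
  proof -
    have "theta_term \<tau> m (- z) = theta_term \<tau> (- m - 1) z * ee (of_int m + 1 / 2)"
      unfolding theta_term_def ee_add [symmetric]
      by (rule arg_cong[of _ _ ee]) (simp add: field_simps power2_eq_square)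
    thus ?thesis
      by (simp add: ee_add ee_half)
  qed
  hence "theta (- z) \<tau> = (\<Sum>\<^sub>\<infinity>m. -1 * theta_term \<tau> (- m - 1) z)"
    unfolding theta_altdef by simp
  also have "\<dots> = - (\<Sum>\<^sub>\<infinity>m. theta_term \<tau> (- m - 1) z)"
    by (simp add: infsum_uminus)
  also have "(\<Sum>\<^sub>\<infinity>m. theta_term \<tau> (- m - 1) z) = theta z \<tau>"
    unfolding theta_altdef
    by (rule infsum_reindex_bij_witness[of _ "\<lambda>m. - m - 1" "\<lambda>m. - m - 1"]) auto
  finally show ?thesis .
qed

lemma theta_0: "theta 0 \<tau> = 0"
  using theta_uminus[of 0] by simp

text \<open>Averaging over the points \<open>k / N\<close> isolates the terms with \<open>N\<close> dividing the index; for large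
  \<open>N\<close> the term of index 0 dominates the others.\<close>
lemma theta_not_identically_0: "\<exists>z. theta z \<tau> \<noteq> 0"
proof (rule ccontr)
  assume "\<not> ?thesis"
  hence zero: "theta z \<tau> = 0" for z
    by blast
  define a where "a m = theta_term \<tau> m 0" for m
  have a_summable: "(\<lambda>m. norm (a m)) summable_on UNIV"
    unfolding a_def by (rule theta_term_abs_summable)
  have "norm (a 0) > 0"
    by (simp add: a_def theta_term_def)
  moreover have "((\<lambda>m. norm (a m)) has_sum (\<Sum>\<^sub>\<infinity>m. norm (a m))) UNIV"
    using a_summable by simp
  ultimately have "\<forall>\<^sub>F X in finite_subsets_at_top UNIV. dist (\<Sum>m\<in>X. norm (a m)) (\<Sum>\<^sub>\<infinity>m. norm (a m)) < norm (a 0)"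
    unfolding has_sum_def tendsto_iff by blast
  then obtain X0 where X0: "finite X0"
      "\<And>X. finite X \<Longrightarrow> X0 \<subseteq> X \<Longrightarrow> dist (\<Sum>m\<in>X. norm (a m)) (\<Sum>\<^sub>\<infinity>m. norm (a m)) < norm (a 0)"
    by (auto simp: eventually_finite_subsets_at_top)
  \<comment> \<open>Every index in \<open>X\<close> is smaller than \<open>N\<close> in modulus, so
    0 is the only multiple of \<open>N\<close> in \<open>X\<close>.\<close>
  define X where "X = insert 0 X0"
  define N where "N = Max (abs ` X) + 1"
  have finX: "finite X"
    using X0 by (simp add: X_def)
  have N: "\<bar>m\<bar> < N" if "m \<in> X" for m
    using that finX by (auto simp: N_def intro!: zle_add1_eq_le[THEN iffD2] Max_ge)
  have N0: "N > 0"
    using N[of 0] by (simp add: X_def)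
  define b where "b m = (if N dvd m then a m else 0)" for m
  have nb: "norm (b m) \<le> norm (a m)" for m
    by (simp add: b_def)
  have b_summable: "b summable_on A" for A
    by (rule summable_on_subset_banach[of _ UNIV], rule abs_summable_summable,
        rule Infinite_Sum.abs_summable_on_comparison_test'[OF a_summable]) (auto intro: nb)
  \<comment> \<open>The prefactor cancels the half in the exponent m + 1/2, which leaves genuine
    \<open>N\<close>-th roots of unity.\<close>
  have "0 = (\<Sum>k\<in>{0..<N}. ee (- (of_int k / of_int N) / 2) * theta (of_int k / of_int N) \<tau>)"
    by (simp add: zero)
  also have "\<dots> = (\<Sum>k\<in>{0..<N}. \<Sum>\<^sub>\<infinity>m. a m * ee (of_int k * of_int m / of_int N))"
  proof (rule sum.cong[OF refl])
    fix k
    have "ee (- (of_int k / of_int N) / 2) * theta_term \<tau> m (of_int k / of_int N)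
        = a m * ee (of_int k * of_int m / of_int N)" for m
      unfolding a_def theta_term_def ee_add [symmetric]
      by (rule arg_cong[of _ _ ee]) (simp add: algebra_simps add_divide_distrib)
    thus "ee (- (of_int k / of_int N) / 2) * theta (of_int k / of_int N) \<tau>
        = (\<Sum>\<^sub>\<infinity>m. a m * ee (of_int k * of_int m / of_int N))"
      unfolding theta_altdef infsum_cmult_right' [symmetric] by simp
  qed
  also have "\<dots> = (\<Sum>\<^sub>\<infinity>m. \<Sum>k\<in>{0..<N}. a m * ee (of_int k * of_int m / of_int N))"
  proof (rule infsum_finite_sum [symmetric], simp)
    fix k
    have le: "norm (a m * ee (of_int k * of_int m / of_int N)) \<le> norm (a m)" for m
      using norm_ee_of_real[of "of_int k * of_int m / of_int N"] by (simp add: norm_mult)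
    show "(\<lambda>m. a m * ee (of_int k * of_int m / of_int N)) summable_on UNIV"
      by (rule abs_summable_summable, rule Infinite_Sum.abs_summable_on_comparison_test'[OF a_summable])
         (rule le)
  qed
  also have "\<dots> = (\<Sum>\<^sub>\<infinity>m. of_int N * b m)"
    unfolding sum_distrib_left [symmetric] sum_ee_roots[OF N0] by (rule infsum_cong) (auto simp: b_def)
  also have "\<dots> = of_int N * (\<Sum>\<^sub>\<infinity>m. b m)"
    by (rule infsum_cmult_right')
  finally have "(\<Sum>\<^sub>\<infinity>m. b m) = 0"
    using N0 by simp
  moreover have "(\<Sum>\<^sub>\<infinity>m. b m) = (\<Sum>\<^sub>\<infinity>m\<in>X. b m) + (\<Sum>\<^sub>\<infinity>m\<in>-X. b m)"
    using infsum_Un_disjoint[OF b_summable b_summable, of X "-X"] by simp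
  moreover have "(\<Sum>\<^sub>\<infinity>m\<in>X. b m) = a 0"
  proof -
    have "\<not> N dvd m" if "m \<in> X" "m \<noteq> 0" for m
      using dvd_imp_le_int[OF that(2), of N] N[OF that(1)] by auto
    hence "(\<Sum>m\<in>X. b m) = (\<Sum>m\<in>X. if m = 0 then a 0 else 0)"
      by (intro sum.cong) (auto simp: b_def)
    thus ?thesis
      using finX by (simp add: X_def)
  qed
  ultimately have "norm (a 0) = norm (\<Sum>\<^sub>\<infinity>m\<in>-X. b m)"
    by (metis add_eq_0_iff norm_minus_cancel)
  also have "\<dots> \<le> (\<Sum>\<^sub>\<infinity>m\<in>-X. norm (a m))"
    by (rule norm_infsum_le[OF has_sum_infsum has_sum_infsum])
       (auto intro!: b_summable nb summable_on_subset_banach[OF a_summable])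
  also have "\<dots> = (\<Sum>\<^sub>\<infinity>m. norm (a m)) - (\<Sum>m\<in>X. norm (a m))"
    using infsum_Un_disjoint[of "\<lambda>m. norm (a m)" X "-X"] finX
      summable_on_subset_banach[OF a_summable, of "-X"] by auto
  also have "\<dots> < norm (a 0)"
  proof -
    have "X0 \<subseteq> X"
      by (auto simp: X_def)
    from X0(2)[OF finX this] show ?thesis
      unfolding dist_norm real_norm_def by linarith
  qed
  finally show False
    by simp
qed

end

section \<open>The product side: q-Pochhammer symbols and the Jacobi triple product\<close>

definition euler_prod :: "complex \<Rightarrow> complex \<Rightarrow> complex" where
  "euler_prod q w = (\<Prod>n. 1 - q ^ n * w)"

context
  fixes q :: complex
  assumes q: "norm q < 1"
begin

lemma euler_prod_convergent: "convergent_prod (\<lambda>n. 1 - q ^ n * w)"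
proof -
  have "summable (\<lambda>n. norm q ^ n * norm w)"
    using q by (intro summable_mult2 summable_geometric) auto
  hence "abs_convergent_prod (\<lambda>n. 1 + (- (q ^ n * w)))"
    by (intro summable_imp_abs_convergent_prod) (simp add: norm_mult norm_power)
  thus ?thesis
    using abs_convergent_prod_imp_convergent_prod by fastforce
qed

lemma euler_prod_LIMSEQ: "(\<lambda>N. \<Prod>n<N. 1 - q ^ n * w) \<longlonglongrightarrow> euler_prod q w"
proof -
  have "(\<lambda>N. \<Prod>n<Suc N. 1 - q ^ n * w) \<longlonglongrightarrow> euler_prod q w"
    using convergent_prod_LIMSEQ[OF euler_prod_convergent[of w]]
    unfolding euler_prod_def lessThan_Suc_atMost .
  thus ?thesis
    by (subst (asm) filterlim_sequentially_Suc)
qed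

lemma euler_prod_head: "euler_prod q w = (1 - w) * euler_prod q (q * w)"
proof -
  have "(\<Prod>n<Suc N. 1 - q ^ n * w) = (1 - w) * (\<Prod>n<N. 1 - q ^ n * (q * w))" for N
    by (subst prod.lessThan_Suc_shift) (simp add: mult_ac)
  hence "(\<lambda>N. \<Prod>n<Suc N. 1 - q ^ n * w) \<longlonglongrightarrow> (1 - w) * euler_prod q (q * w)"
    by (simp only:) (intro tendsto_intros euler_prod_LIMSEQ)
  thus ?thesis
    using euler_prod_LIMSEQ[of w] by (subst (asm) filterlim_sequentially_Suc) (rule LIMSEQ_unique)
qed

lemma euler_prod_eq_0: "euler_prod q w = 0 \<Longrightarrow> \<exists>n. q ^ n * w = 1"
  using prodinf_nonzero[OF euler_prod_convergent[of w]] unfolding euler_prod_def by fastforce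

lemma euler_prod_holomorphic: "euler_prod q holomorphic_on A"
proof -
  have "euler_prod q holomorphic_on UNIV"
  proof (rule holomorphic_uniform_sequence)
    fix z :: complex
    define R where "R = norm z + 1"
    have "uniformly_convergent_on (cball z 1) (\<lambda>N w. \<Prod>n<N. 1 + (- (q ^ n * w)))"
    proof (rule uniformly_convergent_on_prod)
      show "uniformly_convergent_on (cball z 1) (\<lambda>N w. \<Sum>n<N. norm (- (q ^ n * w)))"
      proof (rule Weierstrass_m_test')
        fix n w assume "w \<in> cball z 1"
        hence "norm w \<le> R"
          unfolding R_def using norm_triangle_ineq2[of w z] by (auto simp: dist_norm norm_minus_commute)
        thus "norm (norm (- (q ^ n * w))) \<le> norm q ^ n * R"
          by (auto simp: norm_mult norm_power intro!: mult_left_mono)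
      qed (use q in \<open>intro summable_mult2 summable_geometric, auto\<close>)
    qed (auto intro!: continuous_intros)
    then obtain g where g: "uniform_limit (cball z 1) (\<lambda>N w. \<Prod>n<N. 1 - q ^ n * w) g sequentially"
      by (auto simp: uniformly_convergent_on_def)
    have "g w = euler_prod q w" if "w \<in> cball z 1" for w
      using tendsto_uniform_limitI[OF g that] euler_prod_LIMSEQ by (rule LIMSEQ_unique)
    hence "uniform_limit (cball z 1) (\<lambda>N w. \<Prod>n<N. 1 - q ^ n * w) (euler_prod q) sequentially"
      using g by (simp add: uniform_limit_iff)
    thus "\<exists>d>0. cball z d \<subseteq> UNIV \<and>
        uniform_limit (cball z d) (\<lambda>N w. \<Prod>n<N. 1 - q ^ n * w) (euler_prod q) sequentially"
      by (intro exI[of _ 1]) auto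
  qed (auto intro!: holomorphic_intros)
  thus ?thesis
    using holomorphic_on_subset by blast
qed

lemma euler_prod_analytic [analytic_intros]: "f analytic_on A \<Longrightarrow> (\<lambda>z. euler_prod q (f z)) analytic_on A"
  using analytic_on_compose[of f A "euler_prod q"]
    analytic_on_subset[of "euler_prod q" UNIV "f ` A"] euler_prod_holomorphic[of UNIV]
  by (simp add: o_def analytic_on_open)

end

text \<open>The part of the Jacobi triple product that depends on z: w^(-1/2) (w; q) (q/w; q) with w
  = \<open>ee z\<close> and q = \<open>ee \<tau>\<close>. The constant factor is omitted because
  only zeros and their orders are read off.\<close>

definition theta_prod :: "complex \<Rightarrow> complex \<Rightarrow> complex" where
  "theta_prod \<tau> z = ee (- (z / 2)) * euler_prod (ee \<tau>) (ee z) * euler_prod (ee \<tau>) (ee \<tau> * ee (- z))"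

context
  fixes \<tau> :: complex
  assumes tau: "Im \<tau> > 0"
begin

lemma norm_ee_tau: "norm (ee \<tau>) < 1"
  using tau by (simp add: norm_ee)

lemma theta_prod_analytic: "theta_prod \<tau> analytic_on A"
  unfolding theta_prod_def by (intro analytic_intros norm_ee_tau) auto

lemma theta_prod_plus_1: "theta_prod \<tau> (z + 1) = - theta_prod \<tau> z"
  by (simp add: theta_prod_def ee_add ee_diff ee_minus ee_half add_divide_distrib)

text \<open>Replacing w by q w removes the factor 1 - w from the first product and adds 1 - 1/w to
  the second; their quotient is - 1/w.\<close>

lemma theta_prod_plus_tau: "theta_prod \<tau> (z + \<tau>) = - ee (- \<tau> / 2 - z) * theta_prod \<tau> z"
proof -
  define q w where "q = ee \<tau>" and "w = ee z"
  have q: "norm q < 1" and nz: "q \<noteq> 0" "w \<noteq> 0"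
    using norm_ee_tau by (auto simp: q_def w_def)
  have eq1: "euler_prod q w = (1 - w) * euler_prod q (q * w)"
    and eq2: "euler_prod q (1 / w) = (1 - 1 / w) * euler_prod q (q / w)"
    using euler_prod_head[OF q, of w] euler_prod_head[OF q, of "1 / w"] by simp_all
  have "theta_prod \<tau> (z + \<tau>) = ee (- (z / 2)) * ee (- \<tau> / 2) * euler_prod q (q * w) * euler_prod q (1 / w)"
  proof -
    have "ee (- ((z + \<tau>) / 2)) = ee (- (z / 2)) * ee (- \<tau> / 2)"
      unfolding ee_add [symmetric] by (rule arg_cong[of _ _ ee]) (simp add: field_simps)
    moreover have "ee (z + \<tau>) = q * w" "ee \<tau> * ee (- (z + \<tau>)) = 1 / w"
      by (simp_all add: q_def w_def ee_add ee_minus ee_diff field_simps)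
    ultimately show ?thesis
      by (simp only: theta_prod_def q_def)
  qed
  also have "\<dots> = - ee (- (z / 2)) * ee (- \<tau> / 2) / w * ((1 - w) * euler_prod q (q * w)) * euler_prod q (q / w)"
    using nz by (simp add: eq2 field_simps)
  also have "\<dots> = - ee (- \<tau> / 2 - z) * theta_prod \<tau> z"
  proof -
    have "ee (- \<tau> / 2 - z) = ee (- \<tau> / 2) / w" "ee \<tau> * ee (- z) = q / w"
      by (simp_all only: q_def w_def ee_diff ee_minus divide_inverse)
    thus ?thesis
      unfolding eq1 [symmetric] theta_prod_def by (simp add: q_def w_def)
  qed
  finally show ?thesis .
qed

lemma theta_prod_eq_0:
  assumes "theta_prod \<tau> z = 0"
  shows "z \<in> period_lattice \<tau>"
proof -
  have "(\<exists>n. ee \<tau> ^ n * ee z = 1) \<or> (\<exists>n. ee \<tau> ^ n * (ee \<tau> * ee (- z)) = 1)"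
  proof -
    have "euler_prod (ee \<tau>) (ee z) = 0 \<or> euler_prod (ee \<tau>) (ee \<tau> * ee (- z)) = 0"
      using assms by (simp add: theta_prod_def)
    thus ?thesis
      using euler_prod_eq_0[OF norm_ee_tau] by blast
  qed
  thus ?thesis
  proof
    assume "\<exists>n. ee \<tau> ^ n * ee z = 1"
    then obtain n where "ee (of_nat n * \<tau> + z) = 1"
      by (auto simp: ee_power ee_add)
    then obtain m where "of_nat n * \<tau> + z = of_int m"
      by (auto simp: ee_eq_1_iff Ints_def)
    hence "z = of_int m + of_int (- int n) * \<tau>"
      by (simp add: algebra_simps)
    thus ?thesis by blast
  next
    assume "\<exists>n. ee \<tau> ^ n * (ee \<tau> * ee (- z)) = 1"
    then obtain n where "ee (of_nat n * \<tau> + \<tau> - z) = 1"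
      by (auto simp: ee_power ee_add ee_diff ee_minus field_simps)
    then obtain m where "of_nat n * \<tau> + \<tau> - z = of_int m"
      by (auto simp: ee_eq_1_iff Ints_def)
    hence "z = of_int (- m) + of_int (int n + 1) * \<tau>"
      by (simp add: algebra_simps)
    thus ?thesis by blast
  qed
qed

text \<open>The factor 1 - \<open>ee z\<close> carries the zero and is simple; the cofactor
  \<open>K\<close> does not vanish at 0 because |q^(n+1)| < 1 for every n.\<close>

lemma theta_prod_deriv_0: "deriv (theta_prod \<tau>) 0 \<noteq> 0" and theta_prod_0: "theta_prod \<tau> 0 = 0"
proof -
  define q where "q = ee \<tau>"
  have q: "norm q < 1"
    using norm_ee_tau by (simp add: q_def)
  define K where "K z = ee (- (z / 2)) * euler_prod q (q * ee z) * euler_prod q (q * ee (- z))" for z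
  have K: "theta_prod \<tau> z = (1 - ee z) * K z" for z
    using euler_prod_head[OF q, of "ee z"] by (simp add: theta_prod_def K_def q_def)
  thus "theta_prod \<tau> 0 = 0"
    by simp
  have "q ^ n * q \<noteq> 1" for n
  proof -
    have "norm q > 0"
      by (simp add: q_def)
    hence "norm (q ^ Suc n) < 1"
      unfolding norm_power using q by (intro power_Suc_less_one) auto
    thus ?thesis
      by (auto simp: mult.commute)
  qed
  hence "K 0 \<noteq> 0"
    using euler_prod_eq_0[OF q, of q] by (auto simp: K_def)
  moreover have "K analytic_on {0}"
    unfolding K_def by (intro analytic_intros q) auto
  hence "(K has_field_derivative deriv K 0) (at 0)"
    by (simp add: analytic_on_imp_differentiable_at DERIV_deriv_iff_field_differentiable)
  hence "(theta_prod \<tau> has_field_derivative (- (2 * of_real pi * \<i>) * K 0 + deriv K 0 * (1 - ee 0))) (at 0)"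
    unfolding K ee_def by (auto intro!: derivative_eq_intros)
  hence "deriv (theta_prod \<tau>) 0 = - (2 * of_real pi * \<i>) * K 0 + deriv K 0 * (1 - ee 0)"
    by (rule DERIV_imp_deriv)
  ultimately show "deriv (theta_prod \<tau>) 0 \<noteq> 0"
    by simp
qed

text \<open>Both sides have the same multipliers, so the quotient is doubly periodic. A pole could
  occur only at a lattice point, and by periodicity it suffices to look at 0, where the simple zero
  of the product is cancelled by the zero of theta. Liouville gives a constant, which is nonzero
  because theta is not identically zero.\<close>

lemma theta_eq_theta_prod: "\<exists>C. C \<noteq> 0 \<and> (\<forall>z. theta z \<tau> = C * theta_prod \<tau> z)"
proof -
  define f where "f z = theta z \<tau> / theta_prod \<tau> z" for z
  have mero: "f meromorphic_on UNIV"
    unfolding f_def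
    by (intro meromorphic_intros analytic_on_imp_meromorphic_on theta_analytic theta_prod_analytic tau) auto
  have f1: "f (z + 1) = 1 * f z" for z
    by (simp add: f_def theta_plus_1[OF tau] theta_prod_plus_1)
  have f2: "f (z + \<tau>) = 1 * f z" for z
    by (simp add: f_def theta_plus_tau[OF tau] theta_prod_plus_tau)
  have cont: "((\<lambda>z. theta z \<tau>) \<longlongrightarrow> theta a \<tau>) (at a)" for a
    using analytic_at_imp_isCont[of "\<lambda>z. theta z \<tau>" a] theta_analytic[OF tau, of "\<lambda>z. z" "{a}"]
    by (auto simp: isCont_def)
  have "((\<lambda>z. (z - a) * f z) \<longlongrightarrow> 0) (at a)" for a
  proof (cases "theta_prod \<tau> a = 0")
    case False
    have "((\<lambda>z. theta_prod \<tau> z) \<longlongrightarrow> theta_prod \<tau> a) (at a)"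
      using analytic_at_imp_isCont[OF theta_prod_analytic] by (simp add: isCont_def)
    hence "((\<lambda>z. (z - a) * f z) \<longlongrightarrow> (a - a) * (theta a \<tau> / theta_prod \<tau> a)) (at a)"
      unfolding f_def using False by (intro tendsto_intros cont)
    thus ?thesis by simp
  next
    case True
    have "((\<lambda>z. theta_prod \<tau> z / z) \<longlongrightarrow> deriv (theta_prod \<tau>) 0) (at 0)"
      using analytic_on_imp_differentiable_at[OF theta_prod_analytic, of 0 "{0}"]
      by (simp add: theta_prod_0 DERIV_deriv_iff_field_differentiable [symmetric] has_field_derivative_iff)
    hence "((\<lambda>z. theta z \<tau> / (theta_prod \<tau> z / z)) \<longlongrightarrow> theta 0 \<tau> / deriv (theta_prod \<tau>) 0) (at 0)"
      using theta_prod_deriv_0 by (intro tendsto_intros cont)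
    hence lim: "((\<lambda>z. (z - 0) * f z) \<longlongrightarrow> 0) (at 0)"
      by (simp add: f_def theta_0[OF tau] mult_ac)
    from theta_prod_eq_0[OF True] obtain m n where a: "a = of_int m + of_int n * \<tau>"
      by (auto simp: period_lattice_def)
    have "f (z + a) = 1 * f z" for z
      using quasi_period_int[of f 1 1 z m] quasi_period_int[of f \<tau> 1 "z + of_int m" n] f1 f2
      by (simp add: a add_ac)
    from no_pole_shift[OF this lim] show ?thesis
      by simp
  qed
  then obtain C where C: "\<And>z. f analytic_on {z} \<Longrightarrow> f z = C"
    using elliptic_second_kind_constant[OF tau mero f1 _ f2 _] by (metis norm_one)
  have eq: "theta z \<tau> = C * theta_prod \<tau> z" if "theta_prod \<tau> z \<noteq> 0" for z
  proof -
    have "f analytic_on {z}"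
      unfolding f_def using that by (intro analytic_intros theta_analytic theta_prod_analytic tau) auto
    thus ?thesis
      using C[of z] that by (simp add: f_def field_simps)
  qed
  moreover have "theta z \<tau> = C * theta_prod \<tau> z" if "theta_prod \<tau> z = 0" for z
  proof -
    from theta_prod_eq_0[OF that] obtain m n where z: "z = of_int m + of_int n * \<tau>"
      by (auto simp: period_lattice_def)
    have "theta (w + \<tau>) \<tau> = 0 \<longleftrightarrow> theta w \<tau> = 0" for w
      by (simp add: theta_plus_tau[OF tau])
    \<comment> \<open>The multiplier of theta under \<tau> varies with the point. The indicator of
      nonvanishing has the constant multiplier 1 instead.\<close>
    hence *: "theta (w + of_int n * \<tau>) \<tau> = 0 \<longleftrightarrow> theta w \<tau> = 0" for w
      using quasi_period_int[of "\<lambda>w. if theta w \<tau> = 0 then 0 else 1" \<tau> 1 w n]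
      by (auto split: if_splits)
    have "theta (of_int m) \<tau> = 0"
      using quasi_period_int[of "\<lambda>w. theta w \<tau>" 1 "-1" 0 m] theta_plus_1[OF tau] by (simp add: theta_0[OF tau])
    thus ?thesis
      using * by (simp add: z that [unfolded z])
  qed
  ultimately have eq': "theta z \<tau> = C * theta_prod \<tau> z" for z
    by blast
  moreover have "C \<noteq> 0"
    using theta_not_identically_0[OF tau] eq' by auto
  ultimately show ?thesis
    by blast
qed

lemma theta_eq_0_imp: "theta z \<tau> = 0 \<Longrightarrow> z \<in> period_lattice \<tau>"
  using theta_eq_theta_prod theta_prod_eq_0 by fastforce

lemma theta'_0_nonzero: "theta' 0 \<tau> \<noteq> 0"
proof -
  obtain C where C: "C \<noteq> 0" "\<And>z. theta z \<tau> = C * theta_prod \<tau> z"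
    using theta_eq_theta_prod by blast
  have "theta' 0 \<tau> = C * deriv (theta_prod \<tau>) 0"
    unfolding theta'_def C(2)
    by (rule deriv_cmult) (rule analytic_on_imp_differentiable_at[OF theta_prod_analytic UNIV_I])
  thus ?thesis
    using C theta_prod_deriv_0 by simp
qed

end

subsection \<open>The Kronecker function\<close>

no_notation fps_nth (infixl "$" 75)

definition ivec :: "int \<times> int \<Rightarrow> real ^ 2" where
  "ivec j = vector [of_int (fst j), of_int (snd j)]"

lemma ivec_nth [simp]: "ivec j $ 1 = of_int (fst j)" "ivec j $ 2 = of_int (snd j)"
  by (simp_all add: ivec_def)

lemma ivec_add: "ivec (j + k) = ivec j + ivec k"
  and ivec_diff: "ivec (j - k) = ivec j - ivec k"
  by (simp_all add: vec_eq_iff forall_2)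

lemma Z2_iff: "v \<in> Z2 \<longleftrightarrow> v $ 1 \<in> \<int> \<and> v $ 2 \<in> \<int>"
  by (simp add: Z2_def forall_2)

lemma Z2_iff_ivec: "v \<in> Z2 \<longleftrightarrow> (\<exists>j. v = ivec j)"
proof
  assume "v \<in> Z2"
  then obtain m n where "v $ 1 = of_int m" "v $ 2 = of_int n"
    by (auto simp: Z2_iff Ints_def)
  hence "v = ivec (m, n)"
    by (simp add: vec_eq_iff forall_2)
  thus "\<exists>j. v = ivec j" ..
qed (auto simp: Z2_iff)

lemma ivec_in_Z2 [simp]: "ivec j \<in> Z2"
  by (simp add: Z2_iff)

lemma Z2_add: "u \<in> Z2 \<Longrightarrow> v \<in> Z2 \<Longrightarrow> u + v \<in> Z2"
  and Z2_diff: "u \<in> Z2 \<Longrightarrow> v \<in> Z2 \<Longrightarrow> u - v \<in> Z2"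
  and Z2_uminus_iff [simp]: "- u \<in> Z2 \<longleftrightarrow> u \<in> Z2"
  and Z2_scale: "u \<in> Z2 \<Longrightarrow> of_int n *\<^sub>R u \<in> Z2"
  by (simp_all add: Z2_iff)

lemma Z2_add_ivec_iff [simp]: "v + ivec j \<in> Z2 \<longleftrightarrow> v \<in> Z2"
  using Z2_add[of v "ivec j"] Z2_diff[of "v + ivec j" "ivec j"] by auto

lemma ee_nth_neq_1:
  assumes "v \<notin> Z2"
  shows "ee (of_real (v $ 2)) \<noteq> 1 \<or> ee (of_real (v $ 1)) \<noteq> 1"
  using assms by (auto simp: ee_eq_1_iff Z2_iff)

definition char_point :: "complex \<Rightarrow> real ^ 2 \<Rightarrow> complex" where
  "char_point \<tau> v = - of_real (v $ 1) + of_real (v $ 2) * \<tau>"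

lemma Fgen_altdef:
  "Fgen v X \<tau> = ee (of_real (v $ 2) * X) * (theta' 0 \<tau> * theta (char_point \<tau> v + X) \<tau>) /
     (theta (char_point \<tau> v) \<tau> * theta X \<tau>)"
  by (simp add: Fgen_def char_point_def Let_def)

lemma analytic_no_pole:
  assumes "f analytic_on {a}"
  shows "((\<lambda>X. (X - a) * f X) \<longlongrightarrow> 0) (at a)"
proof -
  have "((\<lambda>X. (X - a) * f X) \<longlongrightarrow> (a - a) * f a) (at a)"
    using analytic_at_imp_isCont[OF assms] by (intro tendsto_intros) (simp add: isCont_def)
  thus ?thesis by simp
qed

section \<open>Multipliers, residues and the Fay identity\<close>

context
  fixes \<tau> :: complex
  assumes tau: "Im \<tau> > 0"
begin

lemma period_lattice_eq_iff:
  fixes m n m' n' :: real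
  shows "of_real m + of_real n * \<tau> = of_real m' + of_real n' * \<tau> \<longleftrightarrow> m = m' \<and> n = n'"
proof
  assume *: "of_real m + of_real n * \<tau> = of_real m' + of_real n' * \<tau>"
  have "n * Im \<tau> = n' * Im \<tau>"
    using arg_cong[OF *, of Im] by simp
  hence "n = n'"
    using tau by simp
  thus "m = m' \<and> n = n'"
    using * by simp
qed auto

lemma char_point_in_lattice_iff: "char_point \<tau> v \<in> period_lattice \<tau> \<longleftrightarrow> v \<in> Z2"
proof
  assume "char_point \<tau> v \<in> period_lattice \<tau>"
  then obtain m n where "char_point \<tau> v = of_int m + of_int n * \<tau>"
    by (auto simp: period_lattice_def)
  hence "- v $ 1 = of_int m" "v $ 2 = of_int n"
    using period_lattice_eq_iff[of "- v $ 1" "v $ 2" "of_int m" "of_int n"]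
    by (auto simp: char_point_def)
  thus "v \<in> Z2"
    unfolding Z2_iff by (metis Ints_of_int minus_in_Ints_iff)
next
  assume "v \<in> Z2"
  then obtain j where "v = ivec j"
    by (auto simp: Z2_iff_ivec)
  hence "char_point \<tau> v = of_int (- fst j) + of_int (snd j) * \<tau>"
    by (simp add: char_point_def)
  thus "char_point \<tau> v \<in> period_lattice \<tau>"
    by (simp only: period_latticeI)
qed

lemma theta_char_point_nonzero: "v \<notin> Z2 \<Longrightarrow> theta (char_point \<tau> v) \<tau> \<noteq> 0"
  using theta_eq_0_imp[OF tau] char_point_in_lattice_iff by blast

lemma theta_eq_0_iff: "theta z \<tau> = 0 \<longleftrightarrow> z \<in> period_lattice \<tau>"
proof
  assume "z \<in> period_lattice \<tau>"
  then obtain m n where z: "z = of_int m + of_int n * \<tau>"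
    by (auto simp: period_lattice_def)
  define f where "f w = (if theta w \<tau> = 0 then 0 else 1 :: complex)" for w
  have "f (w + \<tau>) = 1 * f w" "f (w + 1) = 1 * f w" for w
    by (simp_all add: f_def theta_plus_tau[OF tau] theta_plus_1[OF tau])
  hence "f z = f 0"
    using quasi_period_int[of f 1 1 0 m] quasi_period_int[of f \<tau> 1 "of_int m" n] by (simp add: z)
  thus "theta z \<tau> = 0"
    by (simp add: f_def theta_0[OF tau] split: if_splits)
qed (rule theta_eq_0_imp[OF tau])

text \<open>Off \<open>Z2\<close> at least one multiplier differs from 1, so the Liouville constant
  is 0. The pole condition is asked for one translate of each point only; the multipliers carry it
  to the whole coset, and each application may choose the most convenient representative.\<close>

lemma quasi_elliptic_eq_0:
  assumes v: "v \<notin> Z2" and mero: "f meromorphic_on UNIV"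
    and f1: "\<And>z. f (z + 1) = ee (of_real (v $ 2)) * f z"
    and f2: "\<And>z. f (z + \<tau>) = ee (of_real (v $ 1)) * f z"
    and no_pole: "\<And>a. \<exists>w\<in>period_lattice \<tau>. ((\<lambda>z. (z - (a - w)) * f z) \<longlongrightarrow> 0) (at (a - w))"
    and ana: "f analytic_on {X}"
  shows "f X = 0"
proof -
  have "((\<lambda>z. (z - a) * f z) \<longlongrightarrow> 0) (at a)" for a
  proof -
    obtain m n where lim: "((\<lambda>z. (z - (a - (of_int m + of_int n * \<tau>))) * f z) \<longlongrightarrow> 0) (at (a - (of_int m + of_int n * \<tau>)))"
      using no_pole[of a] by (auto simp: period_lattice_def)
    have "f (z + (of_int m + of_int n * \<tau>)) =
        ee (of_real (v $ 1)) powi n * (ee (of_real (v $ 2)) powi m) * f z" for z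
      using quasi_period_int[of f 1 "ee (of_real (v $ 2))" z m] f1 f2
        quasi_period_int[of f \<tau> "ee (of_real (v $ 1))" "z + of_int m" n] by (simp add: add_ac)
    from no_pole_shift[OF this lim] show ?thesis
      by simp
  qed
  then obtain C where "\<And>z. f analytic_on {z} \<Longrightarrow> f z = C"
      "ee (of_real (v $ 2)) \<noteq> 1 \<or> ee (of_real (v $ 1)) \<noteq> 1 \<Longrightarrow> C = 0"
    using elliptic_second_kind_constant[OF tau mero f1 norm_ee_of_real f2 norm_ee_of_real] by blast
  thus ?thesis
    using ana ee_nth_neq_1[OF v] by metis
qed

lemma Fgen_plus_1: "Fgen v (X + 1) \<tau> = ee (of_real (v $ 2)) * Fgen v X \<tau>"
proof -
  have "theta (char_point \<tau> v + (X + 1)) \<tau> = - theta (char_point \<tau> v + X) \<tau>"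
    using theta_plus_1[OF tau, of "char_point \<tau> v + X"] by (simp add: add_ac)
  moreover have "ee (of_real (v $ 2) * (X + 1)) = ee (of_real (v $ 2)) * ee (of_real (v $ 2) * X)"
    by (simp add: distrib_left ee_add)
  ultimately show ?thesis
    by (simp add: Fgen_altdef theta_plus_1[OF tau])
qed

text \<open>The theta quotient alone has the multiplier \<open>ee (- w)\<close> with w = - x' + x
  \<tau>. The exponential prefactor contributes \<open>ee (x \<tau>)\<close>, and only the
  unimodular part \<open>ee x'\<close> survives.\<close>

lemma Fgen_plus_tau: "Fgen v (X + \<tau>) \<tau> = ee (of_real (v $ 1)) * Fgen v X \<tau>"
proof -
  define w where "w = char_point \<tau> v"
  have 1: "theta (w + (X + \<tau>)) \<tau> = - ee (- \<tau> / 2 - (w + X)) * theta (w + X) \<tau>"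
    using theta_plus_tau[OF tau, of "w + X"] by (simp add: add_ac)
  have 2: "ee (of_real (v $ 2) * (X + \<tau>)) * ee (- \<tau> / 2 - (w + X))
      = ee (of_real (v $ 1)) * ee (of_real (v $ 2) * X) * ee (- \<tau> / 2 - X)"
    unfolding ee_add [symmetric]
    by (rule arg_cong[of _ _ ee]) (simp add: w_def char_point_def algebra_simps)
  define e where "e = ee (- \<tau> / 2 - X)"
  have "Fgen v (X + \<tau>) \<tau> = (ee (of_real (v $ 2) * (X + \<tau>)) * ee (- \<tau> / 2 - (w + X))) *
      (theta' 0 \<tau> * theta (w + X) \<tau>) / (theta w \<tau> * (e * theta X \<tau>))"
    unfolding Fgen_altdef w_def [symmetric] 1 theta_plus_tau[OF tau, of X] e_def by simp
  also have "\<dots> = ee (of_real (v $ 1)) * Fgen v X \<tau>"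
    unfolding 2 Fgen_altdef w_def [symmetric] e_def [symmetric] by (simp add: e_def)
  finally show ?thesis .
qed

lemma Fgen_plus_lattice:
  "Fgen v (X + (of_int m + of_int n * \<tau>)) \<tau> = ee (of_real (of_int m * v $ 2 + of_int n * v $ 1)) * Fgen v X \<tau>"
proof -
  have powi: "ee z powi i = ee (of_int i * z)" for z i
    by (cases i rule: int_cases2) (simp_all add: power_int_minus ee_power ee_minus)
  show ?thesis
    using quasi_period_int[of "\<lambda>z. Fgen v z \<tau>" 1 "ee (of_real (v $ 2))" X m] Fgen_plus_1 Fgen_plus_tau
      quasi_period_int[of "\<lambda>z. Fgen v z \<tau>" \<tau> "ee (of_real (v $ 1))" "X + of_int m" n]
    by (simp add: add_ac powi ee_add)
qed

lemma Fgen_uminus: "Fgen (- v) (- X) \<tau> = - Fgen v X \<tau>"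
proof -
  define w where "w = char_point \<tau> v"
  have "theta (- w + - X) \<tau> = - theta (w + X) \<tau>"
    using theta_uminus[OF tau, of "w + X"] by simp
  moreover have "char_point \<tau> (- v) = - w"
    by (simp add: w_def char_point_def)
  ultimately show ?thesis
    by (simp add: Fgen_altdef w_def [symmetric] theta_uminus[OF tau])
qed

text \<open>At a pole the value is a quotient with denominator 0, which is 0 by convention.
  Periodicity in v can therefore be stated for all X.\<close>

lemma Fgen_at_lattice: "X \<in> period_lattice \<tau> \<Longrightarrow> Fgen v X \<tau> = 0"
  by (simp add: Fgen_altdef theta_eq_0_iff)

lemma Fgen_analytic:
  assumes "v \<notin> Z2" "f analytic_on A" "\<And>z. z \<in> A \<Longrightarrow> f z \<notin> period_lattice \<tau>"
  shows "(\<lambda>z. Fgen v (f z) \<tau>) analytic_on A"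
  unfolding Fgen_altdef using assms theta_char_point_nonzero[OF assms(1)]
  by (intro analytic_intros theta_analytic tau) (auto simp: theta_eq_0_iff)

lemma Fgen_meromorphic:
  assumes "f analytic_on A"
  shows "(\<lambda>z. Fgen v (f z) \<tau>) meromorphic_on A"
  unfolding Fgen_altdef
  by (intro meromorphic_intros analytic_on_imp_meromorphic_on analytic_intros theta_analytic tau assms)

lemma theta_over_self_tendsto: "((\<lambda>z. theta z \<tau> / z) \<longlongrightarrow> theta' 0 \<tau>) (at 0)"
proof -
  have ana: "(\<lambda>z. theta z \<tau>) analytic_on {0}"
    by (intro theta_analytic tau) auto
  show ?thesis
    using analytic_on_imp_differentiable_at[OF ana, of 0]
    by (simp add: theta'_def DERIV_deriv_iff_field_differentiable [symmetric] has_field_derivative_iff theta_0[OF tau])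
qed

lemma Fgen_residue_0:
  assumes v: "v \<notin> Z2"
  shows "((\<lambda>X. X * Fgen v X \<tau>) \<longlongrightarrow> 1) (at 0)"
proof -
  define w where "w = char_point \<tau> v"
  have w: "theta w \<tau> \<noteq> 0"
    using theta_char_point_nonzero[OF v] by (simp add: w_def)
  have "(\<lambda>X. ee (of_real (v $ 2) * X) * (theta' 0 \<tau> * theta (w + X) \<tau>)) analytic_on {0}"
    by (intro analytic_intros theta_analytic tau)
  hence lim2: "((\<lambda>X. ee (of_real (v $ 2) * X) * (theta' 0 \<tau> * theta (w + X) \<tau>)) \<longlongrightarrow>
     ee (of_real (v $ 2) * 0) * (theta' 0 \<tau> * theta (w + 0) \<tau>)) (at 0)"
    by (rule analytic_at_imp_isCont[unfolded isCont_def])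
  have "((\<lambda>X. ee (of_real (v $ 2) * X) * (theta' 0 \<tau> * theta (w + X) \<tau>) / (theta w \<tau> * (theta X \<tau> / X))) \<longlongrightarrow>
     ee (of_real (v $ 2) * 0) * (theta' 0 \<tau> * theta (w + 0) \<tau>) / (theta w \<tau> * theta' 0 \<tau>)) (at 0)"
    using w theta'_0_nonzero[OF tau]
    by (intro tendsto_divide[OF lim2 tendsto_mult[OF tendsto_const theta_over_self_tendsto]]) auto
  thus ?thesis
    using w theta'_0_nonzero[OF tau] by (simp add: Fgen_altdef w_def [symmetric] mult_ac)
qed

text \<open>The lattice point m + n \<tau> contributes its multiplier, the inner factor k the
  denominator. Stating this for an arbitrary linear argument lets one rule serve all the pole
  comparisons below.\<close>

lemma Fgen_residue:
  assumes v: "v \<notin> Z2" and k: "k \<noteq> 0" and a: "k * a + b = of_int m + of_int n * \<tau>"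
  shows "((\<lambda>X. (X - a) * Fgen v (k * X + b) \<tau>) \<longlongrightarrow>
           ee (of_real (of_int m * v $ 2 + of_int n * v $ 1)) / k) (at a)"
proof -
  define c where "c = ee (of_real (of_int m * v $ 2 + of_int n * v $ 1))"
  have "Fgen v (z + (of_int m + of_int n * \<tau>)) \<tau> = c * Fgen v z \<tau>" for z
    unfolding c_def by (rule Fgen_plus_lattice)
  moreover have "((\<lambda>X. (X - 0) * Fgen v X \<tau>) \<longlongrightarrow> 1) (at 0)"
    using Fgen_residue_0[OF v] by simp
  ultimately have lim: "((\<lambda>z. (z - (0 + (k * a + b))) * Fgen v z \<tau>) \<longlongrightarrow> c * 1) (at (0 + (k * a + b)))"
    unfolding a by (rule no_pole_shift)
  have "filterlim (\<lambda>X. k * X + b) (at (k * a + b)) (at a)"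
    using k by (auto simp: filterlim_at eventually_at_filter intro!: tendsto_eq_intros)
  moreover have "((\<lambda>z. (z - (k * a + b)) * Fgen v z \<tau>) \<longlongrightarrow> c) (at (k * a + b))"
    using lim by simp
  ultimately have "((\<lambda>X. (k * X + b - (k * a + b)) * Fgen v (k * X + b) \<tau>) \<longlongrightarrow> c) (at a)"
    by (rule filterlim_compose[rotated])
  hence "((\<lambda>X. (k * X + b - (k * a + b)) * Fgen v (k * X + b) \<tau> / k) \<longlongrightarrow> c / k) (at a)"
    using k by (intro tendsto_intros)
  moreover have "(k * X + b - (k * a + b)) * Fgen v (k * X + b) \<tau> / k = (X - a) * Fgen v (k * X + b) \<tau>" for X
    using k by (simp add: field_simps)
  ultimately show ?thesis
    by (simp add: c_def)
qed

lemma Fgen_periodic: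
  assumes v: "v \<notin> Z2"
  shows "Fgen (v + ivec j) X \<tau> = Fgen v X \<tau>"
proof (cases "X \<in> period_lattice \<tau>")
  case False
  \<comment> \<open>The redundant form \<open>1 * X + 0\<close> makes the arguments instances of the
    linear argument in \<open>Fgen_residue\<close>.\<close>
  define f where "f X = Fgen (v + ivec j) (1 * X + 0) \<tau> - Fgen v (1 * X + 0) \<tau>" for X
  have "f X = 0"
  proof (rule quasi_elliptic_eq_0[OF v, where f = f])
    show "f meromorphic_on UNIV"
      unfolding f_def by (intro meromorphic_intros Fgen_meromorphic analytic_intros)
    show "f (z + 1) = ee (of_real (v $ 2)) * f z" "f (z + \<tau>) = ee (of_real (v $ 1)) * f z" for z
      by (simp_all add: f_def Fgen_plus_1 Fgen_plus_tau ee_add right_diff_distrib)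
    have ana: "f analytic_on {z}" if "z \<notin> period_lattice \<tau>" for z
      unfolding f_def using that v by (intro analytic_intros Fgen_analytic) auto
    thus "f analytic_on {X}"
      using False by blast
    show "\<exists>w\<in>period_lattice \<tau>. ((\<lambda>z. (z - (a - w)) * f z) \<longlongrightarrow> 0) (at (a - w))" for a
    proof (cases "a \<in> period_lattice \<tau>")
      case True
      have "((\<lambda>z. (z - 0) * Fgen (v + ivec j) (1 * z + 0) \<tau> - (z - 0) * Fgen v (1 * z + 0) \<tau>) \<longlongrightarrow>
        ee (of_real (of_int 0 * (v + ivec j) $ 2 + of_int 0 * (v + ivec j) $ 1)) / 1
         - ee (of_real (of_int 0 * v $ 2 + of_int 0 * v $ 1)) / 1) (at 0)"
        using v by (intro tendsto_diff Fgen_residue) auto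
      hence "((\<lambda>z. (z - (a - a)) * f z) \<longlongrightarrow> 0) (at (a - a))"
        by (simp add: f_def right_diff_distrib)
      thus ?thesis
        using True by blast
    next
      case False
      thus ?thesis
        using analytic_no_pole[OF ana] period_latticeI[of 0 0 \<tau>] by (intro bexI[of _ 0]) auto
    qed
  qed
  thus ?thesis
    by (simp add: f_def)
qed (simp add: Fgen_at_lattice)

text \<open>Both sides are compared as functions of X with Y fixed; all terms have the multipliers
  of u. Modulo the lattice there are two possible poles. At X = 0 the two residues are both F(v; Y).
  At X = - Y the residues F(v - u; Y) and F(u - v; - Y) cancel because F is odd under (v, X) -> (-
  v, - X).\<close>

lemma Fgen_fay:
  assumes u: "u \<notin> Z2" and v: "v \<notin> Z2" and uv: "u - v \<notin> Z2"
    and X: "X \<notin> period_lattice \<tau>" and Y: "Y \<notin> period_lattice \<tau>" and XY: "X + Y \<notin> period_lattice \<tau>"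
  shows "Fgen u X \<tau> * Fgen v Y \<tau> =
    Fgen u (X + Y) \<tau> * Fgen (v - u) Y \<tau> + Fgen v (X + Y) \<tau> * Fgen (u - v) X \<tau>"
proof -
  define f where "f X = Fgen u (1 * X + 0) \<tau> * Fgen v Y \<tau> - Fgen u (1 * X + Y) \<tau> * Fgen (v - u) Y \<tau>
    - Fgen v (1 * X + Y) \<tau> * Fgen (u - v) (1 * X + 0) \<tau>" for X
  have "f X = 0"
  proof (rule quasi_elliptic_eq_0[OF u, where f = f])
    show "f meromorphic_on UNIV"
      unfolding f_def by (intro meromorphic_intros Fgen_meromorphic analytic_intros)
    have f: "f X = Fgen u X \<tau> * Fgen v Y \<tau> - Fgen u (X + Y) \<tau> * Fgen (v - u) Y \<tau>
        - Fgen v (X + Y) \<tau> * Fgen (u - v) X \<tau>" for X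
      by (simp add: f_def)
    show "f (z + 1) = ee (of_real (u $ 2)) * f z" for z
    proof -
      have e1: "Fgen w (z + 1 + Y) \<tau> = ee (of_real (w $ 2)) * Fgen w (z + Y) \<tau>" for w
        using Fgen_plus_1[of w "z + Y"] by (simp add: add_ac)
      have e2: "ee (of_real ((u - v) $ 2)) = ee (of_real (u $ 2)) / ee (of_real (v $ 2))"
        by (simp add: ee_diff)
      show ?thesis
        unfolding f e1 Fgen_plus_1 e2 by (simp add: field_simps)
    qed
    show "f (z + \<tau>) = ee (of_real (u $ 1)) * f z" for z
    proof -
      have e1: "Fgen w (z + \<tau> + Y) \<tau> = ee (of_real (w $ 1)) * Fgen w (z + Y) \<tau>" for w
        using Fgen_plus_tau[of w "z + Y"] by (simp add: add_ac)
      have e2: "ee (of_real ((u - v) $ 1)) = ee (of_real (u $ 1)) / ee (of_real (v $ 1))"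
        by (simp add: ee_diff)
      show ?thesis
        unfolding f e1 Fgen_plus_tau e2 by (simp add: field_simps)
    qed
    have ana: "f analytic_on {z}" if "z \<notin> period_lattice \<tau>" "z + Y \<notin> period_lattice \<tau>" for z
      unfolding f_def using that u v uv by (intro analytic_intros Fgen_analytic) auto
    thus "f analytic_on {X}"
      using X XY by blast
    show "\<exists>w\<in>period_lattice \<tau>. ((\<lambda>z. (z - (a - w)) * f z) \<longlongrightarrow> 0) (at (a - w))" for a
    proof -
      consider "a \<in> period_lattice \<tau>" | "a + Y \<in> period_lattice \<tau>"
        | "a \<notin> period_lattice \<tau>" "a + Y \<notin> period_lattice \<tau>"
        by blast
      thus ?thesis
      proof cases
        case 1
        have cont: "(\<lambda>z. Fgen v (1 * z + Y) \<tau>) analytic_on {0}" "(\<lambda>z. Fgen u (1 * z + Y) \<tau>) analytic_on {0}"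
          using Y u v by (auto intro!: Fgen_analytic analytic_intros)
        have "((\<lambda>z. (z - 0) * Fgen u (1 * z + 0) \<tau> * Fgen v Y \<tau>
           - (z - 0) * Fgen u (1 * z + Y) \<tau> * Fgen (v - u) Y \<tau>
           - Fgen v (1 * z + Y) \<tau> * ((z - 0) * Fgen (u - v) (1 * z + 0) \<tau>)) \<longlongrightarrow>
          ee (of_real (of_int 0 * u $ 2 + of_int 0 * u $ 1)) / 1 * Fgen v Y \<tau>
           - (0 - 0) * Fgen u (1 * 0 + Y) \<tau> * Fgen (v - u) Y \<tau>
           - Fgen v (1 * 0 + Y) \<tau> * (ee (of_real (of_int 0 * (u - v) $ 2 + of_int 0 * (u - v) $ 1)) / 1)) (at 0)"
          using u uv
          by (intro tendsto_diff tendsto_mult tendsto_const Fgen_residue tendsto_ident_at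
              cont[THEN analytic_at_imp_isCont, unfolded isCont_def]) auto
        hence "((\<lambda>z. (z - (a - a)) * f z) \<longlongrightarrow> 0) (at (a - a))"
          by (simp add: f_def algebra_simps)
        thus ?thesis
          using 1 by blast
      next
        case 2
        have cont: "(\<lambda>z. Fgen (u - v) (1 * z + 0) \<tau>) analytic_on {- Y}" "(\<lambda>z. Fgen u (1 * z + 0) \<tau>) analytic_on {- Y}"
          using Y u uv theta_uminus[OF tau, of Y]
          by (auto intro!: Fgen_analytic analytic_intros simp flip: theta_eq_0_iff)
        have "((\<lambda>z. (z - (- Y)) * Fgen u (1 * z + 0) \<tau> * Fgen v Y \<tau>
           - (z - (- Y)) * Fgen u (1 * z + Y) \<tau> * Fgen (v - u) Y \<tau>
           - (z - (- Y)) * Fgen v (1 * z + Y) \<tau> * Fgen (u - v) (1 * z + 0) \<tau>) \<longlongrightarrow>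
          (- Y - (- Y)) * Fgen u (1 * (- Y) + 0) \<tau> * Fgen v Y \<tau>
           - ee (of_real (of_int 0 * u $ 2 + of_int 0 * u $ 1)) / 1 * Fgen (v - u) Y \<tau>
           - ee (of_real (of_int 0 * v $ 2 + of_int 0 * v $ 1)) / 1 * Fgen (u - v) (1 * (- Y) + 0) \<tau>) (at (- Y))"
          using u v
          by (intro tendsto_diff tendsto_mult tendsto_const Fgen_residue tendsto_ident_at
              cont[THEN analytic_at_imp_isCont, unfolded isCont_def]) auto
        moreover have "Fgen (u - v) (- Y) \<tau> = - Fgen (v - u) Y \<tau>"
          using Fgen_uminus[of "v - u" Y] by simp
        ultimately have "((\<lambda>z. (z - (a - (a + Y))) * f z) \<longlongrightarrow> 0) (at (a - (a + Y)))"
          by (simp add: f_def algebra_simps)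
        thus ?thesis
          using 2 by blast
      next
        case 3
        thus ?thesis
          using analytic_no_pole[OF ana[OF 3]] period_latticeI[of 0 0 \<tau>] by (intro bexI[of _ 0]) auto
      qed
    qed
  qed
  thus ?thesis
    by (simp add: f_def algebra_simps)
qed

end

subsection \<open>Sums over pairs of residues\<close>

text \<open>The absolute value admits negative moduli, since c may have either sign.\<close>

definition res :: "int \<Rightarrow> (int \<times> int) set" where
  "res N = {0..<\<bar>N\<bar>} \<times> {0..<\<bar>N\<bar>}"

definition iscale :: "int \<Rightarrow> int \<times> int \<Rightarrow> int \<times> int" where
  "iscale n j = (n * fst j, n * snd j)"

lemma fst_iscale [simp]: "fst (iscale n j) = n * fst j"
  and snd_iscale [simp]: "snd (iscale n j) = n * snd j"
  by (simp_all add: iscale_def)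

lemma finite_res [simp]: "finite (res N)"
  by (simp add: res_def)

lemma ivec_iscale: "ivec (iscale n j) = of_int n *\<^sub>R ivec j"
  by (simp add: vec_eq_iff forall_2)

lemma sum_res: "(\<Sum>j\<in>res N. f j) = (\<Sum>j'\<in>{0..<\<bar>N\<bar>}. \<Sum>j\<in>{0..<\<bar>N\<bar>}. f (j', j))"
  by (simp add: res_def sum.cartesian_product)

lemma res_residue_ex:
  assumes "N \<noteq> 0"
  obtains r k where "r \<in> res N" "i = r + iscale N k"
proof
  show "(fst i mod \<bar>N\<bar>, snd i mod \<bar>N\<bar>) \<in> res N"
    using assms by (simp add: res_def)
  have "m = m mod \<bar>N\<bar> + N * (sgn N * (m div \<bar>N\<bar>))" for m
    using mult_div_mod_eq[of "\<bar>N\<bar>" m] by (simp add: abs_sgn mult_ac)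
  thus "i = (fst i mod \<bar>N\<bar>, snd i mod \<bar>N\<bar>) + iscale N (sgn N * (fst i div \<bar>N\<bar>), sgn N * (snd i div \<bar>N\<bar>))"
    by (auto simp: prod_eq_iff)
qed

lemma res_residue_unique:
  assumes "r \<in> res N" "r' \<in> res N" "r - r' = iscale N k"
  shows "r = r'"
proof -
  have *: "m = m'" if "m \<in> {0..<\<bar>N\<bar>}" "m' \<in> {0..<\<bar>N\<bar>}" "m - m' = N * l" for m m' l
  proof -
    have "m mod N = m' mod N"
      using that(3) by (metis dvd_triv_left mod_eq_dvd_iff)
    hence "m mod \<bar>N\<bar> = m' mod \<bar>N\<bar>"
      by (metis abs_dvd_iff mod_eq_dvd_iff)
    thus ?thesis
      using that by simp
  qed
  show ?thesis
    using assms *[of "fst r" "fst r'" "fst k"] *[of "snd r" "snd r'" "snd k"]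
    by (auto simp: res_def prod_eq_iff)
qed

text \<open>A bijection presented as a relation: existence and uniqueness of representatives replace
  explicit formulas with remainders in both directions.\<close>

lemma sum_eq_by_representatives:
  assumes ex1: "\<And>a. a \<in> A \<Longrightarrow> \<exists>b\<in>B. R a b" and ex2: "\<And>b. b \<in> B \<Longrightarrow> \<exists>a\<in>A. R a b"
    and u1: "\<And>a b b'. a \<in> A \<Longrightarrow> b \<in> B \<Longrightarrow> b' \<in> B \<Longrightarrow> R a b \<Longrightarrow> R a b' \<Longrightarrow> b = b'"
    and u2: "\<And>a a' b. a \<in> A \<Longrightarrow> a' \<in> A \<Longrightarrow> b \<in> B \<Longrightarrow> R a b \<Longrightarrow> R a' b \<Longrightarrow> a = a'"
    and eq: "\<And>a b. a \<in> A \<Longrightarrow> b \<in> B \<Longrightarrow> R a b \<Longrightarrow> f a = g b"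
  shows "sum f A = sum g B"
proof -
  obtain h where h: "\<And>a. a \<in> A \<Longrightarrow> h a \<in> B \<and> R a (h a)"
    using ex1 by metis
  obtain h' where h': "\<And>b. b \<in> B \<Longrightarrow> h' b \<in> A \<and> R (h' b) b"
    using ex2 by metis
  show ?thesis
  proof (rule sum.reindex_bij_witness[of _ h' h])
    show "h' (h a) = a" if "a \<in> A" for a
      using that h h' u2 by blast
    show "h (h' b) = b" if "b \<in> B" for b
      using that h h' u1 by blast
    show "g (h a) = f a" if "a \<in> A" for a
      using that h eq by metis
  qed (use h h' in auto)
qed

text \<open>Digits in base M: a residue modulo M N is r + M s with r modulo M and s modulo
  N.\<close>

lemma sum_res_mult:
  fixes h :: "int \<times> int \<Rightarrow> complex"
  assumes M: "M \<noteq> 0" and N: "N \<noteq> 0" and h: "\<And>i k. h (i + iscale (M * N) k) = h i"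
  shows "(\<Sum>i\<in>res (M * N). h i) = (\<Sum>i\<in>res M. \<Sum>k\<in>res N. h (i + iscale M k))"
proof -
  have "(\<Sum>i\<in>res (M * N). h i) = (\<Sum>(i, k)\<in>res M \<times> res N. h (i + iscale M k))"
  proof (rule sum_eq_by_representatives[where R = "\<lambda>i (r, s). \<exists>k. i = r + iscale M s + iscale (M * N) k"])
    fix i assume "i \<in> res (M * N)"
    obtain r k where rk: "r \<in> res M" "i = r + iscale M k"
      using res_residue_ex[OF M] by blast
    obtain s l where sl: "s \<in> res N" "k = s + iscale N l"
      using res_residue_ex[OF N] by blast
    have "i = r + iscale M s + iscale (M * N) l"
      by (simp add: rk sl prod_eq_iff algebra_simps)
    thus "\<exists>b\<in>res M \<times> res N. case b of (r, s) \<Rightarrow> \<exists>k. i = r + iscale M s + iscale (M * N) k"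
      using rk sl by blast
  next
    fix b assume "b \<in> res M \<times> res N"
    obtain r s where b: "b = (r, s)"
      by (cases b)
    have "M * N \<noteq> 0"
      using M N by simp
    then obtain i k where "i \<in> res (M * N)" "r + iscale M s = i + iscale (M * N) k"
      using res_residue_ex by blast
    moreover from this have "i = r + iscale M s + iscale (M * N) (- k)"
      by (simp add: prod_eq_iff algebra_simps)
    ultimately show "\<exists>i\<in>res (M * N). case b of (r, s) \<Rightarrow> \<exists>k. i = r + iscale M s + iscale (M * N) k"
      unfolding b by blast
  next
    fix i b b' assume in_res': "b \<in> res M \<times> res N" "b' \<in> res M \<times> res N"
      and i': "case b of (r, s) \<Rightarrow> \<exists>k. i = r + iscale M s + iscale (M * N) k"
        "case b' of (r, s) \<Rightarrow> \<exists>k. i = r + iscale M s + iscale (M * N) k"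
    obtain r s r' s' where b: "b = (r, s)" "b' = (r', s')"
      by (metis surj_pair)
    have in_res: "r \<in> res M" "s \<in> res N" "r' \<in> res M" "s' \<in> res N"
      using in_res' by (simp_all add: b)
    obtain k where k: "i = r + iscale M s + iscale (M * N) k"
      using i'(1) unfolding b by blast
    obtain k' where k': "i = r' + iscale M s' + iscale (M * N) k'"
      using i'(2) unfolding b by blast
    note i = k k'
    have "r - r' = iscale M (s' + iscale N k' - s - iscale N k)"
      using i by (simp add: prod_eq_iff algebra_simps)
    hence "r = r'"
      by (rule res_residue_unique[rotated 2]) (rule in_res)+
    have *: "m - m' = N * (l' - l)" if "x = y + M * m + M * N * l" "x = y + M * m' + M * N * l'"
      for x y m m' l l'
    proof -
      have "M * (m - m') = M * (N * (l' - l))"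
        using that by (simp add: algebra_simps)
      thus ?thesis
        using M by simp
    qed
    have "s - s' = iscale N (k' - k)"
      using i \<open>r = r'\<close> *[of "fst i" "fst r" "fst s" "fst k" "fst s'" "fst k'"]
        *[of "snd i" "snd r" "snd s" "snd k" "snd s'" "snd k'"]
      by (simp add: prod_eq_iff)
    hence "s = s'"
      by (rule res_residue_unique[rotated 2]) (rule in_res)+
    thus "b = b'"
      using \<open>r = r'\<close> by (simp add: b)
  next
    fix i i' b assume "i \<in> res (M * N)" "i' \<in> res (M * N)"
      and "case b of (r, s) \<Rightarrow> \<exists>k. i = r + iscale M s + iscale (M * N) k"
      and "case b of (r, s) \<Rightarrow> \<exists>k. i' = r + iscale M s + iscale (M * N) k"
    moreover from this obtain r s k k' where "b = (r, s)"
        "i = r + iscale M s + iscale (M * N) k" "i' = r + iscale M s + iscale (M * N) k'"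
      by auto
    hence "i - i' = iscale (M * N) (k - k')"
      by (simp add: prod_eq_iff algebra_simps)
    ultimately show "i = i'"
      by (intro res_residue_unique[of i _ i'])
  next
    fix i b assume "case b of (r, s) \<Rightarrow> \<exists>k. i = r + iscale M s + iscale (M * N) k"
    moreover obtain r s where b: "b = (r, s)"
      by (cases b)
    ultimately obtain k where "i = r + iscale M s + iscale (M * N) k"
      by auto
    thus "h i = (case b of (i, k) \<Rightarrow> h (i + iscale M k))"
      by (simp only: h b prod.case)
  qed
  thus ?thesis
    by (simp add: sum.cartesian_product)
qed

lemma sum_res_coprime:
  fixes h :: "int \<times> int \<Rightarrow> complex"
  assumes N: "N \<noteq> 0" and q: "coprime q N" and h: "\<And>i k. h (i + iscale N k) = h i"
  shows "(\<Sum>i\<in>res N. h (iscale q i)) = (\<Sum>i\<in>res N. h i)"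
proof -
  obtain s t where st: "s * q + t * N = 1"
    using q bezout_int[of q N] by auto
  show ?thesis
  proof (rule sum_eq_by_representatives[where R = "\<lambda>i j. \<exists>k. iscale q i = j + iscale N k"])
    fix i assume "i \<in> res N"
    show "\<exists>j\<in>res N. \<exists>k. iscale q i = j + iscale N k"
      using res_residue_ex[OF N, of "iscale q i"] by metis
  next
    fix j assume "j \<in> res N"
    obtain i k where ik: "i \<in> res N" "iscale s j = i + iscale N k"
      using res_residue_ex[OF N, of "iscale s j"] by metis
    have *: "q * m = n + N * (- t * n - q * l)" if "s * n = m + N * l" for m n l
    proof -
      have "q * m = q * (s * n) - q * (N * l)"
        using that by (simp add: algebra_simps)
      also have "q * (s * n) = n - N * t * n"
        using arg_cong[OF st, of "\<lambda>x. x * n"] by (simp add: algebra_simps)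
      finally show ?thesis
        by (simp add: algebra_simps)
    qed
    have "iscale q i = j + iscale N (iscale (- t) j - iscale q k)"
      using ik(2) *[of "fst j" "fst i" "fst k"] *[of "snd j" "snd i" "snd k"]
      by (simp add: prod_eq_iff)
    thus "\<exists>i\<in>res N. \<exists>k. iscale q i = j + iscale N k"
      using ik(1) by blast
  next
    fix i j j' assume "j \<in> res N" "j' \<in> res N"
      and "\<exists>k. iscale q i = j + iscale N k" "\<exists>k. iscale q i = j' + iscale N k"
    moreover from this obtain k k' where "iscale q i = j + iscale N k" "iscale q i = j' + iscale N k'"
      by blast
    hence "j - j' = iscale N (k' - k)"
      by (simp add: prod_eq_iff algebra_simps)
    ultimately show "j = j'"
      by (intro res_residue_unique[of j _ j'])
  next
    fix i i' j assume "i \<in> res N" "i' \<in> res N"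
      and "\<exists>k. iscale q i = j + iscale N k" "\<exists>k. iscale q i' = j + iscale N k"
    moreover from this obtain k k' where kk: "iscale q i = j + iscale N k" "iscale q i' = j + iscale N k'"
      by blast
    have *: "m - m' = N * (s * (l - l') + t * (m - m'))" if "q * m = n + N * l" "q * m' = n + N * l'" for m m' n l l'
    proof -
      have "m - m' = s * (q * m - q * m') + t * N * (m - m')"
        using arg_cong[OF st, of "\<lambda>x. x * (m - m')"] by (simp add: algebra_simps)
      also have "q * m - q * m' = N * (l - l')"
        using that by (simp add: algebra_simps)
      finally show ?thesis
        by (simp add: algebra_simps)
    qed
    have "i - i' = iscale N (iscale s (k - k') + iscale t (i - i'))"
      using kk *[of "fst i" "fst j" "fst k" "fst i'" "fst k'"] *[of "snd i" "snd j" "snd k" "snd i'" "snd k'"]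
      by (simp add: prod_eq_iff)
    ultimately show "i = i'"
      by (intro res_residue_unique[of i _ i'])
  next
    fix i j assume "\<exists>k. iscale q i = j + iscale N k"
    then obtain k where "iscale q i = j + iscale N k" ..
    thus "h (iscale q i) = h j"
      by (simp only: h)
  qed
qed

text \<open>Both index sets are fundamental domains for one and the same lattice of pairs, written in the
  coordinates \<open>(i, j)\<close> and \<open>(k, z) = (d i - c j, a j - b i)\<close>.\<close>
lemma sum_res_unimodular:
  fixes f g :: "int \<times> int \<Rightarrow> int \<times> int \<Rightarrow> complex"
  assumes det: "a * d - b * c = 1" and p': "p' = c * q + d * p" and q': "q' = a * q + b * p"
    and nz: "c \<noteq> 0" "p \<noteq> 0" "p' \<noteq> 0"
    and eq: "\<And>i j t w. f i j = g (iscale d i - iscale c j + iscale (c * p') t)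
               (iscale a j - iscale b i - iscale (q' * c) t + iscale p w)"
  shows "(\<Sum>i\<in>res (p * c). \<Sum>j\<in>res p'. f i j) = (\<Sum>k\<in>res (p' * c). \<Sum>z\<in>res p. g k z)"
proof -
  have e1: "a * p' - q' * c = p"
    using arg_cong[OF det, of "\<lambda>x. x * p"] by (simp add: p' q' algebra_simps)
  have e2: "d * q' - b * p' = q"
    using arg_cong[OF det, of "\<lambda>x. x * q"] by (simp add: p' q' algebra_simps)
  \<comment> \<open>When k moves by c p' t, the term q' c t keeps q' k + p' z unchanged, while p w
    moves it by p p' w. These are the moves that translate the arguments in the Fay sum by integer
    vectors.\<close>
  define R where "R = (\<lambda>(i, j) (k, z). \<exists>t w. k = iscale d i - iscale c j + iscale (c * p') t \<and>
      z = iscale a j - iscale b i - iscale (q' * c) t + iscale p w)"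
  have "(\<Sum>(i, j)\<in>res (p * c) \<times> res p'. f i j) = (\<Sum>(k, z)\<in>res (p' * c) \<times> res p. g k z)"
  proof (rule sum_eq_by_representatives[where R = R])
    fix v assume "v \<in> res (p * c) \<times> res p'"
    obtain i j where v: "v = (i, j)" by (cases v)
    obtain k t where k: "k \<in> res (p' * c)" "iscale d i - iscale c j = k + iscale (p' * c) t"
      using res_residue_ex[of "p' * c"] nz by (metis mult_eq_0_iff)
    obtain z w where z: "z \<in> res p" "iscale a j - iscale b i - iscale (q' * c) (- t) = z + iscale p w"
      using res_residue_ex[of p] nz by metis
    have "k = iscale d i - iscale c j + iscale (c * p') (- t)"
      using k(2) by (simp add: prod_eq_iff algebra_simps)
    moreover have "z = iscale a j - iscale b i - iscale (q' * c) (- t) + iscale p (- w)"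
      using z(2) by (simp add: prod_eq_iff algebra_simps)
    ultimately show "\<exists>b\<in>res (p' * c) \<times> res p. R v b"
      unfolding v R_def using k z by blast
  next
    fix v assume "v \<in> res (p' * c) \<times> res p"
    obtain k z where v: "v = (k, z)" by (cases v)
    obtain i t where i: "i \<in> res (p * c)" "iscale a k + iscale c z = i + iscale (p * c) t"
      using res_residue_ex[of "p * c"] nz by (metis mult_eq_0_iff)
    \<comment> \<open>The inverse substitution is i = a k + c z, j = b k + d z. Reducing i by p c t
      has to be compensated by q c t in j: this preserves q i + p j and changes d i - c j by a
      multiple of c p' only.\<close>
    obtain j w where j: "j \<in> res p'" "iscale b k + iscale d z + iscale (q * c) t = j + iscale p' w"
      using res_residue_ex[of p'] nz by metis
    have *: "k0 = d * i0 - c * j0 + c * p' * (t0 - w0) \<and> z0 = a * j0 - b * i0 - q' * c * (t0 - w0) + p * w0"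
      if "a * k0 + c * z0 = i0 + p * c * t0" "b * k0 + d * z0 + q * c * t0 = j0 + p' * w0" for k0 z0 i0 j0 t0 w0
    proof -
      have ij: "i0 = a * k0 + c * z0 - p * c * t0" "j0 = b * k0 + d * z0 + q * c * t0 - p' * w0"
        using that by simp_all
      have "d * i0 - c * j0 + c * p' * (t0 - w0) = (a * d - b * c) * k0"
        unfolding ij p' by (simp add: algebra_simps)
      moreover have "a * j0 - b * i0 - q' * c * (t0 - w0) + p * w0 =
          (a * d - b * c) * z0 + (p - (a * p' - q' * c)) * w0 + c * t0 * (a * q + b * p - q')"
        unfolding ij by (simp add: algebra_simps)
      ultimately show ?thesis
        using det e1 by (simp add: q')
    qed
    have "k = iscale d i - iscale c j + iscale (c * p') (t - w)"
      "z = iscale a j - iscale b i - iscale (q' * c) (t - w) + iscale p w"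
      using i(2) j(2) *[of "fst k" "fst z" "fst i" "fst t" "fst j" "fst w"]
        *[of "snd k" "snd z" "snd i" "snd t" "snd j" "snd w"]
      by (simp_all add: prod_eq_iff)
    thus "\<exists>b\<in>res (p * c) \<times> res p'. R b v"
      unfolding v R_def using i j by blast
  next
    fix u v v' assume in_res': "v \<in> res (p' * c) \<times> res p" "v' \<in> res (p' * c) \<times> res p"
      and R: "R u v" "R u v'"
    obtain i j k z k' z' where uv: "u = (i, j)" "v = (k, z)" "v' = (k', z')"
      by (metis surj_pair)
    have in_res: "k \<in> res (p' * c)" "z \<in> res p" "k' \<in> res (p' * c)" "z' \<in> res p"
      using in_res' by (simp_all add: uv)
    obtain t w where tw: "k = iscale d i - iscale c j + iscale (c * p') t"
        "z = iscale a j - iscale b i - iscale (q' * c) t + iscale p w"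
      using R(1) unfolding R_def uv by blast
    obtain t' w' where tw': "k' = iscale d i - iscale c j + iscale (c * p') t'"
        "z' = iscale a j - iscale b i - iscale (q' * c) t' + iscale p w'"
      using R(2) unfolding R_def uv by blast
    note k = tw(1) tw'(1) and z = tw(2) tw'(2)
    have "k - k' = iscale (p' * c) (t - t')"
      using k by (simp add: prod_eq_iff algebra_simps)
    hence kk: "k = k'"
      by (rule res_residue_unique[rotated 2]) (rule in_res)+
    hence "iscale (c * p') t = iscale (c * p') t'"
      using k by simp
    hence "t = t'"
      using nz by (simp add: prod_eq_iff)
    hence "z - z' = iscale p (w - w')"
      using z by (simp add: prod_eq_iff algebra_simps)
    hence "z = z'"
      by (rule res_residue_unique[rotated 2]) (rule in_res)+
    thus "v = v'"
      by (simp add: uv kk)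
  next
    fix u u' v assume in_res': "u \<in> res (p * c) \<times> res p'" "u' \<in> res (p * c) \<times> res p'"
      and R: "R u v" "R u' v"
    obtain i j i' j' k z where uv: "u = (i, j)" "u' = (i', j')" "v = (k, z)"
      by (metis surj_pair)
    have in_res: "i \<in> res (p * c)" "j \<in> res p'" "i' \<in> res (p * c)" "j' \<in> res p'"
      using in_res' by (simp_all add: uv)
    obtain t w where tw: "k = iscale d i - iscale c j + iscale (c * p') t"
        "z = iscale a j - iscale b i - iscale (q' * c) t + iscale p w"
      using R(1) unfolding R_def uv by blast
    obtain t' w' where tw': "k = iscale d i' - iscale c j' + iscale (c * p') t'"
        "z = iscale a j' - iscale b i' - iscale (q' * c) t' + iscale p w'"
      using R(2) unfolding R_def uv by blast
    note k = tw(1) tw'(1) and z = tw(2) tw'(2)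
    have *: "i0 - i0' = p * c * ((t0' + w0') - (t0 + w0)) \<and>
        (t0' + w0' = t0 + w0 \<longrightarrow> j0 - j0' = p' * (t0 - t0'))"
      if "d * i0 - c * j0 + c * p' * t0 = d * i0' - c * j0' + c * p' * t0'"
        "a * j0 - b * i0 - q' * c * t0 + p * w0 = a * j0' - b * i0' - q' * c * t0' + p * w0'"
      for i0 j0 t0 w0 i0' j0' t0' w0'
    proof -
      define K Z where "K = d * (i0 - i0') - c * (j0 - j0')" and "Z = a * (j0 - j0') - b * (i0 - i0')"
      have K: "K = c * p' * (t0' - t0)" and Z: "Z = p * (w0' - w0) - q' * c * (t0' - t0)"
        using that by (simp_all add: K_def Z_def algebra_simps)
      have "i0 - i0' = a * K + c * Z"
        using arg_cong[OF det, of "\<lambda>x. x * (i0 - i0')"] by (simp add: K_def Z_def algebra_simps)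
      also have "\<dots> = c * (a * p' - q' * c) * (t0' - t0) + c * p * (w0' - w0)"
        unfolding K Z by (simp add: algebra_simps)
      finally have I: "i0 - i0' = p * c * ((t0' + w0') - (t0 + w0))"
        unfolding e1 by (simp add: algebra_simps)
      have "j0 - j0' = b * K + d * Z"
        using arg_cong[OF det, of "\<lambda>x. x * (j0 - j0')"] by (simp add: K_def Z_def algebra_simps)
      also have "\<dots> = - c * (d * q' - b * p') * (t0' - t0) + d * p * (w0' - w0)"
        unfolding K Z by (simp add: algebra_simps)
      \<comment> \<open>This is not yet a multiple of p'. The coefficients c q and d p add up to p'
        only once t + w = t' + w' is known, and that follows from i = i'.\<close>
      finally have J: "j0 - j0' = - c * q * (t0' - t0) + d * p * (w0' - w0)"
        unfolding e2 .
      have "j0 - j0' = p' * (t0 - t0')" if "t0' + w0' = t0 + w0"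
      proof -
        have "w0' - w0 = t0 - t0'"
          using that by simp
        with J show ?thesis
          by (simp add: p' algebra_simps)
      qed
      with I show ?thesis
        by blast
    qed
    have **: "i - i' = iscale (p * c) ((t' + w') - (t + w))"
      "t' + w' = t + w \<longrightarrow> j - j' = iscale p' (t - t')"
      using k z *[of "fst i" "fst j" "fst t" "fst i'" "fst j'" "fst t'" "fst w" "fst w'"]
        *[of "snd i" "snd j" "snd t" "snd i'" "snd j'" "snd t'" "snd w" "snd w'"]
      by (simp_all add: prod_eq_iff)
    from this(1) have ii: "i = i'"
      by (rule res_residue_unique[rotated 2]) (rule in_res)+
    hence "iscale (p * c) ((t' + w') - (t + w)) = 0"
      using **(1) by simp
    hence "t' + w' = t + w"
      using nz by (simp add: prod_eq_iff)
    with **(2) have "j - j' = iscale p' (t - t')"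
      by blast
    hence "j = j'"
      by (rule res_residue_unique[rotated 2]) (rule in_res)+
    thus "u = u'"
      by (simp add: uv ii)
  next
    fix u v assume "R u v"
    thus "(case u of (i, j) \<Rightarrow> f i j) = (case v of (k, z) \<Rightarrow> g k z)"
      unfolding R_def using eq by (auto split: prod.splits)
  qed
  thus ?thesis
    by (simp add: sum.cartesian_product)
qed

subsection \<open>The distribution relation\<close>

lemma sum_ee_roots_signed:
  fixes N m :: int
  assumes "N \<noteq> 0"
  shows "(\<Sum>k\<in>{0..<\<bar>N\<bar>}. ee (of_int k * of_int m / of_int N)) = (if N dvd m then of_int \<bar>N\<bar> else 0)"
proof (cases "N > 0")
  case True
  thus ?thesis
    using sum_ee_roots[of N m] by simp
next
  case False
  have "(\<Sum>k\<in>{0..<\<bar>N\<bar>}. ee (of_int k * of_int m / of_int N)) = (\<Sum>k\<in>{0..<- N}. ee (of_int k * of_int (- m) / of_int (- N)))"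
    using False by simp
  thus ?thesis
    using False assms by (subst (asm) sum_ee_roots) auto
qed

lemma scaleR_notin_Z2: "of_int n *\<^sub>R u \<notin> Z2 \<Longrightarrow> u \<notin> Z2"
  using Z2_scale by blast

context
  fixes \<tau> :: complex
  assumes tau: "Im \<tau> > 0"
begin

lemma period_lattice_scale: "X \<in> period_lattice \<tau> \<Longrightarrow> of_int n * X \<in> period_lattice \<tau>"
proof -
  assume "X \<in> period_lattice \<tau>"
  then obtain k l where "X = of_int k + of_int l * \<tau>"
    by (auto simp: period_lattice_def)
  hence "of_int n * X = of_int (n * k) + of_int (n * l) * \<tau>"
    by (simp add: algebra_simps)
  thus ?thesis
    by (simp only: period_latticeI)
qed

text \<open>Scaling X by N turns the multipliers of each division point into those of u. The left
  side could have poles at all points (m + n \<tau>) / N, but its residue there is a sum of the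
  characters of (Z/N)^2, which vanishes unless N divides both m and n, that is, unless the point
  lies in the lattice.\<close>

lemma Fgen_distribution:
  assumes u: "u \<notin> Z2" and N: "N \<noteq> 0" and X: "of_int N * X \<notin> period_lattice \<tau>"
  shows "(\<Sum>j\<in>res N. Fgen ((u + ivec j) /\<^sub>R of_int N) (of_int N * X) \<tau>) = of_int N * Fgen u X \<tau>"
proof -
  define v where "v j = (u + ivec j) /\<^sub>R of_int N" for j
  have Nv: "of_int N *\<^sub>R v j = u + ivec j" for j
    using N by (simp add: v_def)
  have v: "v j \<notin> Z2" for j
    by (rule scaleR_notin_Z2[of N]) (use u Nv[of j] in simp)
  have ee_Nv: "ee (of_int N * of_real (v j $ i)) = ee (of_real (u $ i))" for j and i :: 2
  proof -
    have "of_int N * v j $ i = u $ i + ivec j $ i"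
      using arg_cong[OF Nv[of j], of "\<lambda>v. v $ i"] by simp
    moreover have "ee (of_real (ivec j $ i)) = 1"
      using ivec_in_Z2[of j] by (simp add: Z2_def ee_eq_1_iff)
    ultimately have "ee (of_real (of_int N * v j $ i)) = ee (of_real (u $ i))"
      by (simp only: of_real_add ee_add mult_1_right)
    thus ?thesis
      by simp
  qed
  define f where "f X = (\<Sum>j\<in>res N. Fgen (v j) (of_int N * X + 0) \<tau>) - of_int N * Fgen u (1 * X + 0) \<tau>" for X
  have "f X = 0"
  proof (rule quasi_elliptic_eq_0[OF tau u, where f = f])
    show "f meromorphic_on UNIV"
      unfolding f_def by (intro meromorphic_intros Fgen_meromorphic[OF tau] analytic_intros)
    have f: "f X = (\<Sum>j\<in>res N. Fgen (v j) (of_int N * X) \<tau>) - of_int N * Fgen u X \<tau>" for X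
      by (simp add: f_def)
    show "f (z + 1) = ee (of_real (u $ 2)) * f z" for z
    proof -
      have "Fgen (v j) (of_int N * (z + 1)) \<tau> = ee (of_real (u $ 2)) * Fgen (v j) (of_int N * z) \<tau>" for j
        using Fgen_plus_lattice[OF tau, of "v j" "of_int N * z" N 0] by (simp add: distrib_left ee_Nv)
      thus ?thesis
        unfolding f Fgen_plus_1[OF tau] by (simp add: sum_distrib_left right_diff_distrib mult_ac)
    qed
    show "f (z + \<tau>) = ee (of_real (u $ 1)) * f z" for z
    proof -
      have "Fgen (v j) (of_int N * (z + \<tau>)) \<tau> = ee (of_real (u $ 1)) * Fgen (v j) (of_int N * z) \<tau>" for j
        using Fgen_plus_lattice[OF tau, of "v j" "of_int N * z" 0 N] by (simp add: distrib_left ee_Nv)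
      thus ?thesis
        unfolding f Fgen_plus_tau[OF tau] by (simp add: sum_distrib_left right_diff_distrib mult_ac)
    qed
    have ana: "f analytic_on {z}" if "of_int N * z \<notin> period_lattice \<tau>" for z
    proof -
      have "z \<notin> period_lattice \<tau>"
        using that period_lattice_scale by blast
      thus ?thesis
        unfolding f_def using that u v
        by (intro analytic_intros Fgen_analytic[OF tau]) auto
    qed
    thus "f analytic_on {X}"
      using X by blast
    show "\<exists>w\<in>period_lattice \<tau>. ((\<lambda>z. (z - (a - w)) * f z) \<longlongrightarrow> 0) (at (a - w))" for a
    proof -
      have "((\<lambda>z. (z - a) * f z) \<longlongrightarrow> 0) (at a)"
      proof (cases "of_int N * a \<in> period_lattice \<tau>")
        case True
        then obtain m n where mn: "of_int N * a = of_int m + of_int n * \<tau>"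
          by (auto simp: period_lattice_def)
        define L where "L j = ee (of_real (of_int m * v j $ 2 + of_int n * v j $ 1)) / of_int N" for j
        have lim1: "((\<lambda>z. \<Sum>j\<in>res N. (z - a) * Fgen (v j) (of_int N * z + 0) \<tau>) \<longlongrightarrow> (\<Sum>j\<in>res N. L j)) (at a)"
          unfolding L_def using N v mn by (intro tendsto_sum Fgen_residue[OF tau]) auto
        define e where "e = ee (of_real ((of_int m * u $ 2 + of_int n * u $ 1) / of_int N))"
        have "L j = e / of_int N * ee (of_int (fst j) * of_int n / of_int N) * ee (of_int (snd j) * of_int m / of_int N)" for j
        proof -
          have "ee (of_real (of_int m * v j $ 2 + of_int n * v j $ 1)) =
              e * ee (of_int (fst j) * of_int n / of_int N) * ee (of_int (snd j) * of_int m / of_int N)"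
            unfolding e_def ee_add [symmetric] v_def
            by (rule arg_cong[of _ _ ee]) (use N in \<open>simp add: field_simps\<close>)
          thus ?thesis
            by (simp add: L_def)
        qed
        hence "(\<Sum>j\<in>res N. L j) = e / of_int N * (\<Sum>j'\<in>{0..<\<bar>N\<bar>}. ee (of_int j' * of_int n / of_int N)) *
            (\<Sum>j\<in>{0..<\<bar>N\<bar>}. ee (of_int j * of_int m / of_int N))"
          by (simp add: sum_res sum_product sum_distrib_left mult_ac)
        \<comment> \<open>The two character sums give |N|^2, so after division by N the factor is N
          whatever its sign.\<close>
        also have "\<dots> = (if N dvd m \<and> N dvd n then of_int N * e else 0)"
        proof -
          have "of_int \<bar>N\<bar> * of_int \<bar>N\<bar> = (of_int N * of_int N :: complex)"
            by (simp only: of_int_mult [symmetric] abs_mult_self_eq)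
          thus ?thesis
            using N by (simp add: sum_ee_roots_signed[OF N] mult.assoc)
        qed
        finally have L: "(\<Sum>j\<in>res N. L j) = (if N dvd m \<and> N dvd n then of_int N * e else 0)" .
        have lim2: "((\<lambda>z. of_int N * ((z - a) * Fgen u (1 * z + 0) \<tau>)) \<longlongrightarrow>
            (if N dvd m \<and> N dvd n then of_int N * e else 0)) (at a)"
        proof (cases "N dvd m \<and> N dvd n")
          case True
          then obtain k l where kl: "m = N * k" "n = N * l"
            by (auto elim!: dvdE)
          have a: "1 * a + 0 = of_int k + of_int l * \<tau>"
          proof -
            have "of_int N * a = of_int N * (of_int k + of_int l * \<tau>)"
              unfolding mn kl by (simp add: algebra_simps)
            thus ?thesis
              using N by simp
          qed
          have "e = ee (of_real (of_int k * u $ 2 + of_int l * u $ 1)) / 1"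
          proof -
            have "(of_int m * u $ 2 + of_int n * u $ 1) / of_int N = of_int k * u $ 2 + of_int l * u $ 1"
              using N by (simp add: kl field_simps)
            thus ?thesis
              by (simp only: e_def div_by_1)
          qed
          moreover have "((\<lambda>z. of_int N * ((z - a) * Fgen u (1 * z + 0) \<tau>)) \<longlongrightarrow>
             of_int N * (ee (of_real (of_int k * u $ 2 + of_int l * u $ 1)) / 1)) (at a)"
            by (intro tendsto_mult tendsto_const Fgen_residue[OF tau u _ a]) simp
          ultimately show ?thesis
            using True by simp
        next
          case False
          have "a \<notin> period_lattice \<tau>"
          proof
            assume "a \<in> period_lattice \<tau>"
            then obtain k l where "a = of_int k + of_int l * \<tau>"
              by (auto simp: period_lattice_def)
            hence "of_int m + of_int n * \<tau> = of_int (N * k) + of_int (N * l) * \<tau>"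
              unfolding mn [symmetric] by (simp add: algebra_simps)
            hence "m = N * k" "n = N * l"
              using period_lattice_eq_iff[OF tau, of "of_int m" "of_int n" "of_int (N * k)" "of_int (N * l)"]
              by (simp_all flip: of_int_mult)
            with False show False
              by simp
          qed
          hence "(\<lambda>z. Fgen u (1 * z + 0) \<tau>) analytic_on {a}"
            using u by (intro Fgen_analytic[OF tau] analytic_intros) auto
          from analytic_no_pole[OF this]
          have "((\<lambda>z. of_int N * ((z - a) * Fgen u (1 * z + 0) \<tau>)) \<longlongrightarrow> of_int N * 0) (at a)"
            by (intro tendsto_mult tendsto_const)
          thus ?thesis
            by (simp only: False if_False mult_zero_right)
        qed
        have "((\<lambda>z. (\<Sum>j\<in>res N. (z - a) * Fgen (v j) (of_int N * z + 0) \<tau>) -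
            of_int N * ((z - a) * Fgen u (1 * z + 0) \<tau>)) \<longlongrightarrow> 0) (at a)"
          using tendsto_diff[OF lim1 lim2] unfolding L by simp
        thus ?thesis
          by (simp add: f_def right_diff_distrib sum_distrib_left mult_ac)
      next
        case False
        thus ?thesis
          by (intro analytic_no_pole ana)
      qed
      thus ?thesis
        using period_latticeI[of 0 0 \<tau>] by (intro bexI[of _ 0]) auto
    qed
  qed
  thus ?thesis
    by (simp add: f_def v_def)
qed

text \<open>A weight of period M is constant on each class modulo M, so the sum over i + M k for
  fixed i is a distribution relation of level N. This lowers the denominator M N to M.\<close>

lemma Fgen_distribution_twisted:
  assumes u: "u \<notin> Z2" and M: "M \<noteq> 0" and N: "N \<noteq> 0" and X: "of_int N * X \<notin> period_lattice \<tau>"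
    and G: "\<And>i k. G (i + iscale M k) = G i"
  shows "(\<Sum>i\<in>res (M * N). G i * Fgen ((u + ivec i) /\<^sub>R of_int (M * N)) (of_int N * X) \<tau>) =
     of_int N * (\<Sum>i\<in>res M. G i * Fgen ((u + ivec i) /\<^sub>R of_int M) X \<tau>)"
proof -
  have notin: "(u + ivec i) /\<^sub>R of_int M \<notin> Z2" if "M \<noteq> 0" for i M
    by (rule scaleR_notin_Z2[of M]) (use u that in simp)
  have MN: "M * N \<noteq> 0"
    using M N by simp
  have "(\<Sum>i\<in>res (M * N). G i * Fgen ((u + ivec i) /\<^sub>R of_int (M * N)) (of_int N * X) \<tau>) =
    (\<Sum>i\<in>res M. \<Sum>k\<in>res N. G (i + iscale M k) * Fgen ((u + ivec (i + iscale M k)) /\<^sub>R of_int (M * N)) (of_int N * X) \<tau>)"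
  proof (rule sum_res_mult[OF M N])
    fix i k
    have "(u + ivec (i + iscale (M * N) k)) /\<^sub>R of_int (M * N) = (u + ivec i) /\<^sub>R of_int (M * N) + ivec k"
      using MN by (simp add: vec_eq_iff ivec_add ivec_iscale field_simps)
    moreover have "G (i + iscale (M * N) k) = G i"
    proof -
      have "iscale (M * N) k = iscale M (iscale N k)"
        by (simp add: prod_eq_iff)
      thus ?thesis
        by (simp only: G)
    qed
    ultimately show "G (i + iscale (M * N) k) * Fgen ((u + ivec (i + iscale (M * N) k)) /\<^sub>R of_int (M * N)) (of_int N * X) \<tau>
        = G i * Fgen ((u + ivec i) /\<^sub>R of_int (M * N)) (of_int N * X) \<tau>"
      using Fgen_periodic[OF tau notin[OF MN]] by simp
  qed
  also have "\<dots> = (\<Sum>i\<in>res M. G i * (\<Sum>k\<in>res N. Fgen (((u + ivec i) /\<^sub>R of_int M + ivec k) /\<^sub>R of_int N) (of_int N * X) \<tau>))"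
  proof -
    have "(u + ivec (i + iscale M k)) /\<^sub>R of_int (M * N) = ((u + ivec i) /\<^sub>R of_int M + ivec k) /\<^sub>R of_int N" for i k
      using M N by (simp add: vec_eq_iff ivec_add ivec_iscale field_simps)
    thus ?thesis
      by (simp add: G sum_distrib_left)
  qed
  also have "\<dots> = of_int N * (\<Sum>i\<in>res M. G i * Fgen ((u + ivec i) /\<^sub>R of_int M) X \<tau>)"
    unfolding Fgen_distribution[OF notin[OF M] N X] by (simp add: sum_distrib_left mult_ac)
  finally show ?thesis .
qed

end

subsection \<open>The summed Fay identity\<close>

lemma of_int_scaleR_inverse:
  fixes v :: "'a :: real_vector"
  shows "n \<noteq> 0 \<Longrightarrow> of_int n *\<^sub>R (v /\<^sub>R of_int n) = v"
  by simp

definition kron_sum :: "int \<Rightarrow> int \<Rightarrow> real ^ 2 \<Rightarrow> real ^ 2 \<Rightarrow> complex \<Rightarrow> complex \<Rightarrow> complex \<Rightarrow> complex" where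
  "kron_sum q p x y X Y \<tau> =
     (\<Sum>i\<in>res p. Fgen ((y + ivec i) /\<^sub>R of_int p) X \<tau> * Fgen (of_int q *\<^sub>R ((y + ivec i) /\<^sub>R of_int p) - x) Y \<tau>)"

context
  fixes \<tau> :: complex
  assumes tau: "Im \<tau> > 0"
begin

text \<open>The Fay identity is summed over i modulo p c and j modulo p'. In the first two products
  j enters one factor only, and its sum is a distribution relation of level p'; the twisted relation
  then lowers p c to p or to c. In the third product both factors depend on both indices, so the
  unimodular change of coordinates has to come first.\<close>

lemma kron_sum_fay:
  fixes a b c d p q p' q' :: int
  assumes det: "a * d - b * c = 1" and p': "p' = c * q + d * p" and q': "q' = a * q + b * p"
    and nz: "c \<noteq> 0" "p \<noteq> 0" "p' \<noteq> 0"
    and y: "y \<notin> Z2" and y': "of_int c *\<^sub>R x + of_int d *\<^sub>R y \<notin> Z2"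
    and xy: "of_int q *\<^sub>R y - of_int p *\<^sub>R x \<notin> Z2"
    and X3: "of_int c * X1 + of_int p' * X2 = of_int p * X3"
    and X: "of_int c * X1 \<notin> period_lattice \<tau>" "of_int p' * X2 \<notin> period_lattice \<tau>" "of_int p * X3 \<notin> period_lattice \<tau>"
  shows "of_int (p' * c) * kron_sum q p x y X1 X2 \<tau> =
    of_int (p' * p) * kron_sum (- d) c x y X3 X2 \<tau> +
    of_int (p * c) * kron_sum q' p' (of_int a *\<^sub>R x + of_int b *\<^sub>R y) (of_int c *\<^sub>R x + of_int d *\<^sub>R y) X1 X3 \<tau>"
proof -
  define \<eta> where "\<eta> = of_int c *\<^sub>R x + of_int d *\<^sub>R y"
  define \<zeta> where "\<zeta> = of_int q *\<^sub>R y - of_int p *\<^sub>R x"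
  \<comment> \<open>The index vectors obey the same relation as the base points: p' i - c (q i + p
    j) = p (d i - c j), parallel to p' y - c \<zeta> = p \<eta>. This gives
    \<open>al i - be i j = de i j\<close>.\<close>
  define al where "al i = (y + ivec i) /\<^sub>R of_int (p * c)" for i
  define be where "be i j = (\<zeta> + ivec (iscale q i + iscale p j)) /\<^sub>R of_int (p * p')" for i j
  define de where "de i j = (\<eta> + ivec (iscale d i - iscale c j)) /\<^sub>R of_int (p' * c)" for i j
  have al: "al i \<notin> Z2" for i
  proof -
    have "of_int (p * c) *\<^sub>R al i = y + ivec i"
      unfolding al_def by (rule of_int_scaleR_inverse) (use nz in simp)
    hence "of_int (p * c) *\<^sub>R al i \<notin> Z2"
      using y by (simp )
    thus ?thesis
      by (rule scaleR_notin_Z2)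
  qed
  have be: "be i j \<notin> Z2" for i j
  proof -
    have "of_int (p * p') *\<^sub>R be i j = \<zeta> + ivec (iscale q i + iscale p j)"
      unfolding be_def by (rule of_int_scaleR_inverse) (use nz in simp)
    hence "of_int (p * p') *\<^sub>R be i j \<notin> Z2"
      using xy by (simp add: \<zeta>_def)
    thus ?thesis
      by (rule scaleR_notin_Z2)
  qed
  have de: "de i j \<notin> Z2" for i j
  proof -
    have "of_int (p' * c) *\<^sub>R de i j = \<eta> + ivec (iscale d i - iscale c j)"
      unfolding de_def by (rule of_int_scaleR_inverse) (use nz in simp)
    hence "of_int (p' * c) *\<^sub>R de i j \<notin> Z2"
      using y' by (simp add: \<eta>_def)
    thus ?thesis
      by (rule scaleR_notin_Z2)
  qed
  have al_be: "al i - be i j = de i j" for i j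
  proof -
    define P C P' where "P = real_of_int p" and "C = real_of_int c" and "P' = real_of_int p'"
    have nz': "P \<noteq> 0" "C \<noteq> 0" "P' \<noteq> 0"
      using nz by (simp_all add: P_def C_def P'_def)
    have P': "P' = C * of_int q + of_int d * P"
      by (simp add: P'_def P_def C_def p')
    have *: "A / (P * C) - Q / (P * P') = R / (P' * C)" if "P' * A - C * Q = P * R" for A Q R
    proof -
      have "A / (P * C) - Q / (P * P') = (P' * A - C * Q) / (P * C * P')"
        using nz' by (simp add: field_simps)
      thus ?thesis
        using nz' by (simp add: that)
    qed
    have "(y0 + i0) / (P * C) - (of_int q * y0 - P * x0 + (of_int q * i0 + P * j0)) / (P * P')
       = (C * x0 + of_int d * y0 + (of_int d * i0 - C * j0)) / (P' * C)" for x0 y0 i0 j0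
      by (rule *) (simp add: P' algebra_simps)
    from this[of "y $ 1" "of_int (fst i)" "x $ 1" "of_int (fst j)"] this[of "y $ 2" "of_int (snd i)" "x $ 2" "of_int (snd j)"]
    show ?thesis
      by (simp add: vec_eq_iff forall_2 al_def be_def de_def \<eta>_def \<zeta>_def P_def C_def P'_def divide_inverse mult_ac)
  qed
  have X1: "of_int p' * X2 + of_int c * X1 = of_int p * X3"
    using X3 by (simp add: add_ac)
  have fay: "Fgen (al i) (of_int c * X1) \<tau> * Fgen (be i j) (of_int p' * X2) \<tau> =
      Fgen (al i) (of_int p * X3) \<tau> * Fgen (- de i j) (of_int p' * X2) \<tau> +
      Fgen (be i j) (of_int p * X3) \<tau> * Fgen (de i j) (of_int c * X1) \<tau>" for i j
    using Fgen_fay[OF tau al be, of i i j "of_int c * X1" "of_int p' * X2"] de[of i j] X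
    by (simp add: al_be X3 minus_diff_eq[of "al i" "be i j", symmetric] del: minus_diff_eq)
  have "(\<Sum>i\<in>res (p * c). \<Sum>j\<in>res p'. Fgen (al i) (of_int c * X1) \<tau> * Fgen (be i j) (of_int p' * X2) \<tau>) =
      of_int (p' * c) * kron_sum q p x y X1 X2 \<tau>"
  proof -
    define G where "G i = Fgen (of_int q *\<^sub>R ((y + ivec i) /\<^sub>R of_int p) - x) X2 \<tau>" for i
    have arg: "of_int q *\<^sub>R ((y + ivec i) /\<^sub>R of_int p) - x = (\<zeta> + ivec (iscale q i)) /\<^sub>R of_int p" for i
      using nz by (simp add: vec_eq_iff \<zeta>_def ivec_iscale field_simps)
    have notin: "(\<zeta> + ivec (iscale q i)) /\<^sub>R of_int p \<notin> Z2" for i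
      by (rule scaleR_notin_Z2[of p]) (use nz xy in \<open>simp add: \<zeta>_def\<close>)
    have inner: "(\<Sum>j\<in>res p'. Fgen (be i j) (of_int p' * X2) \<tau>) = of_int p' * G i" for i
    proof -
      have "be i j = ((\<zeta> + ivec (iscale q i)) /\<^sub>R of_int p + ivec j) /\<^sub>R of_int p'" for j
        using nz by (simp add: be_def vec_eq_iff ivec_add ivec_iscale field_simps)
      thus ?thesis
        unfolding G_def arg using Fgen_distribution[OF tau notin nz(3) X(2)] by simp
    qed
    have "(\<Sum>i\<in>res (p * c). \<Sum>j\<in>res p'. Fgen (al i) (of_int c * X1) \<tau> * Fgen (be i j) (of_int p' * X2) \<tau>) =
       of_int p' * (\<Sum>i\<in>res (p * c). G i * Fgen ((y + ivec i) /\<^sub>R of_int (p * c)) (of_int c * X1) \<tau>)"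
      unfolding al_def sum_distrib_left [symmetric] inner
      by (simp only: sum_distrib_left mult_ac)
    also have "\<dots> = of_int p' * (of_int c * (\<Sum>i\<in>res p. G i * Fgen ((y + ivec i) /\<^sub>R of_int p) X1 \<tau>))"
    proof (subst Fgen_distribution_twisted[OF tau y nz(2) nz(1) X(1)])
      fix i k
      have "(\<zeta> + ivec (iscale q (i + iscale p k))) /\<^sub>R of_int p = (\<zeta> + ivec (iscale q i)) /\<^sub>R of_int p + ivec (iscale q k)"
        using nz by (simp add: vec_eq_iff ivec_add ivec_iscale field_simps)
      thus "G (i + iscale p k) = G i"
        unfolding G_def arg using Fgen_periodic[OF tau notin] by simp
    qed simp
    finally show ?thesis
      by (simp add: kron_sum_def G_def mult_ac)
  qed
  moreover have "(\<Sum>i\<in>res (p * c). \<Sum>j\<in>res p'. Fgen (al i) (of_int p * X3) \<tau> * Fgen (- de i j) (of_int p' * X2) \<tau>) =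
      of_int (p' * p) * kron_sum (- d) c x y X3 X2 \<tau>"
  proof -
    define G where "G i = Fgen (of_int (- d) *\<^sub>R ((y + ivec i) /\<^sub>R of_int c) - x) X2 \<tau>" for i
    have arg: "of_int (- d) *\<^sub>R ((y + ivec i) /\<^sub>R of_int c) - x = - ((\<eta> + ivec (iscale d i)) /\<^sub>R of_int c)" for i
      using nz by (simp add: vec_eq_iff \<eta>_def ivec_iscale field_simps)
    have notin: "- ((\<eta> + ivec (iscale d i)) /\<^sub>R of_int c) \<notin> Z2" for i
      unfolding Z2_uminus_iff by (rule scaleR_notin_Z2[of c]) (use nz y' in \<open>simp add: \<eta>_def\<close>)
    have inner: "(\<Sum>j\<in>res p'. Fgen (- de i j) (of_int p' * X2) \<tau>) = of_int p' * G i" for i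
    proof -
      have "- de i j = (- ((\<eta> + ivec (iscale d i)) /\<^sub>R of_int c) + ivec j) /\<^sub>R of_int p'" for j
        using nz by (simp add: de_def vec_eq_iff ivec_diff ivec_iscale field_simps)
      thus ?thesis
        unfolding G_def arg using Fgen_distribution[OF tau notin nz(3) X(2)] by simp
    qed
    have "(\<Sum>i\<in>res (p * c). \<Sum>j\<in>res p'. Fgen (al i) (of_int p * X3) \<tau> * Fgen (- de i j) (of_int p' * X2) \<tau>) =
       of_int p' * (\<Sum>i\<in>res (c * p). G i * Fgen ((y + ivec i) /\<^sub>R of_int (c * p)) (of_int p * X3) \<tau>)"
      unfolding al_def sum_distrib_left [symmetric] inner
      by (simp only: sum_distrib_left mult_ac)
    also have "\<dots> = of_int p' * (of_int p * (\<Sum>i\<in>res c. G i * Fgen ((y + ivec i) /\<^sub>R of_int c) X3 \<tau>))"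
    proof (subst Fgen_distribution_twisted[OF tau y nz(1) nz(2) X(3)])
      fix i k
      have "- ((\<eta> + ivec (iscale d (i + iscale c k))) /\<^sub>R of_int c) = - ((\<eta> + ivec (iscale d i)) /\<^sub>R of_int c) + ivec (iscale (- d) k)"
        using nz by (simp add: vec_eq_iff ivec_add ivec_iscale field_simps)
      thus "G (i + iscale c k) = G i"
        unfolding G_def arg using Fgen_periodic[OF tau notin] by simp
    qed simp
    finally show ?thesis
      by (simp add: kron_sum_def G_def mult_ac)
  qed
  moreover have "(\<Sum>i\<in>res (p * c). \<Sum>j\<in>res p'. Fgen (be i j) (of_int p * X3) \<tau> * Fgen (de i j) (of_int c * X1) \<tau>) =
    of_int (p * c) * kron_sum q' p' (of_int a *\<^sub>R x + of_int b *\<^sub>R y) \<eta> X1 X3 \<tau>"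
  proof -
    \<comment> \<open>In the coordinates (k, z) the characteristic \<open>de\<close> depends on k
      alone up to integer vectors, so the z-sum acts on \<open>be\<close> only.\<close>
    define be' where "be' k z = (\<zeta> + ivec (iscale q' k + iscale p' z)) /\<^sub>R of_int (p * p')" for k z
    define de' where "de' k = (\<eta> + ivec k) /\<^sub>R of_int (p' * c)" for k
    define G where "G k = Fgen (of_int q' *\<^sub>R ((\<eta> + ivec k) /\<^sub>R of_int p') - (of_int a *\<^sub>R x + of_int b *\<^sub>R y)) X3 \<tau>" for k
    have arg: "of_int q' *\<^sub>R ((\<eta> + ivec k) /\<^sub>R of_int p') - (of_int a *\<^sub>R x + of_int b *\<^sub>R y) =
        (\<zeta> + ivec (iscale q' k)) /\<^sub>R of_int p'" for k
    proof -
      have "real_of_int p' = of_int c * of_int q + of_int d * of_int p"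
        "real_of_int q' = of_int a * of_int q + of_int b * of_int p"
        by (simp_all add: p' q')
      moreover have "of_int a * of_int d - of_int b * of_int c = (1 :: real)"
        using det by (metis of_int_1 of_int_diff of_int_mult)
      ultimately have key: "of_int q' * (of_int c * x0 + of_int d * y0) - of_int p' * (of_int a * x0 + of_int b * y0) =
          of_int q * y0 - of_int p * x0" for x0 y0 :: real
        by algebra
      have "Q * ((E + K) / of_int p') - A = (Z + Q * K) / of_int p'" if "Q * E - of_int p' * A = Z" for Q E K A Z :: real
        using nz that by (simp add: field_simps)
      note * = this[OF key]
      show ?thesis
        using *[of "x $ 1" "y $ 1" "of_int (fst k)"] *[of "x $ 2" "y $ 2" "of_int (snd k)"]
        by (simp add: vec_eq_iff forall_2 \<eta>_def \<zeta>_def ivec_iscale divide_inverse mult_ac)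
    qed
    have notin: "(\<zeta> + ivec (iscale q' k)) /\<^sub>R of_int p' \<notin> Z2" for k
      by (rule scaleR_notin_Z2[of p']) (use nz xy in \<open>simp add: \<zeta>_def\<close>)
    have inner: "(\<Sum>z\<in>res p. Fgen (be' k z) (of_int p * X3) \<tau>) = of_int p * G k" for k
    proof -
      have "be' k z = ((\<zeta> + ivec (iscale q' k)) /\<^sub>R of_int p' + ivec z) /\<^sub>R of_int p" for z
        using nz by (simp add: be'_def vec_eq_iff ivec_add ivec_iscale field_simps)
      thus ?thesis
        unfolding G_def arg using Fgen_distribution[OF tau notin nz(2) X(3)] by simp
    qed
    have "(\<Sum>i\<in>res (p * c). \<Sum>j\<in>res p'. Fgen (be i j) (of_int p * X3) \<tau> * Fgen (de i j) (of_int c * X1) \<tau>) =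
        (\<Sum>k\<in>res (p' * c). \<Sum>z\<in>res p. Fgen (be' k z) (of_int p * X3) \<tau> * Fgen (de' k) (of_int c * X1) \<tau>)"
    proof (rule sum_res_unimodular[OF det p' q' nz])
      fix i j t w
      define k z where "k = iscale d i - iscale c j + iscale (c * p') t"
        and "z = iscale a j - iscale b i - iscale (q' * c) t + iscale p w"
      have e1: "a * p' - q' * c = p"
        using arg_cong[OF det, of "\<lambda>x. x * p"] by (simp add: p' q' algebra_simps)
      have e2: "d * q' - b * p' = q"
        using arg_cong[OF det, of "\<lambda>x. x * q"] by (simp add: p' q' algebra_simps)
      have *: "q' * (d * i0 - c * j0 + c * p' * t0) + p' * (a * j0 - b * i0 - q' * c * t0 + p * w0) =
        q * i0 + p * j0 + p * p' * w0" for i0 j0 t0 w0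
      proof -
        have "q' * (d * i0 - c * j0 + c * p' * t0) + p' * (a * j0 - b * i0 - q' * c * t0 + p * w0) =
          (d * q' - b * p') * i0 + (a * p' - q' * c) * j0 + p * p' * w0"
          by (simp add: algebra_simps)
        thus ?thesis
          by (simp only: e1 e2)
      qed
      have "iscale q' k + iscale p' z = iscale q i + iscale p j + iscale (p * p') w"
        using *[of "fst i" "fst j" "fst t" "fst w"] *[of "snd i" "snd j" "snd t" "snd w"]
        by (simp add: k_def z_def prod_eq_iff)
      hence "be' k z = be i j + ivec w"
        using nz by (simp add: be'_def be_def vec_eq_iff ivec_add ivec_iscale field_simps)
      moreover have "de' k = de i j + ivec t"
        using nz by (simp add: de'_def de_def k_def vec_eq_iff ivec_add ivec_diff ivec_iscale field_simps)
      ultimately show "Fgen (be i j) (of_int p * X3) \<tau> * Fgen (de i j) (of_int c * X1) \<tau> =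
         Fgen (be' k z) (of_int p * X3) \<tau> * Fgen (de' k) (of_int c * X1) \<tau>"
        using Fgen_periodic[OF tau be] Fgen_periodic[OF tau de] by simp
    qed
    also have "\<dots> =
       of_int p * (\<Sum>k\<in>res (p' * c). G k * Fgen ((\<eta> + ivec k) /\<^sub>R of_int (p' * c)) (of_int c * X1) \<tau>)"
      unfolding de'_def sum_distrib_right [symmetric] inner
      by (simp only: sum_distrib_left mult_ac)
    also have "\<dots> = of_int p * (of_int c * (\<Sum>k\<in>res p'. G k * Fgen ((\<eta> + ivec k) /\<^sub>R of_int p') X1 \<tau>))"
    proof (subst Fgen_distribution_twisted[OF tau _ nz(3) nz(1) X(1)])
      show "\<eta> \<notin> Z2"
        using y' by (simp add: \<eta>_def)
      fix i k
      have "(\<zeta> + ivec (iscale q' (i + iscale p' k))) /\<^sub>R of_int p' = (\<zeta> + ivec (iscale q' i)) /\<^sub>R of_int p' + ivec (iscale q' k)"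
        using nz by (simp add: vec_eq_iff ivec_add ivec_iscale field_simps)
      thus "G (i + iscale p' k) = G i"
        unfolding G_def arg using Fgen_periodic[OF tau notin] by simp
    qed simp
    finally show ?thesis
      by (simp add: kron_sum_def G_def mult_ac)
  qed
  ultimately show ?thesis
    by (simp add: fay sum.distrib flip: \<eta>_def)
qed

end

subsection \<open>Laurent coefficients\<close>

text \<open>Agreement near 0 but not at 0 is enough. The identities for the Kronecker function hold
  only off the lattice, so 0 itself is always excluded.\<close>

lemma has_fps_expansion_unique_at:
  fixes f g :: "complex \<Rightarrow> complex"
  assumes "f has_fps_expansion F" "g has_fps_expansion G" "eventually (\<lambda>z. f z = g z) (at 0)"
  shows "F = G"
proof -
  have "f has_laurent_expansion fps_to_fls F" "g has_laurent_expansion fps_to_fls G"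
    using assms(1,2) by (auto intro: has_laurent_expansion_fps)
  moreover have "f has_laurent_expansion fps_to_fls F \<longleftrightarrow> g has_laurent_expansion fps_to_fls F"
    using assms(3) by (intro has_laurent_expansion_cong) auto
  ultimately have "fps_to_fls F = fps_to_fls G"
    using has_laurent_expansion_unique by blast
  thus ?thesis
    by simp
qed

lemma filterlim_cmult_at_0: "k \<noteq> 0 \<Longrightarrow> filterlim (\<lambda>X. k * X) (at 0) (at (0 :: complex))"
  by (auto simp: filterlim_at eventually_at_filter intro!: tendsto_eq_intros)

lemma eventually_cmult_at_0:
  "k \<noteq> (0 :: complex) \<Longrightarrow> eventually P (at 0) \<Longrightarrow> eventually (\<lambda>X. P (k * X)) (at 0)"
  using filterlim_cmult_at_0[of k] unfolding filterlim_iff by blast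

text \<open>Off the lattice this is (2 pi i)^m B_m / m!, the normalisation in which products of
  generating functions carry no factorials.\<close>

definition kron_coeff :: "nat \<Rightarrow> real ^ 2 \<Rightarrow> complex \<Rightarrow> complex" where
  "kron_coeff m v \<tau> = fls_nth (laurent_expansion (\<lambda>X. Fgen v X \<tau>) 0) (int m - 1)"

text \<open>Multiplying by X and filling in the value at 0 turns the Laurent series with its simple
  pole into a power series.\<close>

definition Fgen_reg :: "real ^ 2 \<Rightarrow> complex \<Rightarrow> complex \<Rightarrow> complex" where
  "Fgen_reg v \<tau> = remove_sings (\<lambda>X. X * Fgen v X \<tau>)"

definition kron_coeff_sum :: "nat \<Rightarrow> nat \<Rightarrow> int \<Rightarrow> int \<Rightarrow> real ^ 2 \<Rightarrow> real ^ 2 \<Rightarrow> complex \<Rightarrow> complex" where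
  "kron_coeff_sum m n q p x y \<tau> =
     (\<Sum>i\<in>res p. kron_coeff m ((y + ivec i) /\<^sub>R of_int p) \<tau> *
        kron_coeff n (of_int q *\<^sub>R ((y + ivec i) /\<^sub>R of_int p) - x) \<tau>)"

lemma kron_sum_args_notin_Z2:
  assumes "p \<noteq> 0" "y \<notin> Z2" "of_int q *\<^sub>R y - of_int p *\<^sub>R x \<notin> Z2"
  shows "(y + ivec i) /\<^sub>R of_int p \<notin> Z2" "of_int q *\<^sub>R ((y + ivec i) /\<^sub>R of_int p) - x \<notin> Z2"
proof -
  show "(y + ivec i) /\<^sub>R of_int p \<notin> Z2"
    by (rule scaleR_notin_Z2[of p]) (use assms in simp)
  have "of_int p *\<^sub>R (of_int q *\<^sub>R ((y + ivec i) /\<^sub>R of_int p) - x) =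
      (of_int q *\<^sub>R y - of_int p *\<^sub>R x) + ivec (iscale q i)"
    using assms(1) by (simp add: vec_eq_iff ivec_iscale field_simps)
  hence "of_int p *\<^sub>R (of_int q *\<^sub>R ((y + ivec i) /\<^sub>R of_int p) - x) \<notin> Z2"
    using assms(3) by (simp only: Z2_add_ivec_iff not_False_eq_True)
  thus "of_int q *\<^sub>R ((y + ivec i) /\<^sub>R of_int p) - x \<notin> Z2"
    by (rule scaleR_notin_Z2)
qed

context
  fixes \<tau> :: complex
  assumes tau: "Im \<tau> > 0"
begin

lemma isolated_singularity_Fgen: "isolated_singularity_at (\<lambda>X. X * Fgen v X \<tau>) 0"
proof -
  have "(\<lambda>X. X * Fgen v X \<tau>) meromorphic_on {0}"
    by (intro meromorphic_intros Fgen_meromorphic[OF tau] analytic_intros)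
  thus ?thesis
    by (rule meromorphic_on_isolated_singularity)
qed

lemma Fgen_reg_eventually: "eventually (\<lambda>X. Fgen_reg v \<tau> X = X * Fgen v X \<tau>) (at 0)"
  unfolding Fgen_reg_def by (rule eventually_remove_sings_eq_at[OF isolated_singularity_Fgen])

lemma Fgen_reg_has_fps_expansion:
  assumes v: "v \<notin> Z2"
  shows "Fgen_reg v \<tau> has_fps_expansion Abs_fps (\<lambda>m. kron_coeff m v \<tau>)"
proof -
  have "Fgen_reg v \<tau> analytic_on {0}"
    unfolding Fgen_reg_def
    by (rule remove_sings_analytic_at[OF isolated_singularity_Fgen Fgen_residue_0[OF tau v]])
  hence exp: "Fgen_reg v \<tau> has_fps_expansion fps_expansion (Fgen_reg v \<tau>) 0" (is "_ has_fps_expansion ?G")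
    by (rule analytic_at_imp_has_fps_expansion_0)
  have e1: "(\<lambda>X. Fgen_reg v \<tau> X * X powi (- 1)) has_laurent_expansion fls_shift 1 (fps_to_fls ?G)"
    by (intro has_laurent_expansion_shift' has_laurent_expansion_fps exp)
  have e2: "eventually (\<lambda>X. Fgen_reg v \<tau> X * X powi (- 1) = Fgen v X \<tau>) (at 0)"
    using Fgen_reg_eventually[of v] eventually_neq_at_within[of 0]
    by eventually_elim (simp add: power_int_minus)
  have "(\<lambda>X. Fgen v X \<tau>) has_laurent_expansion fls_shift 1 (fps_to_fls ?G)"
    by (rule has_laurent_expansion_cong[THEN iffD1, OF e2 refl e1])
  hence "laurent_expansion (\<lambda>X. Fgen v X \<tau>) 0 = fls_shift 1 (fps_to_fls ?G)"
    by (rule laurent_expansion_0_eqI)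
  hence "fps_nth ?G m = kron_coeff m v \<tau>" for m
    by (simp add: kron_coeff_def)
  hence "Abs_fps (\<lambda>m. kron_coeff m v \<tau>) = ?G"
    by (simp add: fps_eq_iff)
  thus ?thesis
    using exp by simp
qed

lemma Fgen_reg_scaled_has_fps_expansion:
  assumes "v \<notin> Z2"
  shows "(\<lambda>Y. Fgen_reg v \<tau> (k * Y)) has_fps_expansion Abs_fps (\<lambda>m. k ^ m * kron_coeff m v \<tau>)"
proof -
  have "(Fgen_reg v \<tau> \<circ> (\<lambda>Y. k * Y)) has_fps_expansion
      fps_compose (Abs_fps (\<lambda>m. kron_coeff m v \<tau>)) (fps_const k * fps_X)"
    by (intro has_fps_expansion_compose Fgen_reg_has_fps_expansion assms fps_expansion_intros) auto
  moreover have "fps_compose (Abs_fps (\<lambda>m. kron_coeff m v \<tau>)) (fps_const k * fps_X) = Abs_fps (\<lambda>m. k ^ m * kron_coeff m v \<tau>)"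
    by (simp add: fps_eq_iff)
  ultimately show ?thesis
    by (simp add: o_def)
qed

lemma kron_coeff_0:
  assumes "v \<notin> Z2"
  shows "kron_coeff 0 v \<tau> = 1"
proof -
  have "Fgen_reg v \<tau> 0 = 1"
    unfolding Fgen_reg_def by (rule remove_sings_eqI[OF Fgen_residue_0[OF tau assms]])
  thus ?thesis
    using has_fps_expansion_imp_0_eq_fps_nth_0[OF Fgen_reg_has_fps_expansion[OF assms]] by simp
qed

lemma kron_coeff_periodic: "v \<notin> Z2 \<Longrightarrow> kron_coeff m (v + ivec j) \<tau> = kron_coeff m v \<tau>"
  by (simp add: kron_coeff_def Fgen_periodic[OF tau])

lemma kron_coeff_uminus:
  assumes "v \<notin> Z2"
  shows "kron_coeff m (- v) \<tau> = (- 1) ^ m * kron_coeff m v \<tau>"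
proof -
  have "Abs_fps (\<lambda>m. kron_coeff m (- v) \<tau>) = Abs_fps (\<lambda>m. (- 1) ^ m * kron_coeff m v \<tau>)"
  proof (rule has_fps_expansion_unique_at)
    show "Fgen_reg (- v) \<tau> has_fps_expansion Abs_fps (\<lambda>m. kron_coeff m (- v) \<tau>)"
      using assms by (intro Fgen_reg_has_fps_expansion) simp
    show "(\<lambda>Y. Fgen_reg v \<tau> (- 1 * Y)) has_fps_expansion Abs_fps (\<lambda>m. (- 1) ^ m * kron_coeff m v \<tau>)"
      by (rule Fgen_reg_scaled_has_fps_expansion[OF assms])
    have "eventually (\<lambda>X. Fgen_reg v \<tau> (- 1 * X) = - 1 * X * Fgen v (- 1 * X) \<tau>) (at 0)"
      by (rule eventually_cmult_at_0[OF _ Fgen_reg_eventually]) simp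
    thus "eventually (\<lambda>X. Fgen_reg (- v) \<tau> X = Fgen_reg v \<tau> (- 1 * X)) (at 0)"
      using Fgen_reg_eventually[of "- v"]
    proof eventually_elim
      case (elim X)
      thus ?case
        using Fgen_uminus[OF tau, of "- v" X] by simp
    qed
  qed
  thus ?thesis
    by (simp add: fps_eq_iff)
qed

lemma eventually_notin_period_lattice:
  assumes "k \<noteq> 0"
  shows "eventually (\<lambda>X. k * X \<notin> period_lattice \<tau>) (at 0)"
proof (rule eventually_cmult_at_0[OF assms])
  have "eventually (\<lambda>z. theta z \<tau> / z \<noteq> 0) (at 0)"
    by (rule tendsto_imp_eventually_ne[OF theta_over_self_tendsto[OF tau] theta'_0_nonzero[OF tau]])
  thus "eventually (\<lambda>z. z \<notin> period_lattice \<tau>) (at 0)"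
    by eventually_elim (auto simp flip: theta_eq_0_iff[OF tau])
qed

text \<open>One factor N comes from the distribution relation, the other from the factor N X that
  clears the pole of F(v; N X).\<close>

lemma kron_coeff_distribution:
  assumes u: "u \<notin> Z2" and N: "N \<noteq> 0"
  shows "of_int N ^ m * (\<Sum>j\<in>res N. kron_coeff m ((u + ivec j) /\<^sub>R of_int N) \<tau>) = of_int N ^ 2 * kron_coeff m u \<tau>"
proof -
  define v where "v j = (u + ivec j) /\<^sub>R of_int N" for j
  have v: "v j \<notin> Z2" for j
    unfolding v_def by (rule scaleR_notin_Z2[of N]) (use u N in simp)
  have "(\<Sum>j\<in>res N. Abs_fps (\<lambda>m. of_int N ^ m * kron_coeff m (v j) \<tau>)) =
      fps_const (of_int N ^ 2) * Abs_fps (\<lambda>m. kron_coeff m u \<tau>)"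
  proof (rule has_fps_expansion_unique_at)
    show "(\<lambda>X. \<Sum>j\<in>res N. Fgen_reg (v j) \<tau> (of_int N * X)) has_fps_expansion
        (\<Sum>j\<in>res N. Abs_fps (\<lambda>m. of_int N ^ m * kron_coeff m (v j) \<tau>))"
      by (intro has_fps_expansion_sum Fgen_reg_scaled_has_fps_expansion v)
    show "(\<lambda>X. of_int N ^ 2 * Fgen_reg u \<tau> X) has_fps_expansion
        fps_const (of_int N ^ 2) * Abs_fps (\<lambda>m. kron_coeff m u \<tau>)"
      by (intro has_fps_expansion_cmult_left Fgen_reg_has_fps_expansion u)
    have "eventually (\<lambda>X. \<forall>j\<in>res N. Fgen_reg (v j) \<tau> (of_int N * X) = of_int N * X * Fgen (v j) (of_int N * X) \<tau>) (at 0)"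
      using N by (intro eventually_ball_finite ballI eventually_cmult_at_0[OF _ Fgen_reg_eventually]) auto
    moreover have "eventually (\<lambda>X. of_int N * X \<notin> period_lattice \<tau>) (at 0)"
      using N by (intro eventually_notin_period_lattice) simp
    ultimately show "eventually (\<lambda>X. (\<Sum>j\<in>res N. Fgen_reg (v j) \<tau> (of_int N * X)) = of_int N ^ 2 * Fgen_reg u \<tau> X) (at 0)"
      using Fgen_reg_eventually[of u]
    proof eventually_elim
      case (elim X)
      have "(\<Sum>j\<in>res N. Fgen_reg (v j) \<tau> (of_int N * X)) = of_int N * X * (\<Sum>j\<in>res N. Fgen (v j) (of_int N * X) \<tau>)"
        using elim(1) by (simp add: sum_distrib_left)
      also have "\<dots> = of_int N ^ 2 * Fgen_reg u \<tau> X"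
        unfolding v_def Fgen_distribution[OF tau u N elim(2)] elim(3) by (simp add: power2_eq_square)
      finally show ?case .
    qed
  qed
  hence "fps_nth (\<Sum>j\<in>res N. Abs_fps (\<lambda>m. of_int N ^ m * kron_coeff m (v j) \<tau>)) m =
      of_int N ^ 2 * kron_coeff m u \<tau>"
    by simp
  thus ?thesis
    by (simp add: fps_sum_nth sum_distrib_left v_def)
qed

text \<open>Restriction to the line through (k, l) replaces a double series by a series in one
  variable, whose coefficient of degree N is the homogeneous part of degree N evaluated at (k,
  l).\<close>

lemma kron_sum_has_expansion:
  assumes p: "p \<noteq> 0" and y: "y \<notin> Z2" and xy: "of_int q *\<^sub>R y - of_int p *\<^sub>R x \<notin> Z2"
    and k: "k \<noteq> 0" and l: "l \<noteq> 0"
  obtains f where "f has_fps_expansion Abs_fps (\<lambda>N. \<Sum>m\<le>N. k ^ m * l ^ (N - m) * kron_coeff_sum m (N - m) q p x y \<tau>)"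
    "eventually (\<lambda>Y. f Y = (k * Y) * (l * Y) * kron_sum q p x y (k * Y) (l * Y) \<tau>) (at 0)"
proof -
  define u v where "u i = (y + ivec i) /\<^sub>R of_int p" and "v i = of_int q *\<^sub>R u i - x" for i
  have u: "u i \<notin> Z2" and v: "v i \<notin> Z2" for i
    using kron_sum_args_notin_Z2[OF p y xy] by (simp_all add: u_def v_def)
  define f where "f Y = (\<Sum>i\<in>res p. Fgen_reg (u i) \<tau> (k * Y) * Fgen_reg (v i) \<tau> (l * Y))" for Y
  show ?thesis
  proof (rule that[of f])
    have "f has_fps_expansion (\<Sum>i\<in>res p. Abs_fps (\<lambda>m. k ^ m * kron_coeff m (u i) \<tau>) * Abs_fps (\<lambda>m. l ^ m * kron_coeff m (v i) \<tau>))"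
      unfolding f_def
      by (intro has_fps_expansion_sum has_fps_expansion_mult Fgen_reg_scaled_has_fps_expansion u v)
    also have "(\<Sum>i\<in>res p. Abs_fps (\<lambda>m. k ^ m * kron_coeff m (u i) \<tau>) * Abs_fps (\<lambda>m. l ^ m * kron_coeff m (v i) \<tau>)) =
       Abs_fps (\<lambda>N. \<Sum>m\<le>N. k ^ m * l ^ (N - m) * kron_coeff_sum m (N - m) q p x y \<tau>)"
    proof (rule fps_ext)
      fix N
      have "fps_nth (\<Sum>i\<in>res p. Abs_fps (\<lambda>m. k ^ m * kron_coeff m (u i) \<tau>) * Abs_fps (\<lambda>m. l ^ m * kron_coeff m (v i) \<tau>)) N =
        (\<Sum>i\<in>res p. \<Sum>m\<le>N. k ^ m * kron_coeff m (u i) \<tau> * (l ^ (N - m) * kron_coeff (N - m) (v i) \<tau>))"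
        by (simp add: fps_sum_nth fps_mult_nth atLeast0AtMost)
      also have "\<dots> = (\<Sum>m\<le>N. k ^ m * l ^ (N - m) * kron_coeff_sum m (N - m) q p x y \<tau>)"
        by (subst sum.swap) (simp add: kron_coeff_sum_def sum_distrib_left mult_ac u_def v_def)
      finally show "fps_nth (\<Sum>i\<in>res p. Abs_fps (\<lambda>m. k ^ m * kron_coeff m (u i) \<tau>) * Abs_fps (\<lambda>m. l ^ m * kron_coeff m (v i) \<tau>)) N =
        fps_nth (Abs_fps (\<lambda>N. \<Sum>m\<le>N. k ^ m * l ^ (N - m) * kron_coeff_sum m (N - m) q p x y \<tau>)) N"
        by simp
    qed
    finally show "f has_fps_expansion Abs_fps (\<lambda>N. \<Sum>m\<le>N. k ^ m * l ^ (N - m) * kron_coeff_sum m (N - m) q p x y \<tau>)" .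
    have "eventually (\<lambda>Y. \<forall>i\<in>res p. Fgen_reg (u i) \<tau> (k * Y) = k * Y * Fgen (u i) (k * Y) \<tau>) (at 0)"
      using k by (intro eventually_ball_finite ballI eventually_cmult_at_0[OF _ Fgen_reg_eventually]) auto
    moreover have "eventually (\<lambda>Y. \<forall>i\<in>res p. Fgen_reg (v i) \<tau> (l * Y) = l * Y * Fgen (v i) (l * Y) \<tau>) (at 0)"
      using l by (intro eventually_ball_finite ballI eventually_cmult_at_0[OF _ Fgen_reg_eventually]) auto
    ultimately show "eventually (\<lambda>Y. f Y = (k * Y) * (l * Y) * kron_sum q p x y (k * Y) (l * Y) \<tau>) (at 0)"
      by eventually_elim (simp add: f_def kron_sum_def sum_distrib_left mult_ac u_def v_def)
  qed
qed

end

section \<open>From the functional equation to an identity of coefficients\<close>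

lemma derivatives_at_0_unique:
  fixes f g :: "complex \<Rightarrow> complex"
  assumes f: "(f has_field_derivative D) (at 0)" and g: "(g has_field_derivative E) (at 0)"
    and eq: "eventually (\<lambda>t. f t = g t) (at 0)"
  shows "f 0 = g 0" "D = E"
proof -
  have "(f \<longlongrightarrow> f 0) (at 0)" "(g \<longlongrightarrow> g 0) (at 0)"
    using DERIV_isCont[OF f] DERIV_isCont[OF g] by (simp_all add: isCont_def)
  moreover from this(1) have "(g \<longlongrightarrow> f 0) (at 0)"
    by (rule Lim_transform_eventually[OF _ eq])
  ultimately show 0: "f 0 = g 0"
    using tendsto_unique[OF trivial_limit_at] by blast
  have "eventually (\<lambda>t. f t = g t) (nhds 0)"
    using eq 0 by (auto simp: eventually_at_filter elim: eventually_mono)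
  hence "(g has_field_derivative D) (at 0)"
    using DERIV_cong_ev[of 0 0 f g D D] f by simp
  thus "D = E"
    using g by (rule DERIV_unique)
qed

text \<open>The left side is the determinant of the columns (q', p') and (\<xi>, \<eta>), which
  arise from (q, p) and (x, y) by the same matrix of determinant 1.\<close>

lemma lattice_form_identity:
  fixes a b c d p q p' q' :: int and x y :: "real ^ 2"
  assumes det: "a * d - b * c = 1" and p': "p' = c * q + d * p" and q': "q' = a * q + b * p"
  shows "of_int q' *\<^sub>R (of_int c *\<^sub>R x + of_int d *\<^sub>R y) - of_int p' *\<^sub>R (of_int a *\<^sub>R x + of_int b *\<^sub>R y)
     = of_int q *\<^sub>R y - of_int p *\<^sub>R x"
proof -
  have "real_of_int p' = of_int c * of_int q + of_int d * of_int p"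
    "real_of_int q' = of_int a * of_int q + of_int b * of_int p"
    by (simp_all add: p' q')
  moreover have "of_int a * of_int d - of_int b * of_int c = (1 :: real)"
    using det by (metis of_int_1 of_int_diff of_int_mult)
  ultimately have "of_int q' * (of_int c * x0 + of_int d * y0) - of_int p' * (of_int a * x0 + of_int b * y0) =
      of_int q * y0 - of_int p * x0" for x0 y0 :: real
    by algebra
  thus ?thesis
    by (simp add: vec_eq_iff)
qed

context
  fixes \<tau> :: complex
  assumes tau: "Im \<tau> > 0"
begin

text \<open>The summed Fay identity on the line X1 = t Y, X2 = Y, X3 = \<mu> Y, multiplied by t
  \<mu> Y^2. Each \<open>kron_sum\<close> absorbs its own two variables to clear its poles; the
  variable left over gives the factor \<mu>, t or 1. Nonzero t and \<mu> keep the arguments off the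
  lattice for small Y.\<close>

lemma kron_coeff_sum_fay:
  fixes a b c d p q p' q' :: int and x y :: "real ^ 2"
  defines "\<xi> \<equiv> of_int a *\<^sub>R x + of_int b *\<^sub>R y" and "\<eta> \<equiv> of_int c *\<^sub>R x + of_int d *\<^sub>R y"
  assumes det: "a * d - b * c = 1" and p': "p' = c * q + d * p" and q': "q' = a * q + b * p"
    and nz: "c \<noteq> 0" "p \<noteq> 0" "p' \<noteq> 0"
    and y: "y \<notin> Z2" and y': "\<eta> \<notin> Z2" and xy: "of_int q *\<^sub>R y - of_int p *\<^sub>R x \<notin> Z2"
    and t: "t \<noteq> 0" and \<mu>: "\<mu> \<noteq> 0" "of_int c * t + of_int p' = of_int p * \<mu>"
  shows "of_int (p' * c) * \<mu> * (\<Sum>m\<le>N. t ^ m * kron_coeff_sum m (N - m) q p x y \<tau>) =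
    of_int (p' * p) * t * (\<Sum>m\<le>N. \<mu> ^ m * kron_coeff_sum m (N - m) (- d) c x y \<tau>) +
    of_int (p * c) * (\<Sum>m\<le>N. t ^ m * \<mu> ^ (N - m) * kron_coeff_sum m (N - m) q' p' \<xi> \<eta> \<tau>)"
proof -
  \<comment> \<open>The trivial powers of 1 bring the sums into the shape of
    \<open>kron_sum_has_expansion\<close> with second slope 1.\<close>
  define S1 where "S1 N = (\<Sum>m\<le>N. t ^ m * 1 ^ (N - m) * kron_coeff_sum m (N - m) q p x y \<tau>)" for N
  define S2 where "S2 N = (\<Sum>m\<le>N. \<mu> ^ m * 1 ^ (N - m) * kron_coeff_sum m (N - m) (- d) c x y \<tau>)" for N
  define S3 where "S3 N = (\<Sum>m\<le>N. t ^ m * \<mu> ^ (N - m) * kron_coeff_sum m (N - m) q' p' \<xi> \<eta> \<tau>)" for N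
  obtain f1 where f1: "f1 has_fps_expansion Abs_fps S1"
    "eventually (\<lambda>Y. f1 Y = (t * Y) * (1 * Y) * kron_sum q p x y (t * Y) (1 * Y) \<tau>) (at 0)"
    unfolding S1_def by (rule kron_sum_has_expansion[OF tau nz(2) y xy t, of 1]) auto
  have "of_int (- d) *\<^sub>R y - of_int c *\<^sub>R x = - \<eta>"
    by (simp add: \<eta>_def)
  hence "of_int (- d) *\<^sub>R y - of_int c *\<^sub>R x \<notin> Z2"
    using y' by (simp only: Z2_uminus_iff not_False_eq_True)
  then obtain f2 where f2: "f2 has_fps_expansion Abs_fps S2"
    "eventually (\<lambda>Y. f2 Y = (\<mu> * Y) * (1 * Y) * kron_sum (- d) c x y (\<mu> * Y) (1 * Y) \<tau>) (at 0)"
    unfolding S2_def using kron_sum_has_expansion[OF tau nz(1) y _ \<mu>(1), of "- d" x 1] by auto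
  have "of_int q' *\<^sub>R \<eta> - of_int p' *\<^sub>R \<xi> \<notin> Z2"
    unfolding \<xi>_def \<eta>_def lattice_form_identity[OF det p' q'] by (rule xy)
  from kron_sum_has_expansion[OF tau nz(3) y' this t \<mu>(1)]
  obtain f3 where f3: "f3 has_fps_expansion Abs_fps S3"
    "eventually (\<lambda>Y. f3 Y = (t * Y) * (\<mu> * Y) * kron_sum q' p' \<xi> \<eta> (t * Y) (\<mu> * Y) \<tau>) (at 0)"
    unfolding S3_def by blast
  have "fps_const (of_int (p' * c) * \<mu>) * Abs_fps S1 =
      fps_const (of_int (p' * p) * t) * Abs_fps S2 + fps_const (of_int (p * c)) * Abs_fps S3"
  proof (rule has_fps_expansion_unique_at)
    show "(\<lambda>Y. (of_int (p' * c) * \<mu>) * f1 Y) has_fps_expansion fps_const (of_int (p' * c) * \<mu>) * Abs_fps S1"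
      by (intro has_fps_expansion_cmult_left f1)
    show "(\<lambda>Y. (of_int (p' * p) * t) * f2 Y + of_int (p * c) * f3 Y) has_fps_expansion
        fps_const (of_int (p' * p) * t) * Abs_fps S2 + fps_const (of_int (p * c)) * Abs_fps S3"
      by (intro has_fps_expansion_add has_fps_expansion_cmult_left f2 f3)
    have "eventually (\<lambda>Y. of_int c * t * Y \<notin> period_lattice \<tau>) (at 0)"
      "eventually (\<lambda>Y. of_int p' * Y \<notin> period_lattice \<tau>) (at 0)"
      "eventually (\<lambda>Y. of_int p * \<mu> * Y \<notin> period_lattice \<tau>) (at 0)"
      using nz t \<mu>(1) by (intro eventually_notin_period_lattice[OF tau]; simp)+
    thus "eventually (\<lambda>Y. (of_int (p' * c) * \<mu>) * f1 Y = (of_int (p' * p) * t) * f2 Y + of_int (p * c) * f3 Y) (at 0)"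
      using f1(2) f2(2) f3(2)
    proof eventually_elim
      case (elim Y)
      have *: "of_int (p' * c) * kron_sum q p x y (t * Y) (1 * Y) \<tau> =
          of_int (p' * p) * kron_sum (- d) c x y (\<mu> * Y) (1 * Y) \<tau> +
          of_int (p * c) * kron_sum q' p' \<xi> \<eta> (t * Y) (\<mu> * Y) \<tau>"
        unfolding \<xi>_def \<eta>_def
      proof (rule kron_sum_fay[OF tau det p' q' nz y _ xy])
        show "of_int c *\<^sub>R x + of_int d *\<^sub>R y \<notin> Z2"
          using y' by (simp add: \<eta>_def)
        show "of_int c * (t * Y) + of_int p' * (1 * Y) = of_int p * (\<mu> * Y)"
          using arg_cong[OF \<mu>(2), of "\<lambda>z. z * Y"] by (simp add: algebra_simps)
      qed (use elim(1-3) in \<open>simp_all add: mult_ac\<close>)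
      have "(of_int (p' * c) * \<mu>) * f1 Y = (t * \<mu> * Y * Y) * (of_int (p' * c) * kron_sum q p x y (t * Y) (1 * Y) \<tau>)"
        unfolding elim(4) by simp
      also have "\<dots> = (of_int (p' * p) * t) * f2 Y + of_int (p * c) * f3 Y"
        unfolding * elim(5,6) by (simp add: algebra_simps)
      finally show ?case .
    qed
  qed
  hence "fps_nth (fps_const (of_int (p' * c) * \<mu>) * Abs_fps S1) N =
      fps_nth (fps_const (of_int (p' * p) * t) * Abs_fps S2 + fps_const (of_int (p * c)) * Abs_fps S3) N"
    by (rule arg_cong)
  thus ?thesis
    by (simp add: S1_def S2_def S3_def)
qed

text \<open>The coefficient of index 0 is 1, so only the second factor remains, at the points
  (\<zeta> + q i) / p. Since q is prime to p, i may replace q i, and the distribution relation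
  applies. This is the source of the Bernoulli term in the theorem.\<close>

lemma kron_coeff_sum_0_left:
  assumes p: "p \<noteq> 0" and qp: "coprime q p" and y: "y \<notin> Z2" and xy: "of_int q *\<^sub>R y - of_int p *\<^sub>R x \<notin> Z2"
  shows "of_int p ^ N * kron_coeff_sum 0 N q p x y \<tau> = of_int p ^ 2 * kron_coeff N (of_int q *\<^sub>R y - of_int p *\<^sub>R x) \<tau>"
proof -
  define \<zeta> where "\<zeta> = of_int q *\<^sub>R y - of_int p *\<^sub>R x"
  have \<zeta>: "\<zeta> \<notin> Z2"
    using xy by (simp add: \<zeta>_def)
  define h where "h i = kron_coeff N ((\<zeta> + ivec i) /\<^sub>R of_int p) \<tau>" for i
  have notin: "(\<zeta> + ivec i) /\<^sub>R of_int p \<notin> Z2" for i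
    by (rule scaleR_notin_Z2[of p]) (use \<zeta> p in simp)
  have "kron_coeff_sum 0 N q p x y \<tau> = (\<Sum>i\<in>res p. h (iscale q i))"
  proof -
    have "of_int q *\<^sub>R ((y + ivec i) /\<^sub>R of_int p) - x = (\<zeta> + ivec (iscale q i)) /\<^sub>R of_int p" for i
      using p by (simp add: vec_eq_iff \<zeta>_def ivec_iscale field_simps)
    thus ?thesis
      using kron_coeff_0[OF tau kron_sum_args_notin_Z2(1)[OF p y xy]] by (simp add: kron_coeff_sum_def h_def)
  qed
  also have "\<dots> = (\<Sum>i\<in>res p. h i)"
  proof (rule sum_res_coprime[OF p qp])
    fix i k
    have "(\<zeta> + ivec (i + iscale p k)) /\<^sub>R of_int p = (\<zeta> + ivec i) /\<^sub>R of_int p + ivec k"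
      using p by (simp add: vec_eq_iff ivec_add ivec_iscale field_simps)
    thus "h (i + iscale p k) = h i"
      using kron_coeff_periodic[OF tau notin] by (simp add: h_def)
  qed
  finally show ?thesis
    using kron_coeff_distribution[OF tau \<zeta> p, of N] by (simp add: h_def \<zeta>_def)
qed

text \<open>The identity between the generating functions is homogeneous; in terms of the ratio \<open>t\<close> of the
  first two variables it is polynomial in each degree, and the terms with a first index 1 are
  isolated by differentiating at \<open>t = 0\<close>.\<close>
lemma kron_coeff_sum_reciprocity:
  fixes a b c d p q p' q' :: int and x y :: "real ^ 2"
  defines "\<xi> \<equiv> of_int a *\<^sub>R x + of_int b *\<^sub>R y" and "\<eta> \<equiv> of_int c *\<^sub>R x + of_int d *\<^sub>R y"
    and "j \<equiv> of_int p' / of_int p :: complex"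
  assumes det: "a * d - b * c = 1" and p': "p' = c * q + d * p" and q': "q' = a * q + b * p"
    and nz: "c \<noteq> 0" "p \<noteq> 0" "p' \<noteq> 0"
    and y: "y \<notin> Z2" and y': "\<eta> \<notin> Z2" and xy: "of_int q *\<^sub>R y - of_int p *\<^sub>R x \<notin> Z2"
    and l: "l > 0"
  shows "kron_coeff_sum 1 l q p x y \<tau> / of_int p - j ^ (l - 1) * kron_coeff_sum 1 l q' p' \<xi> \<eta> \<tau> / of_int p' =
    1 / of_int c * (\<Sum>m\<le>l + 1. j powi (int m - 1) * kron_coeff_sum m (l + 1 - m) (- d) c x y \<tau>)
    + of_nat l * of_int c / (of_int p * of_int p') * kron_coeff_sum 0 (l + 1) q p x y \<tau>"
proof -
  define N where "N = l + 1"
  define A where "A m = kron_coeff_sum m (N - m) q p x y \<tau>" for m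
  define B where "B m = kron_coeff_sum m (N - m) (- d) c x y \<tau>" for m
  define C where "C m = kron_coeff_sum m (N - m) q' p' \<xi> \<eta> \<tau>" for m
  define P P' K :: complex where "P = of_int p" and "P' = of_int p'" and "K = of_int c"
  have nz': "P \<noteq> 0" "P' \<noteq> 0" "K \<noteq> 0"
    using nz by (simp_all add: P_def P'_def K_def)
  have j: "j = P' / P" "j \<noteq> 0"
    using nz' by (simp_all add: j_def P_def P'_def)
  \<comment> \<open>The ratio X3 / X2 when X1 / X2 = t; its value at t = 0 is j(V;r).\<close>
  define \<mu> where "\<mu> t = (K * t + P') / P" for t
  have \<mu>0: "\<mu> 0 = j"
    by (simp add: \<mu>_def j)
  define f where "f t = P' * K * \<mu> t * (\<Sum>m\<le>N. t ^ m * A m)" for t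
  define g where "g t = P' * P * t * (\<Sum>m\<le>N. \<mu> t ^ m * B m) + P * K * (\<Sum>m\<le>N. t ^ m * \<mu> t ^ (N - m) * C m)" for t
  have D\<mu>: "(\<mu> has_field_derivative K / P) (at 0)"
    unfolding \<mu>_def by (auto intro!: derivative_eq_intros simp: nz')
  have Dpow: "((\<lambda>t. t ^ m) has_field_derivative (if m = 1 then 1 else 0)) (at (0 :: complex))" for m
    by (rule derivative_eq_intros refl)+ (simp add: power_0_left)
  have D\<mu>pow: "((\<lambda>t. \<mu> t ^ m) has_field_derivative of_nat m * (K / P * j ^ (m - 1))) (at 0)" for m
    by (rule derivative_eq_intros D\<mu> refl)+ (simp add: \<mu>0)
  have sum1: "(\<Sum>m\<le>N. (if m = 1 then 1 else 0) * h m) = h 1" and sum0: "(\<Sum>m\<le>N. 0 ^ m * h m) = h 0" for h :: "nat \<Rightarrow> complex"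
  proof -
    have "(\<Sum>m\<le>N. (if m = 1 then 1 else 0) * h m) = (\<Sum>m\<le>N. if m = 1 then h 1 else 0)"
      by (intro sum.cong) auto
    thus "(\<Sum>m\<le>N. (if m = 1 then 1 else 0) * h m) = h 1"
      by (simp add: N_def)
    have "(\<Sum>m\<le>N. 0 ^ m * h m) = (\<Sum>m\<le>N. if m = 0 then h 0 else 0)"
      by (intro sum.cong) auto
    thus "(\<Sum>m\<le>N. 0 ^ m * h m) = h 0"
      by simp
  qed
  have Df: "(f has_field_derivative P' * K * (K / P * A 0 + j * A 1)) (at 0)"
  proof -
    have "((\<lambda>t. \<Sum>m\<le>N. t ^ m * A m) has_field_derivative (\<Sum>m\<le>N. (if m = 1 then 1 else 0) * A m)) (at 0)"
      by (intro DERIV_sum DERIV_cmult_right Dpow)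
    hence DA: "((\<lambda>t. \<Sum>m\<le>N. t ^ m * A m) has_field_derivative A 1) (at 0)"
      by (simp only: sum1)
    have "((\<lambda>t. P' * K * (\<mu> t * (\<Sum>m\<le>N. t ^ m * A m))) has_field_derivative
        P' * K * (K / P * (\<Sum>m\<le>N. 0 ^ m * A m) + A 1 * \<mu> 0)) (at 0)"
      by (intro DERIV_cmult DERIV_mult D\<mu> DA)
    moreover have "f = (\<lambda>t. P' * K * (\<mu> t * (\<Sum>m\<le>N. t ^ m * A m)))"
      by (simp add: f_def fun_eq_iff mult.assoc)
    ultimately show ?thesis
      by (simp only: sum0 \<mu>0 mult.commute[of "A 1"])
  qed
  have Dg: "(g has_field_derivative P' * P * (\<Sum>m\<le>N. j ^ m * B m) +
      P * K * (j ^ l * C 1 + of_nat N * (K / P) * j ^ l * C 0)) (at 0)"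
  proof -
    have DB: "((\<lambda>t. \<Sum>m\<le>N. \<mu> t ^ m * B m) has_field_derivative (\<Sum>m\<le>N. of_nat m * (K / P * j ^ (m - 1)) * B m)) (at 0)"
      by (intro DERIV_sum DERIV_cmult_right D\<mu>pow)
    have "((\<lambda>t. P' * P * (t * (\<Sum>m\<le>N. \<mu> t ^ m * B m))) has_field_derivative
        P' * P * (1 * (\<Sum>m\<le>N. \<mu> 0 ^ m * B m) + (\<Sum>m\<le>N. of_nat m * (K / P * j ^ (m - 1)) * B m) * 0)) (at 0)"
      by (intro DERIV_cmult DERIV_mult DERIV_ident DB)
    hence D1: "((\<lambda>t. P' * P * t * (\<Sum>m\<le>N. \<mu> t ^ m * B m)) has_field_derivative P' * P * (\<Sum>m\<le>N. j ^ m * B m)) (at 0)"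
      by (simp add: \<mu>0 mult_ac)
    have "((\<lambda>t. \<Sum>m\<le>N. t ^ m * \<mu> t ^ (N - m) * C m) has_field_derivative
      (\<Sum>m\<le>N. ((if m = 1 then 1 else 0) * \<mu> 0 ^ (N - m) + of_nat (N - m) * (K / P * j ^ (N - m - 1)) * 0 ^ m) * C m)) (at 0)"
      by (intro DERIV_sum DERIV_cmult_right DERIV_mult Dpow D\<mu>pow)
    also have "(\<Sum>m\<le>N. ((if m = 1 then 1 else 0) * \<mu> 0 ^ (N - m) + of_nat (N - m) * (K / P * j ^ (N - m - 1)) * 0 ^ m) * C m) =
       (\<Sum>m\<le>N. (if m = 1 then 1 else 0) * (j ^ (N - m) * C m)) + (\<Sum>m\<le>N. 0 ^ m * (of_nat (N - m) * (K / P * j ^ (N - m - 1)) * C m))"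
      unfolding sum.distrib [symmetric] \<mu>0 by (rule sum.cong) (simp_all only: distrib_right distrib_left mult_ac)
    also have "\<dots> = j ^ l * C 1 + of_nat N * (K / P) * j ^ l * C 0"
      unfolding sum1 sum0 by (simp add: N_def)
    finally have "((\<lambda>t. P * K * (\<Sum>m\<le>N. t ^ m * \<mu> t ^ (N - m) * C m)) has_field_derivative
      P * K * (j ^ l * C 1 + of_nat N * (K / P) * j ^ l * C 0)) (at 0)"
      by (rule DERIV_cmult)
    from DERIV_add[OF D1 this] show ?thesis
      by (simp only: g_def [abs_def])
  qed
  \<comment> \<open>The identity is available for nonzero t and \<mu> only; both hold in a punctured
    neighbourhood of 0, and continuity supplies the value at 0 as well.\<close>
  have "eventually (\<lambda>t. f t = g t) (at 0)"
  proof -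
    have "(\<mu> \<longlongrightarrow> j) (at 0)"
      using DERIV_isCont[OF D\<mu>] by (simp add: isCont_def \<mu>0)
    hence "eventually (\<lambda>t. \<mu> t \<noteq> 0) (at 0)"
      using j(2) by (rule tendsto_imp_eventually_ne)
    thus ?thesis
      using eventually_neq_at_within[of 0]
    proof eventually_elim
      case (elim t)
      have "of_int c * t + of_int p' = of_int p * \<mu> t"
        using nz' by (simp add: \<mu>_def P_def P'_def K_def)
      from kron_coeff_sum_fay[OF det p' q' nz y y'[unfolded \<eta>_def] xy elim(2,1) this, of N]
      show ?case
        by (simp add: f_def g_def A_def B_def C_def P_def P'_def K_def \<xi>_def \<eta>_def mult_ac)
    qed
  qed
  note eqs = derivatives_at_0_unique[OF Df Dg this]
  \<comment> \<open>Equality of the values at t = 0 ties the index-0 term \<open>C 0\<close> to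
    \<open>A 0\<close>, which eliminates \<open>C 0\<close> from the equation of the
    derivatives.\<close>
  have "P' * K * j * A 0 = P * K * (j ^ N * C 0)"
  proof -
    have "f 0 = P' * K * j * A 0"
      by (simp only: f_def \<mu>0 sum0)
    moreover have "g 0 = P * K * (\<Sum>m\<le>N. 0 ^ m * (j ^ (N - m) * C m))"
      by (simp add: g_def \<mu>0 mult_ac)
    hence "g 0 = P * K * (j ^ N * C 0)"
      by (simp only: sum0 diff_zero)
    ultimately show ?thesis
      using eqs(1) by argo
  qed
  hence C0: "j ^ l * C 0 = j * A 0"
    using nz' by (simp add: j N_def field_simps)
  \<comment> \<open>With that elimination \<open>A 0\<close> occurs once on the left, from
    differentiating the prefactor \<mu>, and N = l + 1 times on the right, from differentiating
    \<mu>^N. The difference is the factor l of the final formula.\<close>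
  have E: "P' * K * (K / P * A 0 + j * A 1) = P' * P * (\<Sum>m\<le>N. j ^ m * B m) +
      P * K * (j ^ l * C 1) + K * K * of_nat N * (j * A 0)"
    using eqs(2) nz' unfolding C0 [symmetric] by (simp add: algebra_simps)
  have P'j: "P' = P * j"
    using nz' by (simp add: j)
  have jl: "j ^ l = j * j ^ (l - 1)"
    using l by (cases l) auto
  have "A 1 / P - j ^ (l - 1) * C 1 / P' = 1 / K * ((\<Sum>m\<le>N. j ^ m * B m) / j) + of_nat l * K / (P * P') * A 0"
  proof -
    define S where "S = (\<Sum>m\<le>N. j ^ m * B m)"
    have "P * j * K * (K / P * A 0 + j * A 1) = P * j * P * S + P * K * (j * j ^ (l - 1) * C 1) + K * K * (of_nat l + 1) * (j * A 0)"
      using E by (simp add: S_def jl N_def flip: P'j)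
    hence "j * (P * K * j * A 1) = j * (P * P * S + P * K * (j ^ (l - 1) * C 1) + K * K * of_nat l * A 0)"
      using nz' by (simp add: algebra_simps)
    hence "P * K * j * A 1 = P * P * S + P * K * (j ^ (l - 1) * C 1) + K * K * of_nat l * A 0"
      using j(2) by simp
    moreover define u where "u = j ^ (l - 1)"
    moreover have "A 1 / P - u * C 1 / (P * j) - (1 / K * (S / j) + of_nat l * K / (P * (P * j)) * A 0) =
        (P * K * j * A 1 - (P * P * S + P * K * (u * C 1) + K * K * of_nat l * A 0)) / (P * P * K * j)"
      using nz' j(2) by (simp add: field_simps)
    ultimately show ?thesis
      unfolding S_def [symmetric] P'j u_def by simp
  qed
  moreover have "(\<Sum>m\<le>N. j ^ m * B m) / j = (\<Sum>m\<le>N. j powi (int m - 1) * B m)"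
    using j(2) by (simp add: sum_divide_distrib power_int_diff)
  ultimately show ?thesis
    by (simp only: A_def B_def C_def N_def P_def P'_def K_def add_diff_cancel_right' diff_zero)
qed

end

subsection \<open>Elliptic Dedekind sums\<close>

lemma rnum_rden_of_quotient:
  assumes "p > 0" "coprime q p"
  shows "rnum (of_int q / of_int p) = q" "rden (of_int q / of_int p) = p"
proof -
  have "quotient_of (of_int q / of_int p) = (q, p)"
    using assms by (simp add: quotient_of_Fract flip: Fract_of_int_quotient)
  thus "rnum (of_int q / of_int p) = q" "rden (of_int q / of_int p) = p"
    by (simp_all add: rnum_def rden_def)
qed

lemma rden_pos: "rden r > 0"
  by (simp add: rden_def quotient_of_denom_pos')

lemma coprime_rnum_rden: "coprime (rnum r) (rden r)"
  unfolding rnum_def rden_def by (rule quotient_of_coprime) simp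

lemma rat_eq_rnum_rden: "r = of_int (rnum r) / of_int (rden r)"
  unfolding rnum_def rden_def by (rule quotient_of_div) simp

lemma ellB_eq_kron_coeff:
  "v \<notin> Z2 \<Longrightarrow> ellB m v \<tau> = fact m / (2 * of_real pi * \<i>) ^ m * kron_coeff m v \<tau>"
  by (simp add: ellB_def ellB0_def kron_coeff_def)

text \<open>The hypotheses keep every argument of \<open>ellB\<close> off the lattice, so neither
  its limit nor its undefined branch is ever reached.\<close>

lemma SS_eq_kron_coeff_sum:
  assumes "M $ 2 \<notin> Z2" "of_int (rnum r) *\<^sub>R M $ 2 - of_int (rden r) *\<^sub>R M $ 1 \<notin> Z2"
  shows "SS m n r M \<tau> = fact m * fact n / (2 * of_real pi * \<i>) ^ (m + n) *
    kron_coeff_sum m n (rnum r) (rden r) (M $ 1) (M $ 2) \<tau> / of_int (rden r)"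
proof -
  define u v where "u i = (M $ 2 + ivec i) /\<^sub>R of_int (rden r)" and "v i = of_int (rnum r) *\<^sub>R u i - M $ 1" for i
  have uv: "u i \<notin> Z2" "v i \<notin> Z2" for i
    using kron_sum_args_notin_Z2[OF _ assms] rden_pos[of r] by (simp_all add: u_def v_def)
  have "vector [of_int (fst i), of_int (snd i)] = ivec i" for i
    by (simp add: ivec_def)
  hence "SS m n r M \<tau> = 1 / of_int (rden r) * (\<Sum>i\<in>res (rden r). ellB m (u i) \<tau> * ellB n (v i) \<tau>)"
    using rden_pos[of r] by (simp add: SS_def res_def Let_def u_def v_def case_prod_beta add.commute)
  also have "(\<Sum>i\<in>res (rden r). ellB m (u i) \<tau> * ellB n (v i) \<tau>) =
      fact m * fact n / (2 * of_real pi * \<i>) ^ (m + n) * (\<Sum>i\<in>res (rden r). kron_coeff m (u i) \<tau> * kron_coeff n (v i) \<tau>)"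
    unfolding sum_distrib_left by (rule sum.cong) (simp_all add: ellB_eq_kron_coeff uv power_add)
  finally show ?thesis
    by (simp add: kron_coeff_sum_def u_def v_def)
qed

context
  fixes \<tau> :: complex
  assumes tau: "Im \<tau> > 0"
begin

text \<open>Both factors have parity, and i -> - i permutes the residues modulo p.\<close>

lemma kron_coeff_sum_uminus:
  assumes p: "p \<noteq> 0" and y: "y \<notin> Z2" and xy: "of_int q *\<^sub>R y - of_int p *\<^sub>R x \<notin> Z2"
  shows "kron_coeff_sum m n q p (- x) (- y) \<tau> = (- 1) ^ (m + n) * kron_coeff_sum m n q p x y \<tau>"
proof -
  define u v where "u i = (y + ivec i) /\<^sub>R of_int p" and "v i = of_int q *\<^sub>R u i - x" for i
  have uv: "u i \<notin> Z2" "v i \<notin> Z2" for i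
    using kron_sum_args_notin_Z2[OF p y xy] by (simp_all add: u_def v_def)
  define h where "h i = kron_coeff m (- u i) \<tau> * kron_coeff n (- v i) \<tau>" for i
  have h: "h i = (- 1) ^ (m + n) * (kron_coeff m (u i) \<tau> * kron_coeff n (v i) \<tau>)" for i
    by (simp add: h_def kron_coeff_uminus[OF tau] uv power_add mult_ac)
  have "(- y + ivec i) /\<^sub>R of_int p = - u (iscale (- 1) i)"
    "of_int q *\<^sub>R ((- y + ivec i) /\<^sub>R of_int p) - (- x) = - v (iscale (- 1) i)" for i
    by (simp_all add: u_def v_def vec_eq_iff ivec_iscale algebra_simps)
  hence "kron_coeff_sum m n q p (- x) (- y) \<tau> = (\<Sum>i\<in>res p. h (iscale (- 1) i))"
    by (simp add: kron_coeff_sum_def h_def)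
  also have "\<dots> = (\<Sum>i\<in>res p. h i)"
  proof (rule sum_res_coprime[OF p])
    fix i k
    have "u (i + iscale p k) = u i + ivec k" "v (i + iscale p k) = v i + ivec (iscale q k)"
      using p by (simp_all add: u_def v_def vec_eq_iff ivec_add ivec_iscale field_simps)
    thus "h (i + iscale p k) = h i"
      using kron_coeff_periodic[OF tau] uv by (simp add: h)
  qed simp
  finally show ?thesis
    by (simp add: h kron_coeff_sum_def u_def v_def sum_distrib_left)
qed

text \<open>The Fay summation produces the data (- d, c, x), whereas \<open>RR\<close> is defined
  with (d, c, - x) if c > 0 and with (- d, - c, - x) if c < 0. The two parts translate between them,
  one for each sign of c.\<close>

lemma kron_coeff_sum_reflect:
  assumes p: "p \<noteq> 0" and y: "y \<notin> Z2" and xy: "of_int q *\<^sub>R y - of_int p *\<^sub>R x \<notin> Z2"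
  shows "kron_coeff_sum m n (- q) p (- x) y \<tau> = (- 1) ^ n * kron_coeff_sum m n q p x y \<tau>"
    and "kron_coeff_sum m n q (- p) (- x) y \<tau> = (- 1) ^ (m + n) * kron_coeff_sum m n q p x y \<tau>"
proof -
  define u v where "u i = (y + ivec i) /\<^sub>R of_int p" and "v i = of_int q *\<^sub>R u i - x" for i
  have uv: "u i \<notin> Z2" "v i \<notin> Z2" for i
    using kron_sum_args_notin_Z2[OF p y xy] by (simp_all add: u_def v_def)
  have "of_int (- q) *\<^sub>R ((y + ivec i) /\<^sub>R of_int p) - (- x) = - v i" for i
    by (simp add: u_def v_def)
  hence "kron_coeff_sum m n (- q) p (- x) y \<tau> = (\<Sum>i\<in>res p. kron_coeff m (u i) \<tau> * kron_coeff n (- v i) \<tau>)"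
    unfolding kron_coeff_sum_def u_def [symmetric] by (simp only:)
  also have "\<dots> = (\<Sum>i\<in>res p. (- 1) ^ n * (kron_coeff m (u i) \<tau> * kron_coeff n (v i) \<tau>))"
    by (rule sum.cong) (simp_all add: kron_coeff_uminus[OF tau] uv)
  finally show "kron_coeff_sum m n (- q) p (- x) y \<tau> = (- 1) ^ n * kron_coeff_sum m n q p x y \<tau>"
    by (simp add: kron_coeff_sum_def sum_distrib_left u_def v_def)
  have "(y + ivec i) /\<^sub>R of_int (- p) = - u i"
    "of_int q *\<^sub>R ((y + ivec i) /\<^sub>R of_int (- p)) - (- x) = - v i" for i
    by (simp_all add: u_def v_def)
  moreover have "res (- p) = res p"
    by (simp add: res_def)
  ultimately have "kron_coeff_sum m n q (- p) (- x) y \<tau> = (\<Sum>i\<in>res p. kron_coeff m (- u i) \<tau> * kron_coeff n (- v i) \<tau>)"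
    unfolding kron_coeff_sum_def by (simp only:)
  also have "\<dots> = (\<Sum>i\<in>res p. (- 1) ^ (m + n) * (kron_coeff m (u i) \<tau> * kron_coeff n (v i) \<tau>))"
    by (rule sum.cong) (simp_all add: kron_coeff_uminus[OF tau] uv power_add)
  finally show "kron_coeff_sum m n q (- p) (- x) y \<tau> = (- 1) ^ (m + n) * kron_coeff_sum m n q p x y \<tau>"
    by (simp add: kron_coeff_sum_def sum_distrib_left u_def v_def)
qed

text \<open>The binomial coefficient times m! (l + 1 - m)! is (l + 1)!, so the prefactor of
  \<open>RR_pos\<close> and the normalisation of the sums cancel completely. The index is m = k +
  1.\<close>

lemma RR_pos_eq_kron_coeff_sum:
  assumes c: "V $ 2 $ 1 > 0" and cd: "coprime (V $ 2 $ 2) (V $ 2 $ 1)" and y: "M $ 2 \<notin> Z2"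
    and y': "of_int (V $ 2 $ 1) *\<^sub>R M $ 1 + of_int (V $ 2 $ 2) *\<^sub>R M $ 2 \<notin> Z2"
  shows "RR_pos V l z M \<tau> = 1 / of_int (V $ 2 $ 1) *
    (\<Sum>m\<le>l + 1. (- jfac V z) powi (int m - 1) *
      kron_coeff_sum m (l + 1 - m) (V $ 2 $ 2) (V $ 2 $ 1) (- (M $ 1)) (M $ 2) \<tau>)"
proof -
  define c d where "c = V $ 2 $ 1" and "d = V $ 2 $ 2"
  define x y where "x = M $ 1" and "y = M $ 2"
  define W :: complex where "W = 2 * of_real pi * \<i>"
  have W: "W \<noteq> 0"
    by (simp add: W_def)
  have SS: "SS m n (of_int d / of_int c) (vector [- x, y]) \<tau> =
    fact m * fact n / W ^ (m + n) * kron_coeff_sum m n d c (- x) y \<tau> / of_int c" for m n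
    using SS_eq_kron_coeff_sum[of "vector [- x, y] :: real ^ 2 ^ 2" "of_int d / of_int c" m n \<tau>]
      rnum_rden_of_quotient[of c d] assms
    by (simp add: c_def d_def x_def y_def W_def add.commute)
  have "RR_pos V l z M \<tau> = W ^ (l + 1) / fact (l + 1) *
      (\<Sum>k\<in>{-1..int l}. of_nat ((l + 1) choose nat (k + 1)) * (- jfac V z) powi k *
        SS (nat (k + 1)) (nat (int l - k)) (of_int d / of_int c) (vector [- x, y]) \<tau>)"
    by (simp only: RR_pos_def c_def d_def x_def y_def W_def)
  also have "(\<Sum>k\<in>{-1..int l}. of_nat ((l + 1) choose nat (k + 1)) * (- jfac V z) powi k *
        SS (nat (k + 1)) (nat (int l - k)) (of_int d / of_int c) (vector [- x, y]) \<tau>) =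
     (\<Sum>m\<le>l + 1. of_nat ((l + 1) choose m) * (- jfac V z) powi (int m - 1) *
        SS m (l + 1 - m) (of_int d / of_int c) (vector [- x, y]) \<tau>)"
    by (rule sum.reindex_bij_witness[of _ "\<lambda>m. int m - 1" "\<lambda>k. nat (k + 1)"])
       (auto simp: nat_diff_distrib nat_add_distrib Suc_diff_le intro!: arg_cong2[of _ _ _ _ "\<lambda>m n. SS m n _ _ _"])
  also have "W ^ (l + 1) / fact (l + 1) * \<dots> = (\<Sum>m\<le>l + 1. 1 / of_int c * ((- jfac V z) powi (int m - 1) *
      kron_coeff_sum m (l + 1 - m) d c (- x) y \<tau>))"
    unfolding sum_distrib_left
  proof (rule sum.cong[OF refl])
    fix m assume "m \<in> {..l + 1}"
    hence m: "m \<le> l + 1"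
      by simp
    have "fact m * fact (l + 1 - m) * of_nat ((l + 1) choose m) = (fact (l + 1) :: complex)"
      using binomial_fact_lemma[OF m] by (metis of_nat_fact of_nat_mult)
    moreover have "m + (l + 1 - m) = l + 1"
      using m by simp
    ultimately have *: "of_nat ((l + 1) choose m) * (fact m * fact (l + 1 - m) / W ^ (m + (l + 1 - m))) = fact (l + 1) / W ^ (l + 1)"
      by (simp only: times_divide_eq_right mult_ac)
    have "W ^ (l + 1) / fact (l + 1) * (of_nat ((l + 1) choose m) * (- jfac V z) powi (int m - 1) *
        SS m (l + 1 - m) (of_int d / of_int c) (vector [- x, y]) \<tau>) =
       W ^ (l + 1) / fact (l + 1) * (of_nat ((l + 1) choose m) * (fact m * fact (l + 1 - m) / W ^ (m + (l + 1 - m)))) *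
       (1 / of_int c * ((- jfac V z) powi (int m - 1) * kron_coeff_sum m (l + 1 - m) d c (- x) y \<tau>))"
    proof -
      have "A * (B * J * (E * T / of_int c)) = A * (B * E) * (1 / of_int c * (J * T))" for A B E J T :: complex
        by simp
      thus ?thesis
        unfolding SS .
    qed
    also have "W ^ (l + 1) / fact (l + 1) * (of_nat ((l + 1) choose m) * (fact m * fact (l + 1 - m) / W ^ (m + (l + 1 - m)))) = 1"
    proof -
      have "X / F * (F / X) = 1" if "X \<noteq> 0" "F \<noteq> 0" for X F :: complex
        using that by simp
      thus ?thesis
        unfolding * using W fact_nonzero by (metis power_not_zero)
    qed
    finally show "W ^ (l + 1) / fact (l + 1) * (of_nat ((l + 1) choose m) * (- jfac V z) powi (int m - 1) *
        SS m (l + 1 - m) (of_int d / of_int c) (vector [- x, y]) \<tau>) =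
       1 / of_int c * ((- jfac V z) powi (int m - 1) * kron_coeff_sum m (l + 1 - m) d c (- x) y \<tau>)"
      by simp
  qed
  finally show ?thesis
    by (simp only: c_def d_def x_def y_def sum_distrib_left)
qed

text \<open>The sign of (- j)^(m - 1) and the reflection sign (- 1)^(l + 1 - m) multiply to (- 1)^l,
  independently of m. For c < 0 the signs are (- 1)^(l + 1) and - c instead, so one formula covers
  both cases.\<close>

lemma RR_eq_kron_coeff_sum:
  assumes V: "V = vector [vector [a, b], vector [c, d]]" and c: "c \<noteq> 0" and cd: "coprime d c"
    and y: "M $ 2 \<notin> Z2" and y': "of_int c *\<^sub>R M $ 1 + of_int d *\<^sub>R M $ 2 \<notin> Z2"
    and z: "jfac V z \<noteq> 0"
  shows "RR V l z M \<tau> = (- 1) ^ l / of_int c *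
    (\<Sum>m\<le>l + 1. jfac V z powi (int m - 1) * kron_coeff_sum m (l + 1 - m) (- d) c (M $ 1) (M $ 2) \<tau>)"
proof -
  have V_nth: "V $ 2 $ 1 = c" "V $ 2 $ 2 = d"
    by (simp_all add: V)
  have xy: "of_int (- d) *\<^sub>R M $ 2 - of_int c *\<^sub>R M $ 1 \<notin> Z2"
  proof -
    have "of_int (- d) *\<^sub>R M $ 2 - of_int c *\<^sub>R M $ 1 = - (of_int c *\<^sub>R M $ 1 + of_int d *\<^sub>R M $ 2)"
      by simp
    thus ?thesis
      using y' by (simp only: Z2_uminus_iff not_False_eq_True)
  qed
  have sign: "(- jfac V z) powi (int m - 1) * ((- 1) ^ (l + 1 - m) * K) = (- 1) ^ l * (jfac V z powi (int m - 1) * K)"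
    if "m \<le> l + 1" for m K
  proof -
    have e1: "(- jfac V z) powi (int m - 1) = (- 1) ^ m * (- 1) * jfac V z powi (int m - 1)"
      using z by (simp add: power_int_diff field_simps power_minus[of "jfac V z"])
    have e2: "(- 1) ^ m * (- 1) * (- 1) ^ (l + 1 - m) = ((- 1) ^ l :: complex)"
    proof -
      have "(- 1) ^ m * (- 1) ^ (l + 1 - m) = ((- 1) ^ (l + 1) :: complex)"
        using that by (simp flip: power_add)
      thus ?thesis
        by simp
    qed
    have "(- jfac V z) powi (int m - 1) * ((- 1) ^ (l + 1 - m) * K) =
        ((- 1) ^ m * (- 1) * (- 1) ^ (l + 1 - m)) * (jfac V z powi (int m - 1) * K)"
      unfolding e1 by (simp only: mult_ac)
    thus ?thesis
      unfolding e2 .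
  qed
  show ?thesis
  proof (cases "c > 0")
    case True
    have "RR V l z M \<tau> = RR_pos V l z M \<tau>"
      using True by (simp add: RR_def V_nth)
    also have "\<dots> = 1 / of_int c * (\<Sum>m\<le>l + 1. (- jfac V z) powi (int m - 1) *
        kron_coeff_sum m (l + 1 - m) d c (- (M $ 1)) (M $ 2) \<tau>)"
      using RR_pos_eq_kron_coeff_sum[of V M l z] True cd y y' by (simp add: V_nth)
    also have "(\<Sum>m\<le>l + 1. (- jfac V z) powi (int m - 1) * kron_coeff_sum m (l + 1 - m) d c (- (M $ 1)) (M $ 2) \<tau>) =
      (\<Sum>m\<le>l + 1. (- 1) ^ l * (jfac V z powi (int m - 1) * kron_coeff_sum m (l + 1 - m) (- d) c (M $ 1) (M $ 2) \<tau>))"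
    proof (rule sum.cong[OF refl])
      fix m assume "m \<in> {..l + 1}"
      hence m: "m \<le> l + 1"
        by simp
      have "kron_coeff_sum m (l + 1 - m) d c (- (M $ 1)) (M $ 2) \<tau> =
          (- 1) ^ (l + 1 - m) * kron_coeff_sum m (l + 1 - m) (- d) c (M $ 1) (M $ 2) \<tau>"
        using kron_coeff_sum_reflect(1)[OF c y xy] by simp
      thus "(- jfac V z) powi (int m - 1) * kron_coeff_sum m (l + 1 - m) d c (- (M $ 1)) (M $ 2) \<tau> =
         (- 1) ^ l * (jfac V z powi (int m - 1) * kron_coeff_sum m (l + 1 - m) (- d) c (M $ 1) (M $ 2) \<tau>)"
        by (simp only: sign[OF m])
    qed
    finally show ?thesis
      by (simp only: sum_distrib_left [symmetric]) simp
  next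
    case False
    have jfac: "jfac (- V) z = - jfac V z"
      by (simp add: jfac_def)
    have "RR V l z M \<tau> = RR_pos (- V) l z M \<tau>"
      using False c by (simp add: RR_def V_nth)
    also have "\<dots> = 1 / of_int (- c) * (\<Sum>m\<le>l + 1. jfac V z powi (int m - 1) *
        kron_coeff_sum m (l + 1 - m) (- d) (- c) (- (M $ 1)) (M $ 2) \<tau>)"
    proof -
      have "of_int (- c) *\<^sub>R M $ 1 + of_int (- d) *\<^sub>R M $ 2 = - (of_int c *\<^sub>R M $ 1 + of_int d *\<^sub>R M $ 2)"
        by simp
      hence "of_int (- c) *\<^sub>R M $ 1 + of_int (- d) *\<^sub>R M $ 2 \<notin> Z2"
        using y' by (simp only: Z2_uminus_iff not_False_eq_True)
      thus ?thesis
        using RR_pos_eq_kron_coeff_sum[of "- V" M l z] False c cd y by (simp add: V_nth jfac)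
    qed
    also have "(\<Sum>m\<le>l + 1. jfac V z powi (int m - 1) * kron_coeff_sum m (l + 1 - m) (- d) (- c) (- (M $ 1)) (M $ 2) \<tau>) =
      (\<Sum>m\<le>l + 1. (- 1) ^ (l + 1) * (jfac V z powi (int m - 1) * kron_coeff_sum m (l + 1 - m) (- d) c (M $ 1) (M $ 2) \<tau>))"
      using kron_coeff_sum_reflect(2)[OF c y xy] by (intro sum.cong) auto
    finally show ?thesis
      by (simp only: sum_distrib_left [symmetric]) simp
  qed
qed

end

section \<open>The action of V and the reduction to positive j(V;r)\<close>

lemma lmul_vector:
  "lmul (vector [vector [a, b], vector [c, d]]) (vector [x, y]) =
     vector [of_int a *\<^sub>R x + of_int b *\<^sub>R y, of_int c *\<^sub>R x + of_int d *\<^sub>R y]"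
  by (simp add: vec_eq_iff forall_2 lmul_def matrix_matrix_mult_def map_matrix_def sum_2)

lemma lmul_uminus: "lmul (- V) M = - lmul V M"
  by (simp add: vec_eq_iff lmul_def matrix_matrix_mult_def map_matrix_def sum_negf)

lemma jfac_moebius_act_quotient:
  fixes q p q' p' :: int
  assumes V: "V = vector [vector [a, b], vector [c, d]]" and p: "p \<noteq> 0"
    and p': "p' = c * q + d * p" and q': "q' = a * q + b * p"
  shows "jfac V (of_int q / of_int p :: rat) = of_int p' / of_int p"
    and "moebius_act V (of_int q / of_int p :: rat) = of_int q' / of_int p'"
proof -
  show j: "jfac V (of_int q / of_int p :: rat) = of_int p' / of_int p"
    using p by (simp add: jfac_def V p' field_simps)
  have "(of_int a * (of_int q / of_int p) + of_int b :: rat) = of_int q' / of_int p"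
    using p by (simp add: q' field_simps)
  thus "moebius_act V (of_int q / of_int p :: rat) = of_int q' / of_int p'"
    unfolding moebius_act_def j using p by (simp add: V)
qed

lemma coprime_unimodular:
  fixes a b c d q p :: int
  assumes "a * d - b * c = 1" "coprime q p"
  shows "coprime (a * q + b * p) (c * q + d * p)"
proof (rule coprimeI)
  fix e assume e: "e dvd a * q + b * p" "e dvd c * q + d * p"
  have "d * (a * q + b * p) - b * (c * q + d * p) = (a * d - b * c) * q"
    "a * (c * q + d * p) - c * (a * q + b * p) = (a * d - b * c) * p"
    by (simp_all add: algebra_simps)
  moreover have "e dvd d * (a * q + b * p) - b * (c * q + d * p)" "e dvd a * (c * q + d * p) - c * (a * q + b * p)"
    using e by (intro dvd_diff dvd_mult; simp)+
  ultimately have "e dvd q" "e dvd p"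
    using assms(1) by simp_all
  thus "is_unit e"
    using assms(2) coprime_common_divisor by blast
qed

context
  fixes \<tau> :: complex
  assumes tau: "Im \<tau> > 0"
begin

lemma SS_uminus:
  assumes y: "M $ 2 \<notin> Z2" and xy: "of_int (rnum r) *\<^sub>R M $ 2 - of_int (rden r) *\<^sub>R M $ 1 \<notin> Z2"
  shows "SS m n r (- M) \<tau> = (- 1) ^ (m + n) * SS m n r M \<tau>"
proof -
  have "of_int (rnum r) *\<^sub>R (- M) $ 2 - of_int (rden r) *\<^sub>R (- M) $ 1 = - (of_int (rnum r) *\<^sub>R M $ 2 - of_int (rden r) *\<^sub>R M $ 1)"
    by simp
  hence "of_int (rnum r) *\<^sub>R (- M) $ 2 - of_int (rden r) *\<^sub>R (- M) $ 1 \<notin> Z2"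
    using xy by (simp only: Z2_uminus_iff not_False_eq_True)
  moreover have "(- M) $ 2 \<notin> Z2"
    using y by simp
  ultimately show ?thesis
    using kron_coeff_sum_uminus[OF tau _ y xy, of m n] rden_pos[of r]
    by (simp add: SS_eq_kron_coeff_sum y xy)
qed

text \<open>The substance of the case c = 0. With u = (y + i) / p, the second argument (q + b p) u -
  (x + b y) differs from q u - x by the integer vector b i, which periodicity absorbs.\<close>

lemma SS_shift:
  assumes y: "y \<notin> Z2" and xy: "of_int (rnum r) *\<^sub>R y - of_int (rden r) *\<^sub>R x \<notin> Z2"
  shows "SS m n (r + of_int b) (vector [x + of_int b *\<^sub>R y, y]) \<tau> = SS m n r (vector [x, y]) \<tau>"
proof -
  define p q where "p = rden r" and "q = rnum r"
  have p: "p > 0"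
    by (simp add: p_def rden_pos)
  have "r + of_int b = of_int (q + b * p) / of_int p"
    using rat_eq_rnum_rden[of r] p by (simp add: q_def [symmetric] p_def [symmetric] field_simps)
  moreover have "coprime (q + b * p) p"
    using coprime_unimodular[of 1 1 b 0, OF _ coprime_rnum_rden[of r]] by (simp add: q_def p_def)
  ultimately have r': "rnum (r + of_int b) = q + b * p" "rden (r + of_int b) = p"
    using rnum_rden_of_quotient[OF p] by (simp_all only:)
  have xy': "of_int (q + b * p) *\<^sub>R y - of_int p *\<^sub>R (x + of_int b *\<^sub>R y) \<notin> Z2"
    using xy by (simp add: q_def p_def algebra_simps)
  define u v where "u i = (y + ivec i) /\<^sub>R of_int p" and "v i = of_int q *\<^sub>R u i - x" for i
  have v: "v i \<notin> Z2" for i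
    using kron_sum_args_notin_Z2[OF _ y xy] p by (simp add: u_def v_def q_def p_def)
  have "of_int (q + b * p) *\<^sub>R u i - (x + of_int b *\<^sub>R y) = v i + ivec (iscale b i)" for i
    using p by (simp add: u_def v_def vec_eq_iff ivec_iscale field_simps)
  hence "kron_coeff_sum m n (q + b * p) p (x + of_int b *\<^sub>R y) y \<tau> = kron_coeff_sum m n q p x y \<tau>"
    using kron_coeff_periodic[OF tau v]
    by (simp only: kron_coeff_sum_def u_def [symmetric] v_def [symmetric])
  thus ?thesis
    using SS_eq_kron_coeff_sum[of "vector [x + of_int b *\<^sub>R y, y] :: real ^ 2 ^ 2" "r + of_int b" m n \<tau>]
      SS_eq_kron_coeff_sum[of "vector [x, y] :: real ^ 2 ^ 2" r m n \<tau>] y xy xy'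
    by (simp only: r' vector_2 q_def [symmetric] p_def [symmetric]) simp
qed

text \<open>Positivity of j(V;r) = p' / p means p' > 0, and q' is prime to p'; hence (q', p') is
  exactly the reduced numerator and denominator on which the sum attached to V r is built.\<close>

lemma SS_reciprocity_pos:
  fixes r :: rat and l :: nat and a b c d :: int and V :: "int ^ 2 ^ 2" and x y :: "real ^ 2" and M :: "real ^ 2 ^ 2"
  assumes l: "l > 0"
    and V: "V = vector [vector [a, b], vector [c, d]]" and det: "a * d - b * c = 1"
    and jpos: "jfac V r > 0" and M: "M = vector [x, y]"
    and y: "y \<notin> Z2" and y': "of_int c *\<^sub>R x + of_int d *\<^sub>R y \<notin> Z2"
    and xy: "of_int (rden r) *\<^sub>R x - of_int (rnum r) *\<^sub>R y \<notin> Z2"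
  shows "SS 1 l r M \<tau> - of_rat (jfac V r) ^ (l - 1) * SS 1 l (moebius_act V r) (lmul V M) \<tau> =
      (-1) ^ l * fact l / (2 * of_real pi * \<i>) ^ (l + 1) * RR V l (of_rat r) M \<tau>
      - (-1) ^ l * of_nat l / of_nat (l + 1) * (of_int c / of_rat (jfac V r)) *
        (ellB (l + 1) (of_int (rden r) *\<^sub>R x - of_int (rnum r) *\<^sub>R y) \<tau>
           / of_int (rden r) ^ (l + 1))"
proof -
  define p q where "p = rden r" and "q = rnum r"
  define p' q' where "p' = c * q + d * p" and "q' = a * q + b * p"
  define \<xi> \<eta> \<zeta> where "\<xi> = of_int a *\<^sub>R x + of_int b *\<^sub>R y" and "\<eta> = of_int c *\<^sub>R x + of_int d *\<^sub>R y"
    and "\<zeta> = of_int q *\<^sub>R y - of_int p *\<^sub>R x"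
  have p: "p > 0" and qp: "coprime q p"
    by (simp_all add: p_def q_def rden_pos coprime_rnum_rden)
  have r: "r = of_int q / of_int p"
    unfolding p_def q_def by (rule rat_eq_rnum_rden)
  have jfac: "jfac V r = of_int p' / of_int p"
    unfolding r by (rule jfac_moebius_act_quotient(1)[OF V _ p'_def q'_def]) (use p in simp)
  have p': "p' > 0"
  proof -
    have "(of_int p' :: rat) > 0"
      using jpos p unfolding jfac by (simp add: zero_less_divide_iff)
    thus ?thesis
      by simp
  qed
  have Vr: "moebius_act V r = of_int q' / of_int p'"
    unfolding r by (rule jfac_moebius_act_quotient(2)[OF V _ p'_def q'_def]) (use p in simp)
  have \<zeta>: "\<zeta> \<notin> Z2"
  proof -
    have "\<zeta> = - (of_int (rden r) *\<^sub>R x - of_int (rnum r) *\<^sub>R y)"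
      by (simp add: \<zeta>_def p_def q_def)
    thus ?thesis
      using xy by (simp only: Z2_uminus_iff not_False_eq_True)
  qed
  show ?thesis
  proof (cases "c = 0")
    case True
    \<comment> \<open>With c = 0 the determinant leaves a = d = 1 or a = d = - 1, and positivity of
      p' = d p excludes the latter.\<close>
    have "a * d = 1" "d * p > 0"
      using det p' by (simp_all add: True p'_def)
    hence ad: "a = 1" "d = 1"
      using p by (auto simp: zmult_eq_1_iff zero_less_mult_iff)
    have "jfac V r = 1" "moebius_act V r = r + of_int b" "lmul V M = vector [x + of_int b *\<^sub>R y, y]" "RR V l (of_rat r) M \<tau> = 0"
      by (simp_all add: V M True ad jfac_def moebius_act_def lmul_vector RR_def)
    thus ?thesis
      using SS_shift[OF y, of r x 1 l b] \<zeta> by (simp add: True M \<zeta>_def p_def q_def)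
  next
    case False
    define W j G :: complex where "W = 2 * of_real pi * \<i>" and "j = of_int p' / of_int p" and "G = fact l / W ^ (l + 1)"
    have j: "of_rat (jfac V r) = j"
      by (simp add: jfac j_def of_rat_divide)
    have j0: "j \<noteq> 0"
      using p p' by (simp add: j_def)
    have jz: "jfac V (of_rat r) = j"
      using p by (simp add: jfac_def V r j_def p'_def of_rat_divide field_simps)
    define S where "S = (\<Sum>m\<le>l + 1. j powi (int m - 1) * kron_coeff_sum m (l + 1 - m) (- d) c x y \<tau>)"
    have S1: "SS 1 l r M \<tau> = G * (kron_coeff_sum 1 l q p x y \<tau> / of_int p)"
      using SS_eq_kron_coeff_sum[of M r 1 l \<tau>] y \<zeta> by (simp add: M G_def W_def p_def q_def \<zeta>_def)
    have S2: "SS 1 l (moebius_act V r) (lmul V M) \<tau> = G * (kron_coeff_sum 1 l q' p' \<xi> \<eta> \<tau> / of_int p')"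
    proof -
      have r': "rnum (moebius_act V r) = q'" "rden (moebius_act V r) = p'"
        unfolding Vr using rnum_rden_of_quotient[OF p'] coprime_unimodular[OF det qp]
        by (simp_all only: p'_def [symmetric] q'_def [symmetric])
      have "of_int q' *\<^sub>R \<eta> - of_int p' *\<^sub>R \<xi> \<notin> Z2"
        using \<zeta> lattice_form_identity[OF det p'_def q'_def, of x y] by (simp only: \<xi>_def \<eta>_def \<zeta>_def not_False_eq_True)
      moreover have "lmul V M = vector [\<xi>, \<eta>]"
        by (simp add: V M lmul_vector \<xi>_def \<eta>_def)
      moreover have "\<eta> \<notin> Z2"
        using y' by (simp add: \<eta>_def)
      ultimately show ?thesis
        using SS_eq_kron_coeff_sum[of "lmul V M" "moebius_act V r" 1 l \<tau>]
        by (simp add: r' G_def W_def)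
    qed
    have "coprime d c"
    proof (rule coprimeI)
      fix e assume "e dvd d" "e dvd c"
      hence "e dvd a * d - b * c"
        by simp
      thus "is_unit e"
        by (simp add: det)
    qed
    hence RR: "RR V l (of_rat r) M \<tau> = (- 1) ^ l / of_int c * S"
      using RR_eq_kron_coeff_sum[OF tau V False, of M "of_rat r" l] y y' j0
      by (simp add: jz M S_def)
    \<comment> \<open>The argument in the theorem is - \<zeta>. Its parity (- 1)^(l + 1) turns the
      subtracted Bernoulli term into an added one, and (l + 1)! = (l + 1) l! cancels the denominator
      l + 1.\<close>
    have B: "ellB (l + 1) (of_int (rden r) *\<^sub>R x - of_int (rnum r) *\<^sub>R y) \<tau> =
        (of_nat l + 1) * G * ((- 1) ^ (l + 1) * kron_coeff (l + 1) \<zeta> \<tau>)"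
    proof -
      have "of_int (rden r) *\<^sub>R x - of_int (rnum r) *\<^sub>R y = - \<zeta>"
        by (simp add: \<zeta>_def p_def q_def)
      thus ?thesis
        using ellB_eq_kron_coeff[of "- \<zeta>" "l + 1" \<tau>] kron_coeff_uminus[OF tau \<zeta>, of "l + 1"] \<zeta>
        by (simp add: G_def W_def)
    qed
    define T k where "T = kron_coeff_sum 0 (l + 1) q p x y \<tau>" and "k = kron_coeff (l + 1) \<zeta> \<tau>"
    have T: "T = of_int p ^ 2 * k / of_int p ^ (l + 1)"
      using kron_coeff_sum_0_left[OF tau _ qp y \<zeta>[unfolded \<zeta>_def], of "l + 1"] p
      by (simp add: T_def k_def \<zeta>_def field_simps)
    have "SS 1 l r M \<tau> - j ^ (l - 1) * SS 1 l (moebius_act V r) (lmul V M) \<tau> =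
      G * (kron_coeff_sum 1 l q p x y \<tau> / of_int p - j ^ (l - 1) * kron_coeff_sum 1 l q' p' \<xi> \<eta> \<tau> / of_int p')"
      unfolding S1 S2 by (simp add: right_diff_distrib mult_ac)
    also have "\<dots> = G * (1 / of_int c * S + of_nat l * of_int c / (of_int p * of_int p') * T)"
      using kron_coeff_sum_reciprocity[OF tau det p'_def q'_def False _ _ y y' \<zeta>[unfolded \<zeta>_def] l] p p'
      by (simp add: \<xi>_def \<eta>_def j_def S_def T_def)
    also have "of_nat l * of_int c / (of_int p * of_int p') * T = of_nat l * (of_int c / j) * k / of_int p ^ (l + 1)"
      using p p' by (simp add: T j_def power2_eq_square)
    also have "G * (1 / of_int c * S + of_nat l * (of_int c / j) * k / of_int p ^ (l + 1)) =
      (-1) ^ l * fact l / W ^ (l + 1) * RR V l (of_rat r) M \<tau>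
      - (-1) ^ l * of_nat l / of_nat (l + 1) * (of_int c / j) *
        (ellB (l + 1) (of_int (rden r) *\<^sub>R x - of_int (rnum r) *\<^sub>R y) \<tau> / of_int p ^ (l + 1))"
    proof -
      define s :: complex where "s = (- 1) ^ l"
      define n :: complex where "n = of_nat l + 1"
      have ss: "s * s = 1"
        by (simp add: s_def flip: power_add)
      have n: "n \<noteq> 0" "of_nat (l + 1) = n"
        using of_nat_neq_0[of l, where ?'a = complex] by (simp_all add: n_def add.commute)
      define Q :: complex where "Q = of_int p ^ (l + 1)"
      have "(-1) ^ l * fact l / W ^ (l + 1) = s * G"
        by (simp add: s_def G_def)
      moreover have "(- 1) ^ (l + 1) = - s"
        by (simp add: s_def)
      ultimately have "(-1) ^ l * fact l / W ^ (l + 1) * RR V l (of_rat r) M \<tau>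
         - (-1) ^ l * of_nat l / of_nat (l + 1) * (of_int c / j) *
        (ellB (l + 1) (of_int (rden r) *\<^sub>R x - of_int (rnum r) *\<^sub>R y) \<tau> / of_int p ^ (l + 1)) =
        s * G * (s / of_int c * S) - s * of_nat l / n * (of_int c / j) * (n * G * (- s * k) / Q)"
        unfolding RR B by (simp only: n k_def s_def [symmetric] n_def [symmetric] Q_def [symmetric])
      also have "\<dots> = (s * s) * (G * (1 / of_int c * S)) + (s * s) * (G * (of_nat l * (of_int c / j) * k / Q))"
        using n(1) by (simp add: mult_ac)
      also have "\<dots> = G * (1 / of_int c * S + of_nat l * (of_int c / j) * k / Q)"
        unfolding ss by (simp only: distrib_left mult_1)
      finally show ?thesis
        by (simp only: Q_def)
    qed
    finally show ?thesis
      by (simp only: j W_def p_def)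
  qed
qed

end

theorem theorem7p1:
  fixes \<tau> :: complex and r :: rat and l :: nat
    and a b c d :: int and V :: "int ^ 2 ^ 2"
    and x y :: "real ^ 2" and M :: "real ^ 2 ^ 2"
  assumes "Im \<tau> > 0"
    and "l > 0"
    and "V = vector [vector [a, b], vector [c, d]]"
    and "det V = 1"
    and "jfac V r \<noteq> 0"
    and "M = vector [x, y]"
    and "y \<notin> Z2"
    and "of_int c *\<^sub>R x + of_int d *\<^sub>R y \<notin> Z2"
    and "of_int (rden r) *\<^sub>R x - of_int (rnum r) *\<^sub>R y \<notin> Z2"
  shows "SS 1 l r M \<tau> - of_rat (jfac V r) ^ (l - 1) * SS 1 l (moebius_act V r) (lmul V M) \<tau> =
      (-1) ^ l * fact l / (2 * of_real pi * \<i>) ^ (l + 1) * RR V l (of_rat r) M \<tau>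
      - (-1) ^ l * of_nat l / of_nat (l + 1) * (of_int c / of_rat (jfac V r)) *
        (ellB (l + 1) (of_int (rden r) *\<^sub>R x - of_int (rnum r) *\<^sub>R y) \<tau>
           / of_int (rden r) ^ (l + 1))"
proof -
  have det: "a * d - b * c = 1"
    using assms(3,4) by (simp add: det_2)
  show ?thesis
  proof (cases "jfac V r > 0")
    case True
    thus ?thesis
      using SS_reciprocity_pos[OF assms(1-3) det _ assms(6-9)] by blast
  next
    case False
    \<comment> \<open>Passing to - V fixes V r, c / j and R_V. The sum for - V M acquires (- 1)^(l +
      1) by parity, which cancels the (- 1)^(l - 1) from the power of - j.\<close>
    have mV: "- V = vector [vector [- a, - b], vector [- c, - d]]"
      by (simp add: assms(3) vec_eq_iff forall_2)
    have jm: "jfac (- V) r = - jfac V r"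
      by (simp add: jfac_def)
    have mm: "moebius_act (- V) r = moebius_act V r"
      by (simp add: moebius_act_def jm add_divide_distrib) (simp add: diff_divide_distrib)
    define r' where "r' = moebius_act V r"
    have jneg: "jfac (- V) r > 0"
      using False assms(5) by (simp add: jm)
    have y': "of_int (- c) *\<^sub>R x + of_int (- d) *\<^sub>R y \<notin> Z2"
    proof -
      have "of_int (- c) *\<^sub>R x + of_int (- d) *\<^sub>R y = - (of_int c *\<^sub>R x + of_int d *\<^sub>R y)"
        by simp
      thus ?thesis
        using assms(8) by (simp only: Z2_uminus_iff not_False_eq_True)
    qed
    have RR: "RR (- V) l (of_rat r) M \<tau> = RR V l (of_rat r) M \<tau>"
      by (auto simp: RR_def)
    have SS: "SS 1 l r' (lmul (- V) M) \<tau> = (- 1) ^ (l + 1) * SS 1 l r' (lmul V M) \<tau>"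
    proof -
      define p q where "p = rden r" and "q = rnum r"
      have p: "p > 0"
        by (simp add: p_def rden_pos)
      have r: "r = of_int q / of_int p"
        unfolding p_def q_def by (rule rat_eq_rnum_rden)
      define p' q' where "p' = (- c) * q + (- d) * p" and "q' = (- a) * q + (- b) * p"
      have det': "(- a) * (- d) - (- b) * (- c) = 1"
        using det by simp
      have jfac: "jfac (- V) r = of_int p' / of_int p"
        unfolding r by (rule jfac_moebius_act_quotient(1)[OF mV _ p'_def q'_def]) (use p in simp)
      have p': "p' > 0"
      proof -
        have "(of_int p' :: rat) > 0"
          using jneg p unfolding jfac by (simp add: zero_less_divide_iff)
        thus ?thesis
          by simp
      qed
      have "moebius_act (- V) r = of_int q' / of_int p'"
        unfolding r by (rule jfac_moebius_act_quotient(2)[OF mV _ p'_def q'_def]) (use p in simp)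
      hence "r' = of_int q' / of_int p'"
        by (simp only: mm r'_def)
      hence rr: "rnum r' = q'" "rden r' = p'"
        using rnum_rden_of_quotient[OF p'] coprime_unimodular[OF det' coprime_rnum_rden[of r]]
        by (simp_all only: p'_def [symmetric] q'_def [symmetric] p_def [symmetric] q_def [symmetric])
      have M': "lmul V M $ 1 = of_int a *\<^sub>R x + of_int b *\<^sub>R y" "lmul V M $ 2 = of_int c *\<^sub>R x + of_int d *\<^sub>R y"
        by (simp_all add: assms(3,6) lmul_vector)
      have "of_int q' *\<^sub>R lmul V M $ 2 - of_int p' *\<^sub>R lmul V M $ 1 = of_int p *\<^sub>R x - of_int q *\<^sub>R y"
      proof -
        have "of_int q' *\<^sub>R lmul V M $ 2 - of_int p' *\<^sub>R lmul V M $ 1 =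
            - (of_int q' *\<^sub>R (of_int (- c) *\<^sub>R x + of_int (- d) *\<^sub>R y) - of_int p' *\<^sub>R (of_int (- a) *\<^sub>R x + of_int (- b) *\<^sub>R y))"
          by (simp add: M' algebra_simps)
        thus ?thesis
          unfolding lattice_form_identity[OF det' p'_def q'_def] by simp
      qed
      hence "of_int q' *\<^sub>R lmul V M $ 2 - of_int p' *\<^sub>R lmul V M $ 1 \<notin> Z2"
        using assms(9) by (simp only: p_def q_def not_False_eq_True)
      thus ?thesis
        using SS_uminus[OF assms(1), of "lmul V M" r' 1 l] assms(8)
        by (simp add: lmul_uminus rr M')
    qed
    have "(- 1) ^ (l - 1) * (- 1) ^ (l + 1) = (1 :: complex)"
      using assms(2) by (simp flip: power_add)
    hence "(- of_rat (jfac V r)) ^ (l - 1) * ((- 1) ^ (l + 1) * Y) = of_rat (jfac V r) ^ (l - 1) * Y" for Y :: complex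
      unfolding power_minus[of "of_rat (jfac V r) :: complex"] by (metis mult.assoc mult.commute mult_1)
    thus ?thesis
      using SS_reciprocity_pos[OF assms(1,2) mV _ jneg assms(6,7) y' assms(9)] det
      by (simp only: SS RR jm mm r'_def [symmetric] of_rat_minus of_int_minus minus_divide_divide mult_minus_left mult_minus_right minus_minus)
  qed
qed

end
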